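(* Let $m\ge 2$ and let $A$ be an abelian transitive state-closed group of degree $m$ (a subgroup of the automorphism group $\mathcal{A}_m$ of the $m$-ary tree). Then: (1) the group $A^{*}$ is (additively) isomorphic to a finitely presented $\mathbb{Z}_m[[x]]$-module; (2) if $A^{*}$ is torsion-free then it is a finitely generated $\mathbb{Z}_m$-module which is also a pro-$m$ group.
   Context: Let $Y=\{1,\dots,m\}$. The vertices of the one-rooted $m$-ary tree $\mathcal{T}_m$ are the finite words over $Y$; $\mathcal{A}_m$ is its automorphism group, acting on the right. A permutation $\gamma\in \mathrm{Perm}(Y)$ is identified with the automorphism $yu\mapsto y^{\gamma}u$. Each $\alpha\in\mathcal{A}_m$ is uniquely written $\alpha=(\alpha_1,\dots,\alpha_m)\sigma(\alpha)$ with $\alpha_i\in\mathcal{A}_m$, $\sigma(\alpha)\in \mathrm{Perm}(Y)$, meaning $(iu)^{\alpha}=i^{\sigma(\alpha)}u^{\alpha_i}$. The states of $\alpha$ are the $\alpha_u$, $u$ a finite word, with $\alpha_{\emptyset}=\alpha$, $\alpha_{yu}=(\alpha_y)_u$. A subgroup $G\le\mathcal{A}_m$ is state-closed (of degree $m$) if all states of its elements lie in $G$; $P(G)$ is the permutation group induced by $G$ on $Y$, and $G$ is transitive if $P(G)$ is transitive on $Y$. $\mathrm{Stab}_G(i)$ is the subgroup of $G$ fixing all vertices of level $i$; $\mathcal{A}_m$ is a topological group with the $\mathrm{Stab}_{\mathcal{A}_m}(i)$ as a base of neighbourhoods of the identity, and $\overline{G}$ is the closure of $G$. Put $\alpha^{(0)}=\alpha$,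 $\alpha^{(1)}=(\alpha,\dots,\alpha)$, $\alpha^{(i+1)}=(\alpha^{(i)})^{(1)}$. The diagonal closure of $G$ is $\widetilde{G}=\langle G^{(i)}\mid i\ge 0\rangle$, and $A^{*}$ is the diagonal-topological closure of $A$, i.e. $A^*=\overline{\widetilde{A}}$. $\mathbb{Z}_m=\varprojlim \mathbb{Z}/m^i\mathbb{Z}$ is the ring of $m$-adic integers. For $A$ abelian, transitive and state-closed, $A^{*}$ is abelian and, written additively, is a $\mathbb{Z}_m[[x]]$-module: $\mathbb{Z}_m$ acts by $m$-adic exponentiation ($\alpha^{\xi}=\lim \alpha^{n_k}$ for integers $n_k\to\xi$), $x$ acts by $\alpha\mapsto\alpha^{(1)}$, and $\sum_{i\ge0} q_ix^i$ acts by $\alpha\mapsto \alpha^{q_0}(\alpha^{q_1})^{(1)}(\alpha^{q_2})^{(2)}\cdots$. That $A^*$ is a pro-$m$ group refers to the topology inherited from the tree being the pro-$m$ topology: for every $i$ there is $l(i)\ge1$ with $\mathrm{Stab}_{A^*}(l(i))\le m^iA^*$, so that the subgroups $m^iA^*$ form a base of neighbourhoods of the identity. *)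

theory Defs
  imports "HOL-Combinatorics.Permutations" "HOL-Algebra.Module" "HOL-Algebra.Generated_Groups" "HOL-Analysis.Function_Topology"
begin

section \<open>The rooted tree and its automorphism group\<close>

definition words :: "nat \<Rightarrow> nat list set" where
  "words m = lists {1..m}"

definition tree_edge :: "nat \<Rightarrow> nat list \<Rightarrow> nat list \<Rightarrow> bool" where
  "tree_edge m u v \<longleftrightarrow> u \<in> words m \<and> (\<exists>y\<in>{1..m}. v = u @ [y])"

text \<open>
  Edges point away from the root. The root is the only vertex without incoming edge, so it is fixed.
  An automorphism is extended by the identity to lists that are not words over the alphabet.
\<close>

definition tree_automs :: "nat \<Rightarrow> (nat list \<Rightarrow> nat list) set" where
  "tree_automs m = {\<alpha>. \<alpha> permutes words m \<and>
     (\<forall>u\<in>words m. \<forall>v\<in>words m. tree_edge m (\<alpha> u) (\<alpha> v) \<longleftrightarrow> tree_edge m u v)}"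

text \<open>Automorphisms act on the right: a product applies its left factor first.\<close>

definition tree_aut_group :: "nat \<Rightarrow> (nat list \<Rightarrow> nat list) monoid" where
  "tree_aut_group m = \<lparr>carrier = tree_automs m, mult = (\<lambda>\<alpha> \<beta>. \<beta> \<circ> \<alpha>), one = id\<rparr>"

abbreviation tree_subgroup :: "nat \<Rightarrow> (nat list \<Rightarrow> nat list) set \<Rightarrow> (nat list \<Rightarrow> nat list) monoid" where
  "tree_subgroup m G \<equiv> tree_aut_group m\<lparr>carrier := G\<rparr>"

text \<open>
  For \<open>\<alpha> = (\<alpha>\<^sub>1, \<dots>, \<alpha>\<^sub>m)\<sigma>(\<alpha>)\<close> the image of \<open>y # u\<close> under \<open>\<alpha>\<close> is the image of \<open>y\<close> under \<open>\<sigma>(\<alpha>)\<close>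
  followed by the image of \<open>u\<close> under \<open>\<alpha>\<^sub>y\<close>; \<open>root_perm \<alpha>\<close> is \<open>\<sigma>(\<alpha>)\<close> and \<open>section_at \<alpha> y\<close> is \<open>\<alpha>\<^sub>y\<close>.
\<close>

definition root_perm :: "(nat list \<Rightarrow> nat list) \<Rightarrow> nat \<Rightarrow> nat" where
  "root_perm \<alpha> y = hd (\<alpha> [y])"

definition section_at :: "(nat list \<Rightarrow> nat list) \<Rightarrow> nat \<Rightarrow> nat list \<Rightarrow> nat list" where
  "section_at \<alpha> y = (\<lambda>u. tl (\<alpha> (y # u)))"

primrec state :: "(nat list \<Rightarrow> nat list) \<Rightarrow> nat list \<Rightarrow> nat list \<Rightarrow> nat list" where
  "state \<alpha> [] = \<alpha>"
| "state \<alpha> (y # u) = state (section_at \<alpha> y) u"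

definition state_closed :: "nat \<Rightarrow> (nat list \<Rightarrow> nat list) set \<Rightarrow> bool" where
  "state_closed m G \<longleftrightarrow> (\<forall>\<alpha>\<in>G. \<forall>u\<in>words m. state \<alpha> u \<in> G)"

definition perm_group_on_letters :: "(nat list \<Rightarrow> nat list) set \<Rightarrow> (nat \<Rightarrow> nat) set" where
  "perm_group_on_letters G = root_perm ` G"

definition transitive_on_letters :: "nat \<Rightarrow> (nat list \<Rightarrow> nat list) set \<Rightarrow> bool" where
  "transitive_on_letters m G \<longleftrightarrow>
     (\<forall>i\<in>{1..m}. \<forall>j\<in>{1..m}. \<exists>\<sigma>\<in>perm_group_on_letters G. \<sigma> i = j)"

definition level_stab :: "nat \<Rightarrow> (nat list \<Rightarrow> nat list) set \<Rightarrow> nat \<Rightarrow> (nat list \<Rightarrow> nat list) set" where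
  "level_stab m G i = {\<alpha>\<in>G. \<forall>u\<in>words m. length u = i \<longrightarrow> \<alpha> u = u}"


section \<open>Topology and the diagonal-topological closure\<close>

text \<open>
  For a descending chain \<open>N\<close> of normal subgroups, this is the group topology on \<open>G\<close> in which the
  \<open>N i\<close> form a base of neighbourhoods of the identity; the cosets are then a base of the topology.
\<close>

definition coset_topology :: "('a, 'b) monoid_scheme \<Rightarrow> (nat \<Rightarrow> 'a set) \<Rightarrow> 'a topology" where
  "coset_topology G N = topology_generated_by {g <#\<^bsub>G\<^esub> N i | g i. g \<in> carrier G}"

definition tree_topology :: "nat \<Rightarrow> (nat list \<Rightarrow> nat list) topology" where
  "tree_topology m = coset_topology (tree_aut_group m) (level_stab m (tree_automs m))"

text \<open>The automorphism \<open>\<alpha>\<^sup>(\<^sup>1\<^sup>) = (\<alpha>, \<dots>, \<alpha>)\<close>.\<close>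

definition diag :: "nat \<Rightarrow> (nat list \<Rightarrow> nat list) \<Rightarrow> nat list \<Rightarrow> nat list" where
  "diag m \<alpha> w = (case w of [] \<Rightarrow> [] | y # u \<Rightarrow> if y \<in> {1..m} then y # \<alpha> u else y # u)"

definition diagonal_closure :: "nat \<Rightarrow> (nat list \<Rightarrow> nat list) set \<Rightarrow> (nat list \<Rightarrow> nat list) set" where
  "diagonal_closure m G = generate (tree_aut_group m) (\<Union>i. (diag m ^^ i) ` G)"

definition astar :: "nat \<Rightarrow> (nat list \<Rightarrow> nat list) set \<Rightarrow> (nat list \<Rightarrow> nat list) set" where
  "astar m A = tree_topology m closure_of diagonal_closure m A"


section \<open>The rings of m-adic integers and of formal power series\<close>

text \<open>Elements of the inverse limit are compatible families of least nonnegative residues.\<close>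

definition madic_ring :: "nat \<Rightarrow> (nat \<Rightarrow> int) ring" where
  "madic_ring m =
    \<lparr>carrier = {a. \<forall>i. a i \<in> {0..<int m ^ i} \<and> a (Suc i) mod int m ^ i = a i},
     monoid.mult = (\<lambda>a b i. (a i * b i) mod int m ^ i),
     one = (\<lambda>i. 1 mod int m ^ i),
     zero = (\<lambda>i. 0),
     add = (\<lambda>a b i. (a i + b i) mod int m ^ i)\<rparr>"

definition madic_tendsto :: "nat \<Rightarrow> (nat \<Rightarrow> int) \<Rightarrow> (nat \<Rightarrow> int) \<Rightarrow> bool" where
  "madic_tendsto m n \<xi> \<longleftrightarrow> (\<forall>i. \<forall>\<^sub>F k in sequentially. n k mod int m ^ i = \<xi> i)"

definition power_series_ring :: "('a, 'b) ring_scheme \<Rightarrow> (nat \<Rightarrow> 'a) ring" where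
  "power_series_ring R =
    \<lparr>carrier = UNIV \<rightarrow> carrier R,
     monoid.mult = (\<lambda>p q n. finsum R (\<lambda>i. p i \<otimes>\<^bsub>R\<^esub> q (n - i)) {..n}),
     one = (\<lambda>n. if n = 0 then \<one>\<^bsub>R\<^esub> else \<zero>\<^bsub>R\<^esub>),
     zero = (\<lambda>n. \<zero>\<^bsub>R\<^esub>),
     add = (\<lambda>p q n. p n \<oplus>\<^bsub>R\<^esub> q n)\<rparr>"


section \<open>Finitely generated and finitely presented modules\<close>

text \<open>
  Modules are records extending rings; the ring multiplication and unit play no role for them
  and are left unspecified here and below.
\<close>

definition free_module :: "('a, 'b) ring_scheme \<Rightarrow> nat \<Rightarrow> ('a, nat \<Rightarrow> 'a) module" where
  "free_module R n =
    \<lparr>carrier = {..<n} \<rightarrow>\<^sub>E carrier R, monoid.mult = undefined, one = undefined,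
     zero = (\<lambda>i\<in>{..<n}. \<zero>\<^bsub>R\<^esub>),
     add = (\<lambda>v w. \<lambda>i\<in>{..<n}. v i \<oplus>\<^bsub>R\<^esub> w i),
     smult = (\<lambda>r v. \<lambda>i\<in>{..<n}. r \<otimes>\<^bsub>R\<^esub> v i)\<rparr>"

definition linear_maps ::
    "('a, 'r) ring_scheme \<Rightarrow> ('a, 'b, 'm) module_scheme \<Rightarrow> ('a, 'c, 'n) module_scheme \<Rightarrow> ('b \<Rightarrow> 'c) set" where
  "linear_maps R M N = {f \<in> carrier M \<rightarrow> carrier N.
     (\<forall>x\<in>carrier M. \<forall>y\<in>carrier M. f (x \<oplus>\<^bsub>M\<^esub> y) = f x \<oplus>\<^bsub>N\<^esub> f y) \<and>
     (\<forall>r\<in>carrier R. \<forall>x\<in>carrier M. f (r \<odot>\<^bsub>M\<^esub> x) = r \<odot>\<^bsub>N\<^esub> f x)}"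

definition submodule_span ::
    "('a, 'r) ring_scheme \<Rightarrow> ('a, 'b) module \<Rightarrow> 'b set \<Rightarrow> 'b set" where
  "submodule_span R M S = \<Inter> {N. submodule N R M \<and> S \<subseteq> N}"

definition finitely_generated_module ::
    "('a, 'r) ring_scheme \<Rightarrow> ('a, 'b) module \<Rightarrow> bool" where
  "finitely_generated_module R M \<longleftrightarrow> Module.module R M \<and>
     (\<exists>S. finite S \<and> S \<subseteq> carrier M \<and> submodule_span R M S = carrier M)"

definition finitely_presented_module ::
    "('a, 'r) ring_scheme \<Rightarrow> ('a, 'b) module \<Rightarrow> bool" where
  "finitely_presented_module R M \<longleftrightarrow> Module.module R M \<and>
     (\<exists>n. \<exists>f\<in>linear_maps R (free_module R n) M.
        f ` carrier (free_module R n) = carrier M \<and>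
        (\<exists>S. finite S \<and> S \<subseteq> carrier (free_module R n) \<and>
          submodule_span R (free_module R n) S = {v\<in>carrier (free_module R n). f v = \<zero>\<^bsub>M\<^esub>}))"


section \<open>The module structures on the closure\<close>

definition madic_power :: "nat \<Rightarrow> (nat \<Rightarrow> int) \<Rightarrow> (nat list \<Rightarrow> nat list) \<Rightarrow> (nat list \<Rightarrow> nat list)" where
  "madic_power m \<xi> \<alpha> = (THE \<beta>. \<forall>n. madic_tendsto m n \<xi> \<longrightarrow>
     limitin (tree_topology m) (\<lambda>k. \<alpha> [^]\<^bsub>tree_aut_group m\<^esub> (n k :: int)) \<beta> sequentially)"

text \<open>The infinite product \<open>\<alpha>\<^sup>q\<^sup>0 (\<alpha>\<^sup>q\<^sup>1)\<^sup>(\<^sup>1\<^sup>) (\<alpha>\<^sup>q\<^sup>2)\<^sup>(\<^sup>2\<^sup>) \<cdots>\<close>.\<close>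

definition power_series_action ::
    "nat \<Rightarrow> (nat list \<Rightarrow> nat list) set \<Rightarrow> (nat \<Rightarrow> nat \<Rightarrow> int) \<Rightarrow> (nat list \<Rightarrow> nat list) \<Rightarrow> (nat list \<Rightarrow> nat list)" where
  "power_series_action m A q \<alpha> = (THE \<beta>. limitin (tree_topology m)
     (\<lambda>n. finprod (tree_subgroup m (astar m A)) (\<lambda>i. (diag m ^^ i) (madic_power m (q i) \<alpha>)) {..<n})
     \<beta> sequentially)"

definition additive_module :: "('b, 'c) monoid_scheme \<Rightarrow> ('a \<Rightarrow> 'b \<Rightarrow> 'b) \<Rightarrow> ('a, 'b) module" where
  "additive_module G act =
    \<lparr>carrier = carrier G, monoid.mult = undefined, one = undefined,
     zero = \<one>\<^bsub>G\<^esub>, add = (\<lambda>x y. x \<otimes>\<^bsub>G\<^esub> y), smult = act\<rparr>"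

definition astar_power_series_module ::
    "nat \<Rightarrow> (nat list \<Rightarrow> nat list) set \<Rightarrow> (nat \<Rightarrow> nat \<Rightarrow> int, nat list \<Rightarrow> nat list) module" where
  "astar_power_series_module m A =
     additive_module (tree_subgroup m (astar m A)) (power_series_action m A)"

definition astar_madic_module ::
    "nat \<Rightarrow> (nat list \<Rightarrow> nat list) set \<Rightarrow> (nat \<Rightarrow> int, nat list \<Rightarrow> nat list) module" where
  "astar_madic_module m A = additive_module (tree_subgroup m (astar m A)) (madic_power m)"


section \<open>Torsion-free and pro-m groups\<close>

definition torsion_free_group :: "('a, 'b) monoid_scheme \<Rightarrow> bool" where
  "torsion_free_group G \<longleftrightarrow> (\<forall>a\<in>carrier G. \<forall>n>0. a [^]\<^bsub>G\<^esub> (n::nat) = \<one>\<^bsub>G\<^esub> \<longrightarrow> a = \<one>\<^bsub>G\<^esub>)"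

text \<open>In additive notation this is \<open>nG\<close>.\<close>

definition nth_multiples :: "('a, 'b) monoid_scheme \<Rightarrow> nat \<Rightarrow> 'a set" where
  "nth_multiples G n = (\<lambda>a. a [^]\<^bsub>G\<^esub> n) ` carrier G"

text \<open>
  For an abelian group of tree automorphisms: every \<open>m\<^sup>iG\<close> contains a level stabilizer, and the
  topology inherited from the tree is the pro-\<open>m\<close> topology, in which the \<open>m\<^sup>iG\<close> form a base of
  neighbourhoods of the identity.
\<close>

definition pro_m_group :: "nat \<Rightarrow> (nat list \<Rightarrow> nat list) set \<Rightarrow> bool" where
  "pro_m_group m G \<longleftrightarrow>
     (\<forall>i. \<exists>l\<ge>1. level_stab m G l \<subseteq> nth_multiples (tree_subgroup m G) (m ^ i)) \<and>
     subtopology (tree_topology m) G =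
       coset_topology (tree_subgroup m G) (\<lambda>i. nth_multiples (tree_subgroup m G) (m ^ i))"

end

theory Submission
  imports Defs "HOL-Computational_Algebra.Formal_Power_Series" "HOL-Number_Theory.Cong"
begin

text \<open>
  Write \<open>G\<close> for \<open>A\<^sup>*\<close>, additively, and \<open>x\<close> for the diagonal endomorphism \<open>\<alpha> \<mapsto> \<alpha>\<^sup>(\<^sup>1\<^sup>)\<close>. All conditions on
  \<open>A\<close> pass to the group generated by the \<open>A\<^sup>(\<^sup>i\<^sup>)\<close> and then to its closure, so \<open>G\<close> is abelian, transitive and
  state-closed, closed under \<open>x\<close> and closed in the tree topology.
  
  The group induced on the letters is abelian and transitive, hence regular. If \<open>g \<in> G\<close> fixes the letters
  and \<open>h \<in> G\<close> takes the letter \<open>1\<close> to \<open>y\<close>, then \<open>g h = h g\<close> forces the states of \<open>g\<close> at \<open>1\<close> and at \<open>y\<close> to be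
  equal; so \<open>g\<close> is in \<open>x G\<close>, and by induction the stabilizer of level \<open>N\<close> is \<open>x\<^sup>N G\<close> (\<open>fixing_first_level\<close>,
  \<open>fixing_level\<close>). Thus \<open>x\<close> is injective, \<open>G / x G\<close> has order \<open>m\<close>, so \<open>m G\<close> is contained in \<open>x G\<close>, and \<open>G\<close> is
  complete in the \<open>x\<close>-adic topology, which is the tree topology (\<open>adic\<close>). The rest uses only these properties,
  collected in the locale \<open>adic_group\<close>. Since \<open>m\<^sup>N G \<subseteq> x\<^sup>N G\<close>, a power series over \<open>\<int>\<^sub>m\<close> acts on
  \<open>G / x\<^sup>N G\<close> through its residue modulo \<open>m\<^sup>N\<close>, an integral power series; in this way all computations take place
  over \<open>\<int>[[x]]\<close>.
  
  Finite presentation. Representatives \<open>t\<^sub>j\<close> of \<open>G / x G\<close> generate \<open>G\<close>, because every element is a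
  convergent sum of terms \<open>x\<^sup>i t\<^sub>j\<close>. Let \<open>K\<close> be the kernel of the resulting map onto \<open>G\<close> from a free module over
  \<open>\<int>\<^sub>m[[x]]\<close>. As \<open>x\<close> is injective on \<open>G\<close>, a vector \<open>x v\<close> in \<open>K\<close> has \<open>v\<close> in \<open>K\<close>. The constant coefficients of
  the vectors in \<open>K\<close> form a submodule over \<open>\<int>\<^sub>m\<close>; it contains all multiples of \<open>m\<close>, because \<open>m G \<subseteq> x G\<close>, and
  is therefore generated by finitely many integral vectors. Relations with these constant coefficients generate
  \<open>K\<close> modulo \<open>x K\<close> (\<open>kernel_step\<close>), hence \<open>K\<close> itself, by completeness of \<open>\<int>\<^sub>m[[x]]\<close> (\<open>kernel_expansion\<close>).
  
  The torsion-free case. The point is that every \<open>n G\<close> with \<open>n > 0\<close> contains some \<open>x\<^sup>l G\<close> (\<open>powers_contain_xpow\<close>).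
  For a prime \<open>p\<close> and \<open>g \<in> G\<close>, counting polynomials against cosets of \<open>x\<^sup>2\<^sup>N G\<close> gives integral power series \<open>F\<close>
  with bounded coefficients, nonzero constant coefficient and \<open>F g \<in> x\<^sup>N G\<close>; a limit of them satisfies \<open>F g = 0\<close>
  (\<open>exact_relation\<close>). As \<open>G\<close> is torsion-free, powers of \<open>p\<close> can be divided out of \<open>F\<close>. Then \<open>F\<close> is, modulo
  \<open>p\<close>, a unit times some \<open>x\<^sup>l\<close>, so \<open>x\<^sup>l g \<in> p G\<close> (\<open>xpow_is_prime_power\<close>). Finitely many \<open>g\<close> generate \<open>G\<close>, and the
  primes dividing \<open>n\<close> are treated one after the other. Consequently \<open>G / m G\<close> is finite, which by completeness
  makes \<open>G\<close> finitely generated over \<open>\<int>\<^sub>m\<close>, and the chains \<open>m\<^sup>i G\<close> and \<open>x\<^sup>i G\<close> are cofinal.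
\<close>

section \<open>The m-adic integers\<close>

lemma madic_ring_simps [simp]:
  "mult (madic_ring m) a b = (\<lambda>i. (a i * b i) mod int m ^ i)"
  "one (madic_ring m) = (\<lambda>i. 1 mod int m ^ i)"
  "zero (madic_ring m) = (\<lambda>i. 0)"
  "add (madic_ring m) a b = (\<lambda>i. (a i + b i) mod int m ^ i)"
  by (simp_all add: madic_ring_def)

lemma madic_carrier_iff:
  assumes "m \<ge> 1"
  shows "a \<in> carrier (madic_ring m) \<longleftrightarrow>
    (\<forall>i. a i mod int m ^ i = a i) \<and> (\<forall>i. a (Suc i) mod int m ^ i = a i)"
proof -
  have "b \<in> {0..<int m ^ i} \<longleftrightarrow> b mod int m ^ i = b" for b i
    using assms by (auto simp: mod_pos_pos_trivial) (metis assms of_nat_0_less_iff less_le_trans zero_less_one pos_mod_sign pos_mod_bound zero_less_power)+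
  then show ?thesis by (auto simp: madic_ring_def simp del: atLeastLessThan_iff)
qed

lemma madic_reduce_carrier:
  assumes "m \<ge> 1" and "\<And>i. [c (Suc i) = c i] (mod int m ^ i)"
  shows "(\<lambda>i. c i mod int m ^ i) \<in> carrier (madic_ring m)"
proof -
  have "c (Suc i) mod int m ^ Suc i mod int m ^ i = c i mod int m ^ i" for i
    using assms(2)[of i] by (simp add: cong_def mod_mod_cancel)
  then show ?thesis using assms(1) by (simp add: madic_carrier_iff)
qed

lemma madic_carrier_cong:
  assumes "m \<ge> 1" "a \<in> carrier (madic_ring m)"
  shows "[a (Suc i) = a i] (mod int m ^ i)"
  using assms by (simp add: madic_carrier_iff cong_def)

lemma madic_carrier_cong_le:
  assumes "m \<ge> 1" "a \<in> carrier (madic_ring m)" "i \<le> j"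
  shows "[a j = a i] (mod int m ^ i)"
  using \<open>i \<le> j\<close>
proof (induction j rule: dec_induct)
  case (step n)
  have "[a (Suc n) = a n] (mod int m ^ i)"
    using madic_carrier_cong[OF assms(1,2), of n] step(1)
    by (meson cong_dvd_modulus le_imp_power_dvd)
  then show ?case using step cong_trans by blast
qed simp

lemma madic_eqI:
  assumes "m \<ge> 1" "a \<in> carrier (madic_ring m)" "b \<in> carrier (madic_ring m)"
    and "\<And>i. [a i = b i] (mod int m ^ i)"
  shows "a = b"
  using assms by (auto simp: madic_carrier_iff cong_def fun_eq_iff)

lemma madic_ring_cring:
  assumes m: "m \<ge> 1"
  shows "cring (madic_ring m)"
proof (rule cringI)
  let ?Z = "madic_ring m"
  have add_closed: "a \<oplus>\<^bsub>?Z\<^esub> b \<in> carrier ?Z" if "a \<in> carrier ?Z" "b \<in> carrier ?Z" for a b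
    using madic_reduce_carrier[OF m, of "\<lambda>i. a i + b i"] that m
    by (simp add: cong_add madic_carrier_cong)
  have mult_closed: "a \<otimes>\<^bsub>?Z\<^esub> b \<in> carrier ?Z" if "a \<in> carrier ?Z" "b \<in> carrier ?Z" for a b
    using madic_reduce_carrier[OF m, of "\<lambda>i. a i * b i"] that m
    by (simp add: cong_mult madic_carrier_cong)
  have zero_closed: "\<zero>\<^bsub>?Z\<^esub> \<in> carrier ?Z"
    using madic_reduce_carrier[OF m, of "\<lambda>i. 0"] by simp
  have one_closed: "\<one>\<^bsub>?Z\<^esub> \<in> carrier ?Z"
    using madic_reduce_carrier[OF m, of "\<lambda>i. 1"] by simp
  have res: "a i mod int m ^ i = a i" if "a \<in> carrier ?Z" for a i
    using that m by (simp add: madic_carrier_iff)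
  show "abelian_group ?Z"
  proof (rule abelian_groupI, goal_cases)
    case (6 a)
    have "[- a (Suc i) = - a i] (mod int m ^ i)" for i
      using madic_carrier_cong[OF m 6, of i] by (simp add: cong_minus_minus_iff)
    then have "(\<lambda>i. (- a i) mod int m ^ i) \<in> carrier ?Z"
      by (rule madic_reduce_carrier[OF m])
    moreover have "(\<lambda>i. (- a i) mod int m ^ i) \<oplus>\<^bsub>?Z\<^esub> a = \<zero>\<^bsub>?Z\<^esub>"
      by (simp add: mod_simps)
    ultimately show ?case by blast
  qed (use add_closed zero_closed in \<open>auto simp: fun_eq_iff mod_simps res ac_simps\<close>)
  show "comm_monoid ?Z"
    by (rule comm_monoidI) (use mult_closed one_closed in \<open>auto simp: fun_eq_iff mod_simps res ac_simps\<close>)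
  show "(a \<oplus>\<^bsub>?Z\<^esub> b) \<otimes>\<^bsub>?Z\<^esub> c = a \<otimes>\<^bsub>?Z\<^esub> c \<oplus>\<^bsub>?Z\<^esub> b \<otimes>\<^bsub>?Z\<^esub> c"
    if "a \<in> carrier ?Z" "b \<in> carrier ?Z" "c \<in> carrier ?Z" for a b c
    by (simp add: fun_eq_iff mod_simps distrib_right)
qed

lemma madic_finsum:
  assumes m: "m \<ge> 1" and "finite I" "\<And>k. k \<in> I \<Longrightarrow> f k \<in> carrier (madic_ring m)"
  shows "finsum (madic_ring m) f I = (\<lambda>i. (\<Sum>k\<in>I. f k i) mod int m ^ i)"
proof -
  interpret Z: cring "madic_ring m" using madic_ring_cring[OF m] .
  show ?thesis using assms(2,3)
  proof (induction I rule: finite_induct)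
    case (insert k I)
    then have "f k \<in> carrier (madic_ring m)" "f \<in> I \<rightarrow> carrier (madic_ring m)" by auto
    then show ?case using insert by (simp add: Z.finsum_insert mod_simps)
  qed simp
qed

section \<open>Congruences between integral power series\<close>

definition fps_cong :: "int \<Rightarrow> int fps \<Rightarrow> int fps \<Rightarrow> bool" where
  "fps_cong n f g \<longleftrightarrow> (\<forall>i. [fps_nth f i = fps_nth g i] (mod n))"

lemma fps_cong_refl [simp]: "fps_cong n f f"
  by (simp add: fps_cong_def)

lemma fps_cong_sym: "fps_cong n f g \<Longrightarrow> fps_cong n g f"
  by (simp add: fps_cong_def cong_sym)

lemma fps_cong_trans [trans]: "fps_cong n f g \<Longrightarrow> fps_cong n g h \<Longrightarrow> fps_cong n f h"
  unfolding fps_cong_def using cong_trans by blast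

lemma fps_cong_add: "fps_cong n f g \<Longrightarrow> fps_cong n f' g' \<Longrightarrow> fps_cong n (f + f') (g + g')"
  by (simp add: fps_cong_def cong_add)

lemma fps_cong_mult: "fps_cong n f g \<Longrightarrow> fps_cong n f' g' \<Longrightarrow> fps_cong n (f * f') (g * g')"
  by (simp add: fps_cong_def fps_mult_nth cong_sum cong_mult)

lemma fps_cong_sum: "(\<And>k. k \<in> I \<Longrightarrow> fps_cong n (f k) (g k)) \<Longrightarrow> fps_cong n (sum f I) (sum g I)"
  by (simp add: fps_cong_def fps_sum_nth cong_sum)

section \<open>Power series over the m-adic integers\<close>

abbreviation madic_series :: "nat \<Rightarrow> (nat \<Rightarrow> nat \<Rightarrow> int) ring" where
  "madic_series m \<equiv> power_series_ring (madic_ring m)"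

text \<open>
  An element of the inverse limit is a family of residues, so a power series over the \<open>m\<close>-adic integers
  is a family of integral power series, the \<open>N\<close>-th one being relevant modulo \<open>m ^ N\<close> only.
\<close>

definition residue_series :: "nat \<Rightarrow> (nat \<Rightarrow> nat \<Rightarrow> int) \<Rightarrow> int fps" where
  "residue_series N q = Abs_fps (\<lambda>i. q i N)"

definition series_of_fps :: "nat \<Rightarrow> int fps \<Rightarrow> nat \<Rightarrow> nat \<Rightarrow> int" where
  "series_of_fps m F = (\<lambda>i N. fps_nth F i mod int m ^ N)"

lemma residue_series_nth [simp]: "fps_nth (residue_series N q) i = q i N"
  by (simp add: residue_series_def)

lemma series_carrier_iff: "q \<in> carrier (madic_series m) \<longleftrightarrow> (\<forall>i. q i \<in> carrier (madic_ring m))"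
  by (auto simp: power_series_ring_def)

lemma series_of_fps_carrier: "m \<ge> 1 \<Longrightarrow> series_of_fps m F \<in> carrier (madic_series m)"
  by (simp add: series_carrier_iff series_of_fps_def madic_reduce_carrier)

lemma residue_series_of_fps: "fps_cong (int m ^ N) (residue_series N (series_of_fps m F)) F"
  by (simp add: fps_cong_def series_of_fps_def cong_def)

lemma residue_series_zero [simp]: "residue_series N \<zero>\<^bsub>madic_series m\<^esub> = 0"
  by (rule fps_ext) (simp add: power_series_ring_def)

lemma residue_series_one: "fps_cong (int m ^ N) (residue_series N \<one>\<^bsub>madic_series m\<^esub>) 1"
  by (simp add: fps_cong_def power_series_ring_def cong_def)

lemma residue_series_add:
  "fps_cong (int m ^ N) (residue_series N (p \<oplus>\<^bsub>madic_series m\<^esub> q)) (residue_series N p + residue_series N q)"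
  by (simp add: fps_cong_def power_series_ring_def cong_def)

lemma series_mult_eq:
  assumes "m \<ge> 1" "p \<in> carrier (madic_series m)" "q \<in> carrier (madic_series m)"
  shows "p \<otimes>\<^bsub>madic_series m\<^esub> q = (\<lambda>n N. (\<Sum>i\<le>n. p i N * q (n - i) N) mod int m ^ N)"
proof -
  interpret Z: cring "madic_ring m" using madic_ring_cring[OF assms(1)] .
  have "p i \<otimes>\<^bsub>madic_ring m\<^esub> q j \<in> carrier (madic_ring m)" for i j
    by (rule Z.m_closed) (use assms in \<open>simp_all add: series_carrier_iff\<close>)
  then have "finsum (madic_ring m) (\<lambda>i. p i \<otimes>\<^bsub>madic_ring m\<^esub> q (n - i)) {..n} =
      (\<lambda>N. (\<Sum>i\<le>n. (p i \<otimes>\<^bsub>madic_ring m\<^esub> q (n - i)) N) mod int m ^ N)" for n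
    by (intro madic_finsum assms(1)) auto
  then show ?thesis by (simp add: power_series_ring_def mod_sum_eq)
qed

lemma residue_series_mult:
  assumes "m \<ge> 1" "p \<in> carrier (madic_series m)" "q \<in> carrier (madic_series m)"
  shows "fps_cong (int m ^ N) (residue_series N (p \<otimes>\<^bsub>madic_series m\<^esub> q)) (residue_series N p * residue_series N q)"
  by (simp add: series_mult_eq[OF assms] fps_cong_def fps_mult_nth cong_def atLeast0AtMost)

lemma series_eqI:
  assumes "m \<ge> 1" "p \<in> carrier (madic_series m)" "q \<in> carrier (madic_series m)"
    and "\<And>N. fps_cong (int m ^ N) (residue_series N p) (residue_series N q)"
  shows "p = q"
proof
  fix i
  show "p i = q i"
    by (rule madic_eqI[OF assms(1)]) (use assms in \<open>auto simp: series_carrier_iff fps_cong_def\<close>)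
qed

text \<open>
  In each ring law both sides are congruent, modulo every \<open>m ^ N\<close>, to the corresponding expressions in the ring of
  integral power series, where the law is known.
\<close>

lemma madic_series_cring:
  assumes m: "m \<ge> 1"
  shows "cring (madic_series m)"
proof -
  interpret Z: cring "madic_ring m" using madic_ring_cring[OF m] .
  let ?R = "madic_series m"
  have zero_closed: "\<zero>\<^bsub>?R\<^esub> \<in> carrier ?R" and one_closed: "\<one>\<^bsub>?R\<^esub> \<in> carrier ?R"
    using Z.zero_closed Z.one_closed by (auto simp: power_series_ring_def simp del: madic_ring_simps)
  have add_closed: "p \<oplus>\<^bsub>?R\<^esub> q \<in> carrier ?R" if "p \<in> carrier ?R" "q \<in> carrier ?R" for p q
    using that Z.a_closed by (auto simp: power_series_ring_def Pi_iff simp del: madic_ring_simps)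
  have mult_closed: "p \<otimes>\<^bsub>?R\<^esub> q \<in> carrier ?R" if "p \<in> carrier ?R" "q \<in> carrier ?R" for p q
    using that by (auto simp: power_series_ring_def simp del: madic_ring_simps intro!: Z.finsum_closed Z.m_closed)
  note [simp] = zero_closed one_closed add_closed mult_closed
  note eqI = series_eqI[OF m]
  let ?c = "\<lambda>N. fps_cong (int m ^ N)"
  have trans_sym: "?c N f h \<Longrightarrow> ?c N g h' \<Longrightarrow> h = h' \<Longrightarrow> ?c N f g" for N f g h h'
    using fps_cong_trans fps_cong_sym by blast
  have add: "?c N (residue_series N (p \<oplus>\<^bsub>?R\<^esub> q)) (f + g)"
    if "?c N (residue_series N p) f" "?c N (residue_series N q) g" for N p q f g
    using residue_series_add fps_cong_add[OF that] fps_cong_trans by blast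
  have mult: "?c N (residue_series N (p \<otimes>\<^bsub>?R\<^esub> q)) (f * g)"
    if "p \<in> carrier ?R" "q \<in> carrier ?R" "?c N (residue_series N p) f" "?c N (residue_series N q) g" for N p q f g
    using residue_series_mult[OF m that(1,2)] fps_cong_mult[OF that(3,4)] fps_cong_trans by blast
  note eq = eqI[OF _ _ trans_sym]
  show ?thesis
  proof (rule cringI)
    show "abelian_group ?R"
    proof (rule abelian_groupI, goal_cases)
      case (3 p q r)
      show ?case
        by (rule eq[OF _ _ add[OF add[OF fps_cong_refl fps_cong_refl] fps_cong_refl]
              add[OF fps_cong_refl add[OF fps_cong_refl fps_cong_refl]]]) (simp_all add: 3)
    next
      case (4 p q)
      show ?case
        by (rule eq[OF _ _ add[OF fps_cong_refl fps_cong_refl] add[OF fps_cong_refl fps_cong_refl]])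
          (simp_all add: 4)
    next
      case (5 p)
      show ?case
        by (rule eq[OF _ _ add[OF fps_cong_refl fps_cong_refl] fps_cong_refl]) (simp_all add: 5)
    next
      case (6 p)
      let ?n = "\<lambda>i. \<ominus>\<^bsub>madic_ring m\<^esub> p i"
      have p: "\<And>i. p i \<in> carrier (madic_ring m)" using 6 by (simp add: series_carrier_iff)
      then have "?n \<in> carrier ?R" by (simp add: series_carrier_iff del: madic_ring_simps)
      moreover have "?n \<oplus>\<^bsub>?R\<^esub> p = \<zero>\<^bsub>?R\<^esub>"
        using Z.l_neg[OF p] by (simp add: power_series_ring_def del: madic_ring_simps)
      ultimately show ?case by blast
    qed auto
    show "comm_monoid ?R"
    proof (rule comm_monoidI, goal_cases)
      case (3 p q r)
      show ?case
        by (rule eq[OF _ _ mult[OF _ _ mult[OF _ _ fps_cong_refl fps_cong_refl] fps_cong_refl]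
              mult[OF _ _ fps_cong_refl mult[OF _ _ fps_cong_refl fps_cong_refl]]])
          (simp_all add: 3 mult.assoc)
    next
      case (4 p)
      show ?case
        by (rule eq[OF _ _ mult[OF _ _ residue_series_one fps_cong_refl] fps_cong_refl]) (simp_all add: 4)
    next
      case (5 p q)
      show ?case
        by (rule eq[OF _ _ mult[OF _ _ fps_cong_refl fps_cong_refl] mult[OF _ _ fps_cong_refl fps_cong_refl]])
          (simp_all add: 5)
    qed auto
    show "(p \<oplus>\<^bsub>?R\<^esub> q) \<otimes>\<^bsub>?R\<^esub> r = p \<otimes>\<^bsub>?R\<^esub> r \<oplus>\<^bsub>?R\<^esub> q \<otimes>\<^bsub>?R\<^esub> r"
      if "p \<in> carrier ?R" "q \<in> carrier ?R" "r \<in> carrier ?R" for p q r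
      by (rule eq[OF _ _ mult[OF _ _ add[OF fps_cong_refl fps_cong_refl] fps_cong_refl]
              add[OF mult[OF _ _ fps_cong_refl fps_cong_refl] mult[OF _ _ fps_cong_refl fps_cong_refl]]])
        (simp_all add: that distrib_right)
  qed
qed

lemma residue_series_finsum:
  assumes m: "m \<ge> 1" and "finite I" "\<And>i. i \<in> I \<Longrightarrow> h i \<in> carrier (madic_series m)"
  shows "fps_cong (int m ^ N) (residue_series N (finsum (madic_series m) h I)) (\<Sum>i\<in>I. residue_series N (h i))"
proof -
  interpret R: cring "madic_series m" by (rule madic_series_cring[OF m])
  show ?thesis using assms(2,3)
  proof (induction I rule: finite_induct)
    case empty
    then show ?case by simp
  next
    case (insert i I)
    then have "h \<in> I \<rightarrow> carrier (madic_series m)" "h i \<in> carrier (madic_series m)" by auto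
    then have "finsum (madic_series m) h (insert i I) = h i \<oplus>\<^bsub>madic_series m\<^esub> finsum (madic_series m) h I"
      using insert.hyps by (simp add: R.finsum_insert)
    moreover have "fps_cong (int m ^ N) (residue_series N (h i \<oplus>\<^bsub>madic_series m\<^esub> finsum (madic_series m) h I))
        (residue_series N (h i) + (\<Sum>i\<in>I. residue_series N (h i)))"
      using fps_cong_trans[OF residue_series_add fps_cong_add[OF fps_cong_refl]] insert by blast
    ultimately show ?case using insert.hyps by simp
  qed
qed


section \<open>Groups complete with respect to an injective endomorphism\<close>

text \<open>
  The closure \<open>A\<^sup>*\<close> is the example to have in mind: \<open>x\<close> is the diagonal endomorphism, the image of \<open>x ^^ N\<close> is the
  stabilizer of level \<open>N\<close>, and \<open>m\<close> is the number of letters. Completeness is phrased by series whose \<open>i\<close>-th term is in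
  the image of \<open>x ^^ i\<close>; the differences of a fast Cauchy sequence are the terms of such a series.
\<close>

locale adic_group = comm_group G for G (structure) +
  fixes x :: "'a \<Rightarrow> 'a" and m :: nat
  assumes m_ge: "m \<ge> 1"
    and x_hom: "x \<in> hom G G"
    and x_inj: "\<lbrakk>g \<in> carrier G; x g = \<one>\<rbrakk> \<Longrightarrow> g = \<one>"
    and separated: "\<lbrakk>g \<in> carrier G; \<And>N. g \<in> (x ^^ N) ` carrier G\<rbrakk> \<Longrightarrow> g = \<one>"
    and complete: "(\<And>i. h i \<in> carrier G) \<Longrightarrow>
      \<exists>g\<in>carrier G. \<forall>N. \<exists>k\<in>carrier G. g = (\<Otimes>i\<in>{..<N}. (x ^^ i) (h i)) \<otimes> (x ^^ N) k"
    and pow_m: "g \<in> carrier G \<Longrightarrow> \<exists>h\<in>carrier G. g [^] m = x h"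
    and transversal: "\<exists>T. finite T \<and> T \<subseteq> carrier G \<and> (\<forall>g\<in>carrier G. \<exists>t\<in>T. \<exists>h\<in>carrier G. g = t \<otimes> x h)"
begin

lemma xpow_hom: "x ^^ N \<in> hom G G"
proof (induction N)
  case 0
  then show ?case by (simp add: hom_def)
next
  case (Suc N)
  then show ?case using x_hom by (auto simp: hom_def Pi_iff)
qed

lemma xpow_closed [simp, intro]: "g \<in> carrier G \<Longrightarrow> (x ^^ N) g \<in> carrier G"
  using xpow_hom by (rule hom_in_carrier)

lemma x_closed [simp, intro]: "g \<in> carrier G \<Longrightarrow> x g \<in> carrier G"
  using x_hom by (rule hom_in_carrier)

lemma xpow_mult: "\<lbrakk>g \<in> carrier G; h \<in> carrier G\<rbrakk> \<Longrightarrow> (x ^^ N) (g \<otimes> h) = (x ^^ N) g \<otimes> (x ^^ N) h"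
  using xpow_hom by (rule hom_mult)

lemma x_mult: "\<lbrakk>g \<in> carrier G; h \<in> carrier G\<rbrakk> \<Longrightarrow> x (g \<otimes> h) = x g \<otimes> x h"
  using x_hom by (rule hom_mult)

lemma xpow_group_hom: "group_hom G G (x ^^ N)"
  by (simp add: group_hom_axioms.intro group_hom_def xpow_hom)

lemma xpow_one [simp]: "(x ^^ N) \<one> = \<one>"
  using group_hom.hom_one[OF xpow_group_hom] .

lemma x_one [simp]: "x \<one> = \<one>"
  using xpow_one[of 1] by simp

lemma xpow_inv: "g \<in> carrier G \<Longrightarrow> (x ^^ N) (inv g) = inv ((x ^^ N) g)"
  using group_hom.hom_inv[OF xpow_group_hom] .

lemma xpow_int_pow: "g \<in> carrier G \<Longrightarrow> (x ^^ N) (g [^] (c::int)) = (x ^^ N) g [^] c"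
  using group_hom.hom_int_pow[OF xpow_group_hom] .

lemma xpow_nat_pow: "g \<in> carrier G \<Longrightarrow> (x ^^ N) (g [^] (c::nat)) = (x ^^ N) g [^] c"
  using group_hom.hom_nat_pow[OF xpow_group_hom] .

lemma x_inj_on: "inj_on x (carrier G)"
proof (rule inj_onI)
  fix g h assume gh: "g \<in> carrier G" "h \<in> carrier G" "x g = x h"
  then have "x (g \<otimes> inv h) = \<one>"
    using xpow_inv[of h 1] by (simp add: x_mult)
  then have "g \<otimes> inv h = \<one>" using x_inj gh by simp
  then show "g = h" using gh inv_equality inv_inv inv_closed by metis
qed

text \<open>In additive notation, congruence modulo \<open>x\<^sup>N G\<close>.\<close>

definition near :: "nat \<Rightarrow> 'a \<Rightarrow> 'a \<Rightarrow> bool" where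
  "near N g h \<longleftrightarrow> g \<in> carrier G \<and> h \<in> carrier G \<and> (\<exists>k\<in>carrier G. g = h \<otimes> (x ^^ N) k)"

lemma near_closed: "near N g h \<Longrightarrow> g \<in> carrier G" "near N g h \<Longrightarrow> h \<in> carrier G"
  by (simp_all add: near_def)

lemma nearI: "\<lbrakk>h \<in> carrier G; k \<in> carrier G; g = h \<otimes> (x ^^ N) k\<rbrakk> \<Longrightarrow> near N g h"
  by (auto simp: near_def)

lemma near_refl: "g \<in> carrier G \<Longrightarrow> near N g g"
  by (rule nearI[of _ \<one>]) auto

lemma near_mult: "\<lbrakk>near N g h; near N g' h'\<rbrakk> \<Longrightarrow> near N (g \<otimes> g') (h \<otimes> h')"
proof -
  assume "near N g h" "near N g' h'"
  then obtain k k' where k: "k \<in> carrier G" "k' \<in> carrier G" "g = h \<otimes> (x ^^ N) k" "g' = h' \<otimes> (x ^^ N) k'"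
    and h: "h \<in> carrier G" "h' \<in> carrier G" by (auto simp: near_def)
  then show ?thesis
    by (intro nearI[of _ "k \<otimes> k'"]) (simp_all add: xpow_mult m_ac)
qed

lemma near_sym: "near N g h \<Longrightarrow> near N h g"
proof -
  assume "near N g h"
  then obtain k where k: "k \<in> carrier G" "g = h \<otimes> (x ^^ N) k" and h: "h \<in> carrier G"
    by (auto simp: near_def)
  then show ?thesis
    by (intro nearI[of _ "inv k"]) (simp_all add: xpow_inv m_assoc)
qed

lemma near_trans [trans]: "\<lbrakk>near N g h; near N h k\<rbrakk> \<Longrightarrow> near N g k"
proof -
  assume "near N g h" "near N h k"
  then obtain a b where "a \<in> carrier G" "b \<in> carrier G" "k \<in> carrier G" "g = h \<otimes> (x ^^ N) a" "h = k \<otimes> (x ^^ N) b"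
    by (auto simp: near_def)
  then show ?thesis
    by (intro nearI[of _ "a \<otimes> b"]) (simp_all add: xpow_mult m_ac)
qed

lemma near_0: "\<lbrakk>g \<in> carrier G; h \<in> carrier G\<rbrakk> \<Longrightarrow> near 0 g h"
  by (rule nearI[of _ "inv h \<otimes> g"]) (simp_all add: m_assoc[symmetric])

lemma near_mono: "\<lbrakk>near M g h; N \<le> M\<rbrakk> \<Longrightarrow> near N g h"
proof -
  assume "near M g h" "N \<le> M"
  then obtain k where k: "k \<in> carrier G" "g = h \<otimes> (x ^^ M) k" "h \<in> carrier G"
    by (auto simp: near_def)
  moreover have "(x ^^ M) k = (x ^^ N) ((x ^^ (M - N)) k)"
    using funpow_add[of N "M - N" x] \<open>N \<le> M\<close> by simp
  ultimately show ?thesis by (intro nearI[of _ "(x ^^ (M - N)) k"]) simp_all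
qed

lemma near_xpow: "near N g h \<Longrightarrow> near (N + i) ((x ^^ i) g) ((x ^^ i) h)"
proof -
  assume "near N g h"
  then obtain k where k: "k \<in> carrier G" "g = h \<otimes> (x ^^ N) k" "h \<in> carrier G"
    by (auto simp: near_def)
  then show ?thesis
    by (intro nearI[of _ k]) (simp_all add: xpow_mult funpow_add add.commute[of N])
qed

lemma near_x: "near N g h \<Longrightarrow> near (Suc N) (x g) (x h)"
  using near_xpow[of N g h 1] by simp

lemma near_x_cancel:
  assumes "g \<in> carrier G" "h \<in> carrier G" "near (Suc N) (x g) (x h)"
  shows "near N g h"
proof -
  obtain k where k: "k \<in> carrier G" "x g = x h \<otimes> x ((x ^^ N) k)"
    using assms by (auto simp: near_def)
  then have "x g = x (h \<otimes> (x ^^ N) k)" using assms by (simp add: x_mult)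
  then have "g = h \<otimes> (x ^^ N) k" using x_inj_on assms k by (auto dest: inj_onD)
  then show ?thesis using k assms by (auto intro: nearI)
qed

lemma near_one_iff: "near N g \<one> \<longleftrightarrow> g \<in> (x ^^ N) ` carrier G"
  by (auto simp: near_def)

lemma near_all_eq: "(\<And>N. near N g h) \<Longrightarrow> g = h"
proof -
  assume n: "\<And>N. near N g h"
  then have gh: "g \<in> carrier G" "h \<in> carrier G" by (auto simp: near_def)
  have "near N (g \<otimes> inv h) \<one>" for N
    using near_mult[OF n near_refl[of "inv h"], of N] gh by simp
  then have "g \<otimes> inv h = \<one>" using separated gh by (simp add: near_one_iff)
  then show "g = h" using gh inv_equality inv_inv inv_closed by metis
qed

lemma near_int_pow: "near N g h \<Longrightarrow> near N (g [^] (c::int)) (h [^] c)"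
proof -
  assume "near N g h"
  then obtain k where k: "k \<in> carrier G" "g = h \<otimes> (x ^^ N) k" "h \<in> carrier G"
    by (auto simp: near_def)
  then show ?thesis
    by (intro nearI[of _ "k [^] c"]) (simp_all add: xpow_int_pow int_pow_distrib)
qed

lemma near_finprod:
  assumes "finite I" "\<And>i. i \<in> I \<Longrightarrow> near N (f i) (g i)"
  shows "near N (\<Otimes>i\<in>I. f i) (\<Otimes>i\<in>I. g i)"
  using assms
proof (induction I rule: finite_induct)
  case empty
  then show ?case by (simp add: near_refl)
next
  case (insert i I)
  then have "f \<in> I \<rightarrow> carrier G" "g \<in> I \<rightarrow> carrier G" "f i \<in> carrier G" "g i \<in> carrier G"
    by (auto dest: near_closed)
  then show ?case using insert by (simp add: near_mult)
qed

text \<open>The exponent of \<open>G / x G\<close> divides \<open>m\<close>, so each factor \<open>m\<close> moves one step down the filtration.\<close>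

lemma near_pow_m: "g \<in> carrier G \<Longrightarrow> near N (g [^] (m ^ N)) \<one>"
proof (induction N arbitrary: g)
  case 0
  then show ?case by (simp add: near_0)
next
  case (Suc N)
  obtain h where h: "h \<in> carrier G" "g [^] m = x h" using pow_m[OF Suc.prems] by blast
  have "g [^] (m ^ Suc N) = (g [^] m) [^] (m ^ N)"
    using Suc.prems by (simp add: nat_pow_pow)
  also have "\<dots> = x (h [^] (m ^ N))"
    using xpow_nat_pow[of h 1 "m ^ N"] h by simp
  finally show ?case using near_x[OF Suc.IH[OF h(1)]] by simp
qed

text \<open>
  A power with \<open>m\<close>-adic exponent is therefore determined modulo \<open>x\<^sup>N G\<close> by the residue of the exponent modulo \<open>m ^ N\<close>.
\<close>

lemma near_int_pow_cong:
  assumes "g \<in> carrier G" "[c = d] (mod int m ^ N)"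
  shows "near N (g [^] c) (g [^] d)"
proof -
  obtain e where e: "c = d + int (m ^ N) * e"
    using assms(2) by (metis cong_iff_lin of_nat_power cong_sym)
  have "near N (g [^] d \<otimes> (g [^] (m ^ N)) [^] e) (g [^] d \<otimes> \<one> [^] e)"
    by (intro near_mult near_refl near_int_pow near_pow_m int_pow_closed assms)
  moreover have "g [^] c = g [^] d \<otimes> (g [^] (m ^ N)) [^] e"
    using assms(1) by (simp only: e int_pow_mult int_pow_pow[symmetric] int_pow_int)
  ultimately show ?thesis using assms(1) by (simp add: int_pow_one)
qed


section \<open>Convergent series\<close>

definition partial :: "(nat \<Rightarrow> 'a) \<Rightarrow> nat \<Rightarrow> 'a" where
  "partial h N = (\<Otimes>i\<in>{..<N}. (x ^^ i) (h i))"

definition series :: "(nat \<Rightarrow> 'a) \<Rightarrow> 'a" where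
  "series h = (THE g. \<forall>N. near N g (partial h N))"

lemma partial_0 [simp]: "partial h 0 = \<one>"
  by (simp add: partial_def)

lemma partial_closed [simp]: "(\<And>i. h i \<in> carrier G) \<Longrightarrow> partial h N \<in> carrier G"
  unfolding partial_def by (rule finprod_closed) auto

lemma partial_Suc: "(\<And>i. h i \<in> carrier G) \<Longrightarrow> partial h (Suc N) = partial h N \<otimes> (x ^^ N) (h N)"
  unfolding partial_def lessThan_Suc by (subst finprod_insert) (auto simp: m_comm)

lemma partial_Suc_shift:
  "(\<And>i. h i \<in> carrier G) \<Longrightarrow> partial h (Suc N) = h 0 \<otimes> x (partial (\<lambda>i. h (Suc i)) N)"
proof (induction N)
  case (Suc N)
  then show ?case
    by (simp add: partial_Suc[of h "Suc N"] partial_Suc[of "\<lambda>i. h (Suc i)" N] x_mult m_assoc)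
qed (simp add: partial_Suc)

lemma series_unique: "(\<And>N. near N g (partial h N)) \<Longrightarrow> series h = g"
  unfolding series_def
proof (rule the_equality)
  fix g' assume "\<And>N. near N g (partial h N)" "\<forall>N. near N g' (partial h N)"
  then have "near N g' g" for N using near_trans near_sym by blast
  then show "g' = g" by (rule near_all_eq)
qed blast

lemma series_near:
  assumes "\<And>i. h i \<in> carrier G"
  shows "near N (series h) (partial h N)"
proof -
  obtain g where g: "g \<in> carrier G" "\<And>N. \<exists>k\<in>carrier G. g = partial h N \<otimes> (x ^^ N) k"
    using complete[of h] assms unfolding partial_def by blast
  then have "near N g (partial h N)" for N
    using assms by (simp add: near_def)
  with series_unique this show ?thesis by metis
qed

lemma series_closed [simp]: "(\<And>i. h i \<in> carrier G) \<Longrightarrow> series h \<in> carrier G"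
  using series_near[of h 0] near_closed by blast

lemma series_Suc:
  assumes h: "\<And>i. h i \<in> carrier G"
  shows "series h = h 0 \<otimes> x (series (\<lambda>i. h (Suc i)))"
proof (rule near_all_eq)
  fix N
  have "near (Suc N) (series h) (h 0 \<otimes> x (partial (\<lambda>i. h (Suc i)) N))"
    using series_near[OF h, of "Suc N"] h by (simp add: partial_Suc_shift)
  also have "near (Suc N) \<dots> (h 0 \<otimes> x (series (\<lambda>i. h (Suc i))))"
    by (intro near_mult near_x near_refl near_sym[OF series_near] h)
  finally show "near N (series h) (h 0 \<otimes> x (series (\<lambda>i. h (Suc i))))"
    by (rule near_mono) simp
qed

lemma partial_mult:
  "(\<And>i. h i \<in> carrier G) \<Longrightarrow> (\<And>i. k i \<in> carrier G) \<Longrightarrow>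
    partial (\<lambda>i. h i \<otimes> k i) N = partial h N \<otimes> partial k N"
  by (induction N) (simp_all add: partial_Suc xpow_mult m_ac)

lemma series_mult:
  "(\<And>i. h i \<in> carrier G) \<Longrightarrow> (\<And>i. k i \<in> carrier G) \<Longrightarrow>
    series (\<lambda>i. h i \<otimes> k i) = series h \<otimes> series k"
  by (rule series_unique) (simp add: partial_mult near_mult series_near)

lemma series_int_pow:
  assumes h: "\<And>i. h i \<in> carrier G"
  shows "series (\<lambda>i. h i [^] (c::int)) = series h [^] c"
proof (rule series_unique)
  fix N
  have "partial (\<lambda>i. h i [^] c) N = partial h N [^] c" for N
    by (induction N) (simp_all add: partial_Suc h xpow_int_pow int_pow_distrib int_pow_one)
  then show "near N (series h [^] c) (partial (\<lambda>i. h i [^] c) N)"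
    by (simp add: near_int_pow series_near h)
qed

lemma series_x:
  assumes h: "\<And>i. h i \<in> carrier G"
  shows "series (\<lambda>i. x (h i)) = x (series h)"
proof (rule series_unique)
  fix N
  have "partial (\<lambda>i. x (h i)) N = x (partial h N)" for N
    by (induction N) (simp_all add: partial_Suc h x_mult funpow_swap1)
  then show "near N (x (series h)) (partial (\<lambda>i. x (h i)) N)"
    using near_mono[OF near_x[OF series_near[of h N]]] h by simp
qed

lemma series_one [simp]: "series (\<lambda>i. \<one>) = \<one>"
proof (rule series_unique)
  fix N
  have "partial (\<lambda>i. \<one>) N = \<one>" by (induction N) (simp_all add: partial_Suc)
  then show "near N \<one> (partial (\<lambda>i. \<one>) N)" by (simp add: near_refl)
qed

lemma series_cong_near:
  assumes "\<And>i. near N (h i) (k i)"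
  shows "near N (series h) (series k)"
proof -
  have hk: "\<And>i. h i \<in> carrier G" "\<And>i. k i \<in> carrier G" using assms near_closed by blast+
  have "near N (series h) (partial h N)" by (rule series_near) (rule hk)
  also have "near N \<dots> (partial k N)"
    unfolding partial_def by (intro near_finprod near_mono[OF near_xpow[OF assms]]) auto
  also have "near N \<dots> (series k)" by (rule near_sym, rule series_near) (rule hk)
  finally show ?thesis .
qed


lemma series_finprod:
  assumes "finite I" "\<And>j i. j \<in> I \<Longrightarrow> h j i \<in> carrier G"
  shows "series (\<lambda>i. \<Otimes>j\<in>I. h j i) = (\<Otimes>j\<in>I. series (h j))"
  using assms
proof (induction I rule: finite_induct)
  case (insert j I)
  then have "(\<lambda>j. h j i) \<in> I \<rightarrow> carrier G" "h j i \<in> carrier G"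
    "(\<lambda>j. series (h j)) \<in> I \<rightarrow> carrier G" for i by auto
  moreover from this have "(\<Otimes>j\<in>I. h j i) \<in> carrier G" for i by simp
  ultimately show ?case using insert by (simp add: series_mult)
qed simp

text \<open>
  A representative is split off, the remainder is divided by \<open>x\<close>, and so on; the element is the sum of the
  representatives found, because what is left after \<open>N\<close> steps lies in \<open>x\<^sup>N G\<close>.
\<close>

lemma digit_expansion:
  assumes T: "T \<subseteq> carrier G" "\<forall>g\<in>carrier G. \<exists>t\<in>T. \<exists>h\<in>carrier G. g = t \<otimes> x h"
    and g: "g \<in> carrier G"
  shows "\<exists>d. (\<forall>i. d i \<in> T) \<and> g = series d"
proof -
  obtain dig rest where dr: "\<And>g. g \<in> carrier G \<Longrightarrow> dig g \<in> T \<and> rest g \<in> carrier G \<and> g = dig g \<otimes> x (rest g)"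
    using T(2) by metis
  have r: "(rest ^^ i) g \<in> carrier G" for i
    by (induction i) (use g dr in auto)
  define d where "d i = dig ((rest ^^ i) g)" for i
  have d: "d i \<in> T" "d i \<in> carrier G" for i
    using r dr T(1) by (auto simp: d_def)
  have "g = partial d N \<otimes> (x ^^ N) ((rest ^^ N) g)" for N
  proof (induction N)
    case 0
    then show ?case using g by simp
  next
    case (Suc N)
    have "(x ^^ N) ((rest ^^ N) g) = (x ^^ N) (d N \<otimes> x ((rest ^^ Suc N) g))"
      using dr[OF r[of N]] by (simp add: d_def)
    also have "\<dots> = (x ^^ N) (d N) \<otimes> (x ^^ Suc N) ((rest ^^ Suc N) g)"
      using d r[of "Suc N"] by (simp add: xpow_mult funpow_swap1)
    finally show ?case using Suc d r[of "Suc N"] by (simp add: partial_Suc m_assoc)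
  qed
  then have "near N g (partial d N)" for N
    using r by (intro nearI[of _ "(rest ^^ N) g"]) (use d in auto)
  then have "g = series d" using series_unique by metis
  then show ?thesis using d by blast
qed


section \<open>The action of integral power series\<close>

text \<open>
  Integral coefficients are enough: modulo \<open>x\<^sup>N G\<close>, a power series over the \<open>m\<close>-adic integers acts like its \<open>N\<close>-th
  residue series.
\<close>

definition act :: "int fps \<Rightarrow> 'a \<Rightarrow> 'a" where
  "act F g = series (\<lambda>i. g [^] fps_nth F i)"

lemma act_closed [simp]: "g \<in> carrier G \<Longrightarrow> act F g \<in> carrier G"
  by (simp add: act_def)

lemma act_add: "g \<in> carrier G \<Longrightarrow> act (F + H) g = act F g \<otimes> act H g"
  by (simp add: act_def int_pow_mult series_mult)

lemma act_mult: "\<lbrakk>g \<in> carrier G; h \<in> carrier G\<rbrakk> \<Longrightarrow> act F (g \<otimes> h) = act F g \<otimes> act F h"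
  by (simp add: act_def int_pow_distrib series_mult)

lemma act_shift: "g \<in> carrier G \<Longrightarrow> act F g = g [^] fps_nth F 0 \<otimes> x (act (fps_shift 1 F) g)"
  unfolding act_def by (subst series_Suc) simp_all

lemma act_0 [simp]: "act 0 g = \<one>"
  by (simp add: act_def)

lemma act_const: "g \<in> carrier G \<Longrightarrow> act (fps_const c) g = g [^] c"
proof -
  assume g: "g \<in> carrier G"
  have "fps_shift 1 (fps_const c) = 0" by (rule fps_ext) simp
  then show ?thesis using act_shift[OF g, of "fps_const c"] g by simp
qed

lemma act_1 [simp]: "g \<in> carrier G \<Longrightarrow> act 1 g = g"
  using act_const[of g 1] by (simp add: int_pow_1)

lemma act_X_mult: "g \<in> carrier G \<Longrightarrow> act (fps_X * F) g = x (act F g)"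
proof -
  assume g: "g \<in> carrier G"
  have "fps_shift 1 (fps_X * F) = F" by (rule fps_ext) simp
  then show ?thesis using act_shift[OF g, of "fps_X * F"] g by simp
qed

lemma act_X_power_mult: "g \<in> carrier G \<Longrightarrow> act (fps_X ^ i * F) g = (x ^^ i) (act F g)"
  by (induction i) (simp_all add: act_X_mult mult.assoc)

lemma act_X_power: "g \<in> carrier G \<Longrightarrow> act (fps_X ^ i) g = (x ^^ i) g"
  using act_X_power_mult[of g i 1] by simp

lemma act_const_mult: "g \<in> carrier G \<Longrightarrow> act (fps_const c * F) g = act F g [^] c"
  unfolding act_def by (subst series_int_pow[symmetric]) (simp_all add: int_pow_pow mult.commute)

lemma act_one [simp]: "act F \<one> = \<one>"
  by (simp add: act_def int_pow_one)

lemma act_uminus: "g \<in> carrier G \<Longrightarrow> act (- F) g = inv (act F g)"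
  using act_add[of g "- F" F] by (metis act_0 act_closed add.left_inverse inv_equality)

lemma act_diff: "g \<in> carrier G \<Longrightarrow> act (F - H) g = act F g \<otimes> inv (act H g)"
  using act_add[of g F "- H"] by (simp add: act_uminus)

text \<open>
  By the rule \<open>F = F\<^sub>0 + X F'\<close> the identity for \<open>F\<close> modulo \<open>x\<^sup>N\<^sup>+\<^sup>1 G\<close> reduces to the one for \<open>F'\<close> modulo \<open>x\<^sup>N G\<close>.
\<close>

lemma act_act:
  assumes "g \<in> carrier G"
  shows "act F (act H g) = act (F * H) g"
proof -
  have "near N (act F (act H g)) (act (F * H) g)" for N
  proof (induction N arbitrary: F)
    case 0
    then show ?case using assms by (simp add: near_0)
  next
    case (Suc N)
    have F: "F = fps_const (fps_nth F 0) + fps_X * fps_shift 1 F"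
      by (rule fps_ext) simp
    have "F * H = fps_const (fps_nth F 0) * H + fps_X * (fps_shift 1 F * H)"
      by (subst F) (simp add: algebra_simps)
    then have "act (F * H) g = act H g [^] fps_nth F 0 \<otimes> x (act (fps_shift 1 F * H) g)"
      using assms by (simp add: act_add act_const_mult act_X_mult)
    moreover have "act F (act H g) = act H g [^] fps_nth F 0 \<otimes> x (act (fps_shift 1 F) (act H g))"
      using assms by (intro act_shift) simp
    ultimately show ?case using Suc[of "fps_shift 1 F"] assms
      by (simp add: near_mult near_refl near_x)
  qed
  then show ?thesis by (rule near_all_eq)
qed

lemma act_near_cong: "\<lbrakk>g \<in> carrier G; fps_cong (int m ^ N) F H\<rbrakk> \<Longrightarrow> near N (act F g) (act H g)"
  unfolding act_def fps_cong_def by (intro series_cong_near near_int_pow_cong) auto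

lemma near_act: "near N g h \<Longrightarrow> near N (act F g) (act F h)"
  unfolding act_def by (intro series_cong_near near_int_pow)

lemma act_finprod:
  assumes "finite I" "\<And>i. i \<in> I \<Longrightarrow> f i \<in> carrier G"
  shows "act F (\<Otimes>i\<in>I. f i) = (\<Otimes>i\<in>I. act F (f i))"
  using assms
proof (induction I rule: finite_induct)
  case (insert i I)
  then have "f \<in> I \<rightarrow> carrier G" "f i \<in> carrier G" "(\<lambda>i. act F (f i)) \<in> I \<rightarrow> carrier G" by auto
  then show ?case using insert by (simp add: act_mult)
qed simp


section \<open>The module structures\<close>

lemma additive_module_simps [simp]:
  "carrier (additive_module G sm) = carrier G"
  "zero (additive_module G sm) = \<one>"
  "add (additive_module G sm) g h = g \<otimes> h"
  "smult (additive_module G sm) = sm"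
  by (simp_all add: additive_module_def)

lemma additive_module_abelian: "abelian_group (additive_module G sm)"
  by (rule abelian_groupI) (auto simp: m_ac intro: l_inv_ex)

text \<open>
  The actions of \<open>\<int>\<^sub>m\<close> and \<open>\<int>\<^sub>m[[x]]\<close> on \<open>A\<^sup>*\<close> are given by limits. Only their values modulo each \<open>x\<^sup>N G\<close>
  matter: an operation that is congruent there to the action of the residues satisfies the module laws modulo every
  \<open>x\<^sup>N G\<close>, hence exactly.
\<close>

lemma madic_module:
  assumes sm: "\<forall>a\<in>carrier (madic_ring m). \<forall>g\<in>carrier G. \<forall>N. near N (sm a g) (g [^] a N)"
  shows "Module.module (madic_ring m) (additive_module G sm)"
proof -
  interpret Z: cring "madic_ring m" using madic_ring_cring[OF m_ge] .
  let ?Z = "madic_ring m"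
  have near: "near N (sm a g) (g [^] a N)" if "a \<in> carrier ?Z" "g \<in> carrier G" for a g N
    using sm that by blast
  have closed: "sm a g \<in> carrier G" if "a \<in> carrier ?Z" "g \<in> carrier G" for a g
    using near[OF that] near_closed by blast
  have eqI: "g = h" if "\<And>N. near N g (k N)" "\<And>N. near N h (k N)" for g h k
    using that near_all_eq near_sym near_trans by meson
  show ?thesis
  proof (rule moduleI[OF Z.is_cring additive_module_abelian], simp_all only: additive_module_simps)
    fix a b g h
    assume a: "a \<in> carrier ?Z" and b: "b \<in> carrier ?Z" and g: "g \<in> carrier G" and h: "h \<in> carrier G"
    show "sm a g \<in> carrier G" by (rule closed[OF a g])
    show "sm (a \<oplus>\<^bsub>?Z\<^esub> b) g = sm a g \<otimes> sm b g"
    proof (rule eqI)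
      fix N
      have "near N (sm (a \<oplus>\<^bsub>?Z\<^esub> b) g) (g [^] (a \<oplus>\<^bsub>?Z\<^esub> b) N)"
        by (intro near Z.a_closed a b g)
      also have "near N \<dots> (g [^] (a N + b N))"
        by (rule near_int_pow_cong[OF g]) (simp add: cong_def)
      finally show "near N (sm (a \<oplus>\<^bsub>?Z\<^esub> b) g) (g [^] (a N + b N))" .
      show "near N (sm a g \<otimes> sm b g) (g [^] (a N + b N))"
        using near_mult[OF near[OF a g] near[OF b g]] g by (simp add: int_pow_mult)
    qed
    show "sm a (g \<otimes> h) = sm a g \<otimes> sm a h"
    proof (rule eqI)
      fix N
      show "near N (sm a (g \<otimes> h)) ((g \<otimes> h) [^] a N)" using near a g h by simp
      show "near N (sm a g \<otimes> sm a h) ((g \<otimes> h) [^] a N)"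
        using near_mult[OF near[OF a g] near[OF a h]] g h by (simp add: int_pow_distrib)
    qed
    show "sm (a \<otimes>\<^bsub>?Z\<^esub> b) g = sm a (sm b g)"
    proof (rule eqI)
      fix N
      have "near N (sm (a \<otimes>\<^bsub>?Z\<^esub> b) g) (g [^] (a \<otimes>\<^bsub>?Z\<^esub> b) N)"
        by (intro near Z.m_closed a b g)
      also have "near N \<dots> (g [^] (b N * a N))"
        by (rule near_int_pow_cong[OF g]) (simp add: cong_def mult.commute)
      finally show "near N (sm (a \<otimes>\<^bsub>?Z\<^esub> b) g) (g [^] (b N * a N))" .
      have "near N (sm a (sm b g)) (sm b g [^] a N)" by (intro near closed a b g)
      also have "near N \<dots> ((g [^] b N) [^] a N)" by (intro near_int_pow near b g)
      finally show "near N (sm a (sm b g)) (g [^] (b N * a N))" using g by (simp add: int_pow_pow)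
    qed
  next
    fix g assume g: "g \<in> carrier G"
    show "sm \<one>\<^bsub>?Z\<^esub> g = g"
    proof (rule eqI)
      fix N
      have "near N (sm \<one>\<^bsub>?Z\<^esub> g) (g [^] \<one>\<^bsub>?Z\<^esub> N)" by (intro near Z.one_closed g)
      also have "near N \<dots> (g [^] (1::int))"
        by (rule near_int_pow_cong[OF g]) (simp add: cong_def)
      finally show "near N (sm \<one>\<^bsub>?Z\<^esub> g) (g [^] (1::int))" .
      show "near N g (g [^] (1::int))" using g by (simp add: near_refl int_pow_1)
    qed
  qed
qed

lemma series_module:
  assumes sm: "\<forall>q\<in>carrier (madic_series m). \<forall>g\<in>carrier G. \<forall>N.
      near N (sm q g) (act (residue_series N q) g)"
  shows "Module.module (madic_series m) (additive_module G sm)"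
proof -
  interpret R: cring "madic_series m" using madic_series_cring[OF m_ge] .
  let ?R = "madic_series m"
  let ?r = residue_series
  have near: "near N (sm q g) (act (residue_series N q) g)" if "q \<in> carrier ?R" "g \<in> carrier G" for q g N
    using sm that by blast
  have closed: "sm q g \<in> carrier G" if "q \<in> carrier ?R" "g \<in> carrier G" for q g
    using near[OF that] near_closed by blast
  have eqI: "g = h" if "\<And>N. near N g (k N)" "\<And>N. near N h (k N)" for g h k
    using that near_all_eq near_sym near_trans by meson
  show ?thesis
  proof (rule moduleI[OF R.is_cring additive_module_abelian], simp_all only: additive_module_simps)
    fix p q g h
    assume p: "p \<in> carrier ?R" and q: "q \<in> carrier ?R" and g: "g \<in> carrier G" and h: "h \<in> carrier G"
    show "sm p g \<in> carrier G" by (rule closed[OF p g])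
    show "sm (p \<oplus>\<^bsub>?R\<^esub> q) g = sm p g \<otimes> sm q g"
    proof (rule eqI)
      fix N
      have "near N (sm (p \<oplus>\<^bsub>?R\<^esub> q) g) (act (?r N (p \<oplus>\<^bsub>?R\<^esub> q)) g)"
        by (intro near R.a_closed p q g)
      also have "near N \<dots> (act (?r N p + ?r N q) g)"
        by (rule act_near_cong[OF g residue_series_add])
      finally show "near N (sm (p \<oplus>\<^bsub>?R\<^esub> q) g) (act (?r N p + ?r N q) g)" .
      show "near N (sm p g \<otimes> sm q g) (act (?r N p + ?r N q) g)"
        using near_mult[OF near[OF p g] near[OF q g]] g by (simp add: act_add)
    qed
    show "sm p (g \<otimes> h) = sm p g \<otimes> sm p h"
    proof (rule eqI)
      fix N
      show "near N (sm p (g \<otimes> h)) (act (?r N p) (g \<otimes> h))" using near p g h by simp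
      show "near N (sm p g \<otimes> sm p h) (act (?r N p) (g \<otimes> h))"
        using near_mult[OF near[OF p g] near[OF p h]] g h by (simp add: act_mult)
    qed
    show "sm (p \<otimes>\<^bsub>?R\<^esub> q) g = sm p (sm q g)"
    proof (rule eqI)
      fix N
      have "near N (sm (p \<otimes>\<^bsub>?R\<^esub> q) g) (act (?r N (p \<otimes>\<^bsub>?R\<^esub> q)) g)"
        by (intro near R.m_closed p q g)
      also have "near N \<dots> (act (?r N p * ?r N q) g)"
        by (rule act_near_cong[OF g residue_series_mult[OF m_ge p q]])
      finally show "near N (sm (p \<otimes>\<^bsub>?R\<^esub> q) g) (act (?r N p * ?r N q) g)" .
      have "near N (sm p (sm q g)) (act (?r N p) (sm q g))" by (intro near closed p q g)
      also have "near N \<dots> (act (?r N p) (act (?r N q) g))" by (intro near_act near q g)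
      finally show "near N (sm p (sm q g)) (act (?r N p * ?r N q) g)" using g by (simp add: act_act)
    qed
  next
    fix g assume g: "g \<in> carrier G"
    show "sm \<one>\<^bsub>?R\<^esub> g = g"
    proof (rule eqI)
      fix N
      have "near N (sm \<one>\<^bsub>?R\<^esub> g) (act (?r N \<one>\<^bsub>?R\<^esub>) g)" by (intro near R.one_closed g)
      also have "near N \<dots> (act 1 g)" by (rule act_near_cong[OF g residue_series_one])
      finally show "near N (sm \<one>\<^bsub>?R\<^esub> g) (act 1 g)" .
      show "near N g (act 1 g)" using g by (simp add: near_refl)
    qed
  qed
qed

end


section \<open>Free modules, spans and kernels\<close>

lemma free_module_simps [simp]:
  "carrier (free_module R n) = {..<n} \<rightarrow>\<^sub>E carrier R"
  "zero (free_module R n) = (\<lambda>i\<in>{..<n}. \<zero>\<^bsub>R\<^esub>)"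
  "add (free_module R n) v w = (\<lambda>i\<in>{..<n}. v i \<oplus>\<^bsub>R\<^esub> w i)"
  "smult (free_module R n) r v = (\<lambda>i\<in>{..<n}. r \<otimes>\<^bsub>R\<^esub> v i)"
  by (simp_all add: free_module_def)

lemma (in cring) free_module_module: "Module.module R (free_module R n)"
proof -
  have el: "v i \<in> carrier R" if "v \<in> {..<n} \<rightarrow>\<^sub>E carrier R" "i < n" for v i
    using that by auto
  note ext = PiE_ext[of _ "{..<n}" "\<lambda>_. carrier R"]
  show ?thesis
  proof (rule moduleI)
    show "cring R" by (rule is_cring)
    show "abelian_group (free_module R n)"
    proof (rule abelian_groupI, goal_cases)
      case (1 v w)
      then show ?case using el by auto
    next
      case 2
      show ?case by simp
    next
      case (3 u v w)
      then show ?case using el by (auto simp: a_assoc intro!: restrict_ext)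
    next
      case (4 v w)
      then show ?case using el by (auto simp: a_comm intro!: restrict_ext)
    next
      case (5 v)
      then show ?case using el by (auto intro!: ext)
    next
      case (6 v)
      let ?w = "\<lambda>i\<in>{..<n}. \<ominus> v i"
      have "?w \<in> carrier (free_module R n)" using 6 el by auto
      moreover have "?w \<oplus>\<^bsub>free_module R n\<^esub> v = \<zero>\<^bsub>free_module R n\<^esub>"
        using 6 el by (auto simp: l_neg intro!: restrict_ext)
      ultimately show ?case by blast
    qed
  next
    fix v assume "v \<in> carrier (free_module R n)"
    then show "\<one> \<odot>\<^bsub>free_module R n\<^esub> v = v" using el by (auto intro!: ext)
  next
    fix r v assume "r \<in> carrier R" "v \<in> carrier (free_module R n)"
    then show "r \<odot>\<^bsub>free_module R n\<^esub> v \<in> carrier (free_module R n)" using el by auto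
  next
    fix r s v assume "r \<in> carrier R" "s \<in> carrier R" "v \<in> carrier (free_module R n)"
    then show "(r \<oplus> s) \<odot>\<^bsub>free_module R n\<^esub> v = r \<odot>\<^bsub>free_module R n\<^esub> v \<oplus>\<^bsub>free_module R n\<^esub> s \<odot>\<^bsub>free_module R n\<^esub> v"
      and "(r \<otimes> s) \<odot>\<^bsub>free_module R n\<^esub> v = r \<odot>\<^bsub>free_module R n\<^esub> (s \<odot>\<^bsub>free_module R n\<^esub> v)"
      using el by (auto simp: l_distr m_assoc intro!: restrict_ext)
  next
    fix r v w assume "r \<in> carrier R" "v \<in> carrier (free_module R n)" "w \<in> carrier (free_module R n)"
    then show "r \<odot>\<^bsub>free_module R n\<^esub> (v \<oplus>\<^bsub>free_module R n\<^esub> w) = r \<odot>\<^bsub>free_module R n\<^esub> v \<oplus>\<^bsub>free_module R n\<^esub> r \<odot>\<^bsub>free_module R n\<^esub> w"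
      using el by (auto simp: r_distr intro!: restrict_ext)
  qed
qed

lemma (in cring) free_module_finsum_nth:
  assumes "finite I" "\<And>i. i \<in> I \<Longrightarrow> f i \<in> carrier (free_module R n)" "j < n"
  shows "finsum (free_module R n) f I j = (\<Oplus>i\<in>I. f i j)"
proof -
  interpret F: Module.module R "free_module R n" by (rule free_module_module)
  show ?thesis using assms(1,2)
  proof (induction I rule: finite_induct)
    case empty
    then show ?case using assms(3) F.finsum_empty by simp
  next
    case (insert i I)
    then have "f \<in> I \<rightarrow> carrier (free_module R n)" "f i \<in> carrier (free_module R n)"
      "f i j \<in> carrier R" "(\<lambda>i. f i j) \<in> I \<rightarrow> carrier R" using assms(3) by auto
    then show ?case using insert assms(3) F.finsum_insert[of I i f] by (simp add: finsum_insert)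
  qed
qed

lemma (in Module.module) submodule_finsum_smult:
  assumes N: "submodule N R M" and "finite I"
    and "\<And>i. i \<in> I \<Longrightarrow> c i \<in> carrier R" "\<And>i. i \<in> I \<Longrightarrow> s i \<in> N"
  shows "(\<Oplus>\<^bsub>M\<^esub>i\<in>I. c i \<odot>\<^bsub>M\<^esub> s i) \<in> N"
  using assms(2-)
proof (induction I rule: finite_induct)
  case empty
  obtain b where "b \<in> N" "b \<in> carrier M" using submoduleE(1,2)[OF N] by blast
  then have "\<zero>\<^bsub>M\<^esub> \<in> N" using submoduleE(4)[OF N, of "\<zero>" b] by simp
  then show ?case by simp
next
  case (insert i I)
  have NM: "N \<subseteq> carrier M" by (rule submoduleE(1)[OF N])
  have mem: "c k \<odot>\<^bsub>M\<^esub> s k \<in> N" if "k \<in> insert i I" for k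
    by (rule submoduleE(4)[OF N]) (rule insert.prems[OF that])+
  have "(\<Oplus>\<^bsub>M\<^esub>i\<in>I. c i \<odot>\<^bsub>M\<^esub> s i) \<in> N"
    by (rule insert.IH) (rule insert.prems, simp)+
  then have "c i \<odot>\<^bsub>M\<^esub> s i \<oplus>\<^bsub>M\<^esub> (\<Oplus>\<^bsub>M\<^esub>i\<in>I. c i \<odot>\<^bsub>M\<^esub> s i) \<in> N"
    by (intro submoduleE(5)[OF N] mem) simp_all
  also have "c i \<odot>\<^bsub>M\<^esub> s i \<oplus>\<^bsub>M\<^esub> (\<Oplus>\<^bsub>M\<^esub>i\<in>I. c i \<odot>\<^bsub>M\<^esub> s i) = (\<Oplus>\<^bsub>M\<^esub>i\<in>insert i I. c i \<odot>\<^bsub>M\<^esub> s i)"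
    by (rule M.finsum_insert[symmetric])
      (use insert.hyps mem NM in \<open>auto simp: subset_iff\<close>)
  finally show ?case .
qed

lemma submodule_span_least: "submodule N R M \<Longrightarrow> S \<subseteq> N \<Longrightarrow> submodule_span R M S \<subseteq> N"
  by (auto simp: submodule_span_def)

lemma linear_kernel_submodule:
  assumes "Module.module R M" "Module.module R N" "f \<in> linear_maps R M N"
  shows "submodule {v \<in> carrier M. f v = \<zero>\<^bsub>N\<^esub>} R M"
proof -
  interpret M: Module.module R M by fact
  interpret N: Module.module R N by fact
  have add: "f (v \<oplus>\<^bsub>M\<^esub> w) = f v \<oplus>\<^bsub>N\<^esub> f w" if "v \<in> carrier M" "w \<in> carrier M" for v w
    using assms(3) that by (auto simp: linear_maps_def)
  have smult: "f (r \<odot>\<^bsub>M\<^esub> v) = r \<odot>\<^bsub>N\<^esub> f v" if "r \<in> carrier R" "v \<in> carrier M" for r v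
    using assms(3) that by (auto simp: linear_maps_def)
  have closed: "f v \<in> carrier N" if "v \<in> carrier M" for v
    using assms(3) that by (auto simp: linear_maps_def)
  have zero: "f \<zero>\<^bsub>M\<^esub> = \<zero>\<^bsub>N\<^esub>"
    using smult[of "\<zero>\<^bsub>R\<^esub>" "\<zero>\<^bsub>M\<^esub>"] closed by simp
  have neg: "f (\<ominus>\<^bsub>M\<^esub> v) = \<ominus>\<^bsub>N\<^esub> f v" if "v \<in> carrier M" for v
    using smult[of "\<ominus>\<^bsub>R\<^esub> \<one>\<^bsub>R\<^esub>" v] that closed by (simp add: M.smult_l_minus N.smult_l_minus)
  show ?thesis
    by (rule M.submoduleI) (use add smult zero neg in auto)
qed


section \<open>Finite presentation\<close>

context adic_group
begin

definition combine :: "nat \<Rightarrow> (nat \<Rightarrow> 'a) \<Rightarrow> (nat \<Rightarrow> int fps) \<Rightarrow> 'a" where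
  "combine n t w = (\<Otimes>j\<in>{..<n}. act (w j) (t j))"

end

text \<open>
  Representatives of the cosets of \<open>x G\<close>, numbered because they are to be the images of the standard basis of a free
  module.
\<close>

locale adic_generators = adic_group +
  fixes n :: nat and t :: "nat \<Rightarrow> 'a"
  assumes t_closed: "j < n \<Longrightarrow> t j \<in> carrier G"
    and t_cover: "g \<in> carrier G \<Longrightarrow> \<exists>j<n. \<exists>h\<in>carrier G. g = t j \<otimes> x h"
begin

abbreviation "comb \<equiv> combine n t"

lemma comb_closed [simp]: "comb w \<in> carrier G"
  unfolding combine_def by (rule finprod_closed) (use t_closed in auto)

lemma comb_add: "comb (\<lambda>j. v j + w j) = comb v \<otimes> comb w"
proof -
  have "comb (\<lambda>j. v j + w j) = (\<Otimes>j\<in>{..<n}. act (v j) (t j) \<otimes> act (w j) (t j))"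
    unfolding combine_def by (rule finprod_cong') (use t_closed in \<open>auto simp: act_add\<close>)
  also have "\<dots> = comb v \<otimes> comb w"
    unfolding combine_def by (rule finprod_multf) (use t_closed in auto)
  finally show ?thesis .
qed

lemma comb_mult: "comb (\<lambda>j. F * w j) = act F (comb w)"
proof -
  have "comb (\<lambda>j. F * w j) = (\<Otimes>j\<in>{..<n}. act F (act (w j) (t j)))"
    unfolding combine_def by (rule finprod_cong') (use t_closed in \<open>auto simp: act_act\<close>)
  also have "\<dots> = act F (comb w)"
    unfolding combine_def by (rule act_finprod[symmetric]) (use t_closed in auto)
  finally show ?thesis .
qed

lemma comb_diff: "comb (\<lambda>j. v j - w j) = comb v \<otimes> inv (comb w)"
  using comb_add[of v "\<lambda>j. - 1 * w j"] comb_mult[of "-1" w] by (simp add: act_uminus)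

lemma comb_X: "comb (\<lambda>j. fps_X * w j) = x (comb w)"
  using act_X_mult[of "comb w" 1] by (simp add: comb_mult)

lemma comb_const: "comb (\<lambda>j. fps_const (c j)) = (\<Otimes>j\<in>{..<n}. t j [^] c j)"
  unfolding combine_def by (rule finprod_cong') (use t_closed in \<open>auto simp: act_const\<close>)

lemma comb_sum_relations:
  "finite D \<Longrightarrow> (\<And>c. c \<in> D \<Longrightarrow> comb (r c) = \<one>) \<Longrightarrow> comb (\<lambda>j. \<Sum>c\<in>D. F c * r c j) = \<one>"
proof (induction D rule: finite_induct)
  case empty
  then show ?case using comb_mult[of 0 "\<lambda>j. 0"] by simp
next
  case (insert c D)
  then show ?case by (simp add: comb_add comb_mult)
qed

lemma comb_near_cong:
  "(\<And>j. j < n \<Longrightarrow> fps_cong (int m ^ N) (v j) (w j)) \<Longrightarrow> near N (comb v) (comb w)"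
  unfolding combine_def by (rule near_finprod) (use t_closed in \<open>auto intro: act_near_cong\<close>)

lemma comb_surj:
  assumes "g \<in> carrier G"
  shows "\<exists>w. comb w = g"
proof -
  have "\<exists>d. (\<forall>i. d i \<in> t ` {..<n}) \<and> g = series d"
    by (rule digit_expansion[OF _ _ assms]) (use t_closed t_cover in blast)+
  then obtain d where d: "\<forall>i. d i \<in> t ` {..<n}" "g = series d" by (elim exE conjE)
  from d(1) have "\<forall>i. \<exists>k. k < n \<and> d i = t k" by auto
  then obtain e where e: "\<And>i. e i < n" "\<And>i. d i = t (e i)" by metis
  define w where "w j = Abs_fps (\<lambda>i. if e i = j then 1 else 0 :: int)" for j
  have "d i = (\<Otimes>j\<in>{..<n}. t j [^] fps_nth (w j) i)" for i
  proof -
    have "(\<Otimes>j\<in>{..<n}. t j [^] fps_nth (w j) i) = (\<Otimes>j\<in>{..<n}. if e i = j then t j else \<one>)"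
      by (rule finprod_cong') (use t_closed in \<open>auto simp: w_def int_pow_1\<close>)
    also have "\<dots> = d i" using e t_closed by (subst finprod_singleton) auto
    finally show ?thesis ..
  qed
  then have "d = (\<lambda>i. \<Otimes>j\<in>{..<n}. t j [^] fps_nth (w j) i)" by (rule ext)
  with d(2) have "g = series (\<lambda>i. \<Otimes>j\<in>{..<n}. t j [^] fps_nth (w j) i)" by (rule subst[rotated])
  also have "\<dots> = comb w"
    unfolding combine_def act_def by (rule series_finprod) (use t_closed in auto)
  finally show ?thesis by auto
qed

text \<open>
  The constant coefficients of relations between the generators, reduced to a finite set. The entry \<open>m\<close> is admitted so
  that \<open>m\<close> times a standard basis vector belongs to the set.
\<close>

definition leading_vectors :: "(nat \<Rightarrow> int) set" where
  "leading_vectors = {c \<in> {..<n} \<rightarrow>\<^sub>E {0..int m}. (\<Otimes>j\<in>{..<n}. t j [^] c j) \<in> x ` carrier G}"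

lemma finite_leading: "finite leading_vectors"
proof -
  have "finite ({..<n} \<rightarrow>\<^sub>E {0..int m})" by (intro finite_PiE) auto
  then show ?thesis by (auto simp: leading_vectors_def)
qed

text \<open>
  If \<open>\<Sum>\<^sub>j c\<^sub>j t\<^sub>j\<close> lies in \<open>x G\<close>, it is \<open>x\<close> times a combination \<open>\<Sum>\<^sub>j w\<^sub>j t\<^sub>j\<close>, and \<open>c - X w\<close> is a relation.
\<close>

lemma relations_exist:
  "\<exists>r. \<forall>c\<in>leading_vectors. comb (r c) = \<one> \<and> (\<forall>j. fps_nth (r c j) 0 = c j)"
proof -
  have "\<exists>r. comb r = \<one> \<and> (\<forall>j. fps_nth (r j) 0 = c j)" if c: "c \<in> leading_vectors" for c
  proof -
    obtain h where h: "h \<in> carrier G" "(\<Otimes>j\<in>{..<n}. t j [^] c j) = x h"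
      using c by (auto simp: leading_vectors_def)
    obtain w where "comb w = h" using comb_surj[OF h(1)] by blast
    then have "comb (\<lambda>j. fps_const (c j) - fps_X * w j) = \<one>"
      using h by (simp add: comb_diff comb_const comb_X)
    then show ?thesis by (intro exI[of _ "\<lambda>j. fps_const (c j) - fps_X * w j"]) auto
  qed
  then show ?thesis by metis
qed

text \<open>
  The vectors in the kernel of the presentation, described by residues: the combination of the generators vanishes
  modulo every \<open>x\<^sup>N G\<close>.
\<close>

definition kernel_vector :: "(nat \<Rightarrow> nat \<Rightarrow> nat \<Rightarrow> int) \<Rightarrow> bool" where
  "kernel_vector v \<longleftrightarrow> (\<forall>j<n. v j \<in> carrier (madic_series m)) \<and>
     (\<forall>N. near N (comb (\<lambda>j. residue_series N (v j))) \<one>)"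

text \<open>
  With the chosen relations \<open>r\<^sub>c\<close>, the kernel is spanned over \<open>\<int>\<^sub>m\<close> by the \<open>r\<^sub>c\<close> modulo \<open>X\<close> times itself. If
  \<open>c\<close> is the constant vector of \<open>v\<close> reduced modulo \<open>m\<close>, then the constant vector of \<open>v\<close> is \<open>c + m q\<close> for
  some \<open>m\<close>-adic vector \<open>q\<close>; it is cancelled by \<open>r\<^sub>c\<close> and multiples of the relations led by the vectors
  \<open>m e\<^sub>k\<close>. What remains is divisible by \<open>X\<close>, and the quotient is in the kernel since \<open>x\<close> is injective.
\<close>

lemma kernel_step:
  assumes rel: "\<forall>c\<in>leading_vectors. comb (r c) = \<one> \<and> (\<forall>j. fps_nth (r c j) 0 = c j)"
    and v: "kernel_vector v"
  shows "\<exists>a v'. (\<forall>c. a c \<in> carrier (madic_ring m)) \<and> kernel_vector v' \<and>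
     (\<forall>N. \<forall>j<n. fps_cong (int m ^ N) (residue_series N (v j))
        ((\<Sum>c\<in>leading_vectors. fps_const (a c N) * r c j) + fps_X * residue_series N (v' j)))"
proof -
  let ?D = leading_vectors and ?Z = "madic_ring m"
  have m_pos: "int m > 0" using m_ge by simp
  have r: "comb (r c) = \<one>" "fps_nth (r c j) 0 = c j" if "c \<in> ?D" for c j
    using rel that by auto
  have vj: "v j i \<in> carrier ?Z" if "j < n" for j i
    using v that by (simp add: kernel_vector_def series_carrier_iff)
  have vcong: "[v j i (Suc N) = v j i N] (mod int m ^ N)" if "j < n" for j i N
    using madic_carrier_cong[OF m_ge vj[OF that]] .
  define c where "c = (\<lambda>j\<in>{..<n}. v j 0 1)"
  have c_range: "v j 0 1 \<in> {0..<int m}" if "j < n" for j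
  proof -
    have "v j 0 1 \<in> {0..<int m ^ 1}"
      using vj[OF that, of 0] unfolding madic_ring_def by (simp only: partial_object.simps mem_Collect_eq)
    then show ?thesis by simp
  qed
  have "near 1 (\<Otimes>j\<in>{..<n}. t j [^] c j) \<one>"
  proof -
    have "near 1 (comb (\<lambda>j. residue_series 1 (v j))) (\<Otimes>j\<in>{..<n}. t j [^] c j)"
      unfolding combine_def
    proof (rule near_finprod)
      fix j assume "j \<in> {..<n}"
      then have j: "j < n" by simp
      have "near 1 (act (residue_series 1 (v j)) (t j)) (t j [^] v j 0 1)"
        by (rule nearI[of _ "act (fps_shift 1 (residue_series 1 (v j))) (t j)"])
          (use act_shift[OF t_closed[OF j], of "residue_series 1 (v j)"] t_closed[OF j] in simp_all)
      then show "near 1 (act (residue_series 1 (v j)) (t j)) (t j [^] c j)"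
        using j t_closed[OF j] by (simp add: c_def)
    qed simp
    then show ?thesis using v near_sym near_trans unfolding kernel_vector_def by blast
  qed
  moreover have "c \<in> {..<n} \<rightarrow>\<^sub>E {0..int m}"
    unfolding c_def by (rule restrict_PiE_iff[THEN iffD2]) (use c_range in \<open>force simp: less_imp_le\<close>)
  ultimately have cD: "c \<in> ?D"
    by (simp add: leading_vectors_def near_one_iff)
  \<comment> \<open>The vectors \<open>m e\<^sub>k\<close> lead relations as well, and absorb the multiples of \<open>m\<close>.\<close>
  define e where "e k = (\<lambda>j\<in>{..<n}. if j = k then int m else 0)" for k
  have eD: "e k \<in> ?D" if "k < n" for k
  proof -
    have "(\<Otimes>j\<in>{..<n}. t j [^] e k j) = (\<Otimes>j\<in>{..<n}. if k = j then t j [^] int m else \<one>)"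
      by (rule finprod_cong') (use t_closed in \<open>auto simp: e_def\<close>)
    also have "\<dots> = t k [^] m"
      using that t_closed by (subst finprod_singleton) (auto simp: int_pow_int)
    finally show ?thesis
      using pow_m[OF t_closed[OF that]] m_pos by (auto simp: leading_vectors_def e_def)
  qed
  define q where "q k N = v k 0 (Suc N) div int m" for k N
  have q_eq: "v k 0 (Suc N) = v k 0 1 + int m * q k N" if "k < n" for k N
  proof -
    have "v k 0 (Suc N) mod int m = v k 0 1 mod int m"
      using madic_carrier_cong_le[OF m_ge vj[OF that, of 0], of 1 "Suc N"] by (simp add: cong_def)
    then have "v k 0 (Suc N) mod int m = v k 0 1" using c_range[OF that] by simp
    then show ?thesis unfolding q_def by (metis add.commute div_mult_mod_eq mult.commute)
  qed
  have q_cong: "[q k (Suc N) = q k N] (mod int m ^ N)" if "k < n" for k N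
  proof -
    have "int m * int m ^ N dvd int m * (q k (Suc N) - q k N)"
      using vcong[OF that, of 0 "Suc N"] unfolding q_eq[OF that, of N] q_eq[OF that, of "Suc N"]
      by (simp add: cong_iff_dvd_diff right_diff_distrib)
    then show ?thesis using m_pos by (simp add: cong_iff_dvd_diff)
  qed
  define a0 where "a0 d N = (if d = c then 1 else 0) + (\<Sum>k<n. if d = e k then q k N else 0)" for d N
  define a where "a d = (\<lambda>N. a0 d N mod int m ^ N)" for d
  have a_carrier: "a d \<in> carrier ?Z" for d
    unfolding a_def
  proof (rule madic_reduce_carrier[OF m_ge])
    fix N
    show "[a0 d (Suc N) = a0 d N] (mod int m ^ N)"
      unfolding a0_def by (intro cong_add cong_sum) (auto intro: q_cong)
  qed
  have lead: "[(\<Sum>d\<in>?D. a d N * d j) = v j 0 N] (mod int m ^ N)" if j: "j < n" for N j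
  proof -
    have "[(\<Sum>d\<in>?D. a d N * d j) = (\<Sum>d\<in>?D. a0 d N * d j)] (mod int m ^ N)"
      by (intro cong_sum cong_mult) (auto simp: a_def cong_def)
    moreover have "(\<Sum>d\<in>?D. a0 d N * d j) = v j 0 (Suc N)"
    proof -
      have "(\<Sum>d\<in>?D. a0 d N * d j) =
          (\<Sum>d\<in>?D. if d = c then d j else 0) + (\<Sum>d\<in>?D. \<Sum>k<n. if d = e k then q k N * d j else 0)"
        by (simp add: a0_def distrib_right sum_distrib_right sum.distrib if_distrib[of "\<lambda>u. u * _"] cong: if_cong)
      also have "(\<Sum>d\<in>?D. if d = c then d j else 0) = v j 0 1"
        using cD j finite_leading by (simp add: c_def)
      also have "(\<Sum>d\<in>?D. \<Sum>k<n. if d = e k then q k N * d j else 0) = (\<Sum>k<n. q k N * e k j)"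
        using finite_leading by (subst sum.swap) (auto simp: eD intro!: sum.cong)
      also have "(\<Sum>k<n. q k N * e k j) = int m * q j N"
        using j by (simp add: e_def if_distrib[of "\<lambda>u. _ * u"] cong: if_cong)
      finally show ?thesis using q_eq[OF j, of N] by simp
    qed
    ultimately show ?thesis using vcong[OF j, of 0 N] cong_trans by simp
  qed
  define s where "s N j = (\<Sum>d\<in>?D. fps_const (a d N) * r d j)" for N j
  have s_0: "fps_nth (s N j) 0 = (\<Sum>d\<in>?D. a d N * d j)" for N j
    by (simp add: s_def fps_sum_nth r(2))
  \<comment> \<open>The quotient by \<open>X\<close> of what is left of \<open>v\<close>, reduced to standard residues.\<close>
  define v' where "v' j i N = (v j (Suc i) N - fps_nth (s N j) (Suc i)) mod int m ^ N" for j i N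
  have main: "fps_cong (int m ^ N) (residue_series N (v j)) (s N j + fps_X * residue_series N (v' j))"
    if j: "j < n" for N j
    unfolding fps_cong_def
  proof
    fix i
    show "[fps_nth (residue_series N (v j)) i = fps_nth (s N j + fps_X * residue_series N (v' j)) i] (mod int m ^ N)"
    proof (cases i)
      case 0
      then show ?thesis using lead[OF j, of N] by (simp add: s_0 cong_sym)
    next
      case (Suc i')
      then show ?thesis by (simp add: v'_def cong_def mod_simps)
    qed
  qed
  have "v' j \<in> carrier (madic_series m)" if j: "j < n" for j
  proof -
    have "v' j i \<in> carrier ?Z" for i
      unfolding v'_def
    proof (rule madic_reduce_carrier[OF m_ge])
      fix N
      have "[a d (Suc N) = a d N] (mod int m ^ N)" for d
        by (rule madic_carrier_cong[OF m_ge a_carrier])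
      then show "[v j (Suc i) (Suc N) - fps_nth (s (Suc N) j) (Suc i) =
          v j (Suc i) N - fps_nth (s N j) (Suc i)] (mod int m ^ N)"
        unfolding s_def fps_sum_nth fps_mult_left_const_nth
        by (intro cong_diff cong_sum cong_mult vcong j cong_refl)
    qed
    then show ?thesis by (simp add: series_carrier_iff)
  qed
  moreover have "near N (comb (\<lambda>j. residue_series N (v' j))) \<one>" for N
  proof -
    let ?u = "comb (\<lambda>j. residue_series (Suc N) (v' j))"
    have "near (Suc N) (comb (\<lambda>j. residue_series (Suc N) (v j)))
        (comb (\<lambda>j. s (Suc N) j + fps_X * residue_series (Suc N) (v' j)))"
      by (rule comb_near_cong) (rule main)
    also have "comb (\<lambda>j. s (Suc N) j + fps_X * residue_series (Suc N) (v' j)) = x ?u"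
      unfolding s_def using comb_sum_relations[OF finite_leading, of r] r(1) by (simp add: comb_add comb_X)
    finally have "near (Suc N) (x ?u) (x \<one>)"
      using v near_sym near_trans unfolding kernel_vector_def x_one by blast
    then have "near N ?u \<one>" by (rule near_x_cancel[rotated 2]) auto
    moreover have "near N ?u (comb (\<lambda>j. residue_series N (v' j)))"
    proof (rule comb_near_cong)
      fix j assume "j < n"
      then have "v' j \<in> carrier (madic_series m)" by fact
      then show "fps_cong (int m ^ N) (residue_series (Suc N) (v' j)) (residue_series N (v' j))"
        using madic_carrier_cong[OF m_ge] by (simp add: fps_cong_def series_carrier_iff)
    qed
    ultimately show ?thesis using near_sym near_trans by blast
  qed
  ultimately have "kernel_vector v'" by (simp add: kernel_vector_def)
  then show ?thesis using a_carrier main unfolding s_def by blast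
qed

text \<open>
  Iteration of \<open>kernel_step\<close>: the scalars found in step \<open>i\<close> are the coefficients of \<open>X\<^sup>i\<close> in the power series that
  multiply the relations.
\<close>

lemma kernel_expansion:
  assumes rel: "\<forall>c\<in>leading_vectors. comb (r c) = \<one> \<and> (\<forall>j. fps_nth (r c j) 0 = c j)"
    and v: "kernel_vector v"
  shows "\<exists>C. (\<forall>c. C c \<in> carrier (madic_series m)) \<and>
     (\<forall>N. \<forall>j<n. fps_cong (int m ^ N) (residue_series N (v j))
        (\<Sum>c\<in>leading_vectors. residue_series N (C c) * r c j))"
proof -
  let ?D = leading_vectors
  define stp where "stp v p \<longleftrightarrow> (\<forall>c. fst p c \<in> carrier (madic_ring m)) \<and> kernel_vector (snd p) \<and>
     (\<forall>N. \<forall>j<n. fps_cong (int m ^ N) (residue_series N (v j))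
        ((\<Sum>c\<in>?D. fps_const (fst p c N) * r c j) + fps_X * residue_series N (snd p j)))" for v p
  define F where "F v = (SOME p. stp v p)" for v
  have F: "stp v (F v)" if kv: "kernel_vector v" for v
  proof -
    from kernel_step[OF rel kv] obtain a v' where "stp v (a, v')"
      unfolding stp_def fst_conv snd_conv by (elim exE)
    then show ?thesis unfolding F_def by (rule someI)
  qed
  define a where "a v = fst (F v)" for v
  define nxt where "nxt v = snd (F v)" for v
  have step: "a v c \<in> carrier (madic_ring m)" "kernel_vector (nxt v)"
      "j < n \<Longrightarrow> fps_cong (int m ^ N) (residue_series N (v j))
        ((\<Sum>c\<in>?D. fps_const (a v c N) * r c j) + fps_X * residue_series N (nxt v j))"
    if "kernel_vector v" for v c N j
    using F[OF that] unfolding stp_def a_def nxt_def by simp_all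
  define V where "V s = (nxt ^^ s) v" for s
  have V: "kernel_vector (V s)" for s
    unfolding V_def by (induction s) (use v step(2) in auto)
  have V_Suc: "nxt (V s) = V (Suc s)" for s by (simp add: V_def)
  define A where "A s N c = Abs_fps (\<lambda>i. a (V (s + i)) c N)" for s N c
  define Q where "Q s N j = (\<Sum>c\<in>?D. A s N c * r c j)" for s N j
  have A_eq: "A s N c = fps_const (a (V s) c N) + fps_X * A (Suc s) N c" for s N c
    by (rule fps_ext) (auto simp: A_def)
  have Q_eq: "Q s N j = (\<Sum>c\<in>?D. fps_const (a (V s) c N) * r c j) + fps_X * Q (Suc s) N j" for s N j
    unfolding Q_def
    by (simp only: A_eq[of s] distrib_right sum.distrib sum_distrib_left mult.assoc)
  have main: "[fps_nth (residue_series N (V s j)) i = fps_nth (Q s N j) i] (mod int m ^ N)"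
    if j: "j < n" for s N j i
  proof (induction i arbitrary: s)
    case 0
    have "[fps_nth (residue_series N (V s j)) 0 = fps_nth
        ((\<Sum>c\<in>?D. fps_const (a (V s) c N) * r c j) + fps_X * residue_series N (nxt (V s) j)) 0] (mod int m ^ N)"
      using step(3)[OF V j] unfolding fps_cong_def by blast
    then show ?case by (subst Q_eq) simp
  next
    case (Suc i)
    have "[fps_nth (residue_series N (V s j)) (Suc i) = fps_nth
        ((\<Sum>c\<in>?D. fps_const (a (V s) c N) * r c j) + fps_X * residue_series N (nxt (V s) j)) (Suc i)] (mod int m ^ N)"
      using step(3)[OF V j] unfolding fps_cong_def by blast
    moreover have "[fps_nth ((\<Sum>c\<in>?D. fps_const (a (V s) c N) * r c j) + fps_X * residue_series N (nxt (V s) j)) (Suc i)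
        = fps_nth (Q s N j) (Suc i)] (mod int m ^ N)"
      using Suc[of "Suc s"] by (subst Q_eq) (simp add: V_Suc cong_add_lcancel)
    ultimately show ?case by (rule cong_trans)
  qed
  have A_0: "A 0 N c = residue_series N (\<lambda>i. a (V i) c)" for N c
    by (rule fps_ext) (simp add: A_def)
  have "fps_cong (int m ^ N) (residue_series N (V 0 j))
      (\<Sum>c\<in>?D. residue_series N (\<lambda>i. a (V i) c) * r c j)" if "j < n" for N j
    using main[OF that, of N 0] unfolding fps_cong_def Q_def A_0 by blast
  then have expansion: "fps_cong (int m ^ N) (residue_series N (v j))
      (\<Sum>c\<in>?D. residue_series N (\<lambda>i. a (V i) c) * r c j)" if "j < n" for N j
    using that unfolding V_def funpow_0 .
  show ?thesis
  proof (rule exI[of _ "\<lambda>c i. a (V i) c"], rule conjI)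
    show "\<forall>c. (\<lambda>i. a (V i) c) \<in> carrier (madic_series m)"
      unfolding series_carrier_iff using step(1)[OF V] by blast
    show "\<forall>N. \<forall>j<n. fps_cong (int m ^ N) (residue_series N (v j))
        (\<Sum>c\<in>?D. residue_series N (\<lambda>i. a (V i) c) * r c j)"
      using expansion by blast
  qed
qed


theorem finitely_presented:
  assumes sm: "\<forall>q\<in>carrier (madic_series m). \<forall>g\<in>carrier G. \<forall>N.
      near N (sm q g) (act (residue_series N q) g)"
  shows "finitely_presented_module (madic_series m) (additive_module G sm)"
proof -
  let ?R = "madic_series m" and ?M = "additive_module G sm"
  let ?F = "free_module ?R n"
  interpret R: cring ?R by (rule madic_series_cring[OF m_ge])
  interpret M: Module.module ?R ?M by (rule series_module[OF sm])
  interpret F: Module.module ?R ?F by (rule R.free_module_module)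
  have near_sm: "near N (sm q g) (act (residue_series N q) g)" if "q \<in> carrier ?R" "g \<in> carrier G" for q g N
    using sm that by blast
  define f where "f v = (\<Otimes>j\<in>{..<n}. sm (v j) (t j))" for v
  have f_near: "near N (f v) (comb w)"
    if "\<And>j. j < n \<Longrightarrow> v j \<in> carrier ?R" "\<And>j. j < n \<Longrightarrow> fps_cong (int m ^ N) (residue_series N (v j)) (w j)" for v w N
  proof -
    have "near N (f v) (comb (\<lambda>j. residue_series N (v j)))"
      unfolding f_def combine_def by (rule near_finprod) (use that t_closed near_sm in auto)
    also have "near N \<dots> (comb w)" by (rule comb_near_cong) (rule that)
    finally show ?thesis .
  qed
  have f_residue: "near N (f v) (comb (\<lambda>j. residue_series N (v j)))" if "v \<in> carrier ?F" for v N
    by (rule f_near) (use that in auto)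
  have f_closed: "f v \<in> carrier G" if "v \<in> carrier ?F" for v
    using f_residue[OF that] near_closed by blast
  have linear: "f \<in> linear_maps ?R ?F ?M"
    unfolding linear_maps_def additive_module_simps
  proof (intro CollectI conjI ballI)
    show "f \<in> carrier ?F \<rightarrow> carrier G" using f_closed by blast
  next
    fix v w assume v: "v \<in> carrier ?F" and w: "w \<in> carrier ?F"
    show "f (v \<oplus>\<^bsub>?F\<^esub> w) = f v \<otimes> f w"
    proof (rule near_all_eq)
      fix N
      have "near N (f (v \<oplus>\<^bsub>?F\<^esub> w)) (comb (\<lambda>j. residue_series N (v j) + residue_series N (w j)))"
        by (rule f_near) (use v w residue_series_add in auto)
      also have "near N \<dots> (f v \<otimes> f w)"
        unfolding comb_add by (intro near_mult near_sym[OF f_residue] v w)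
      finally show "near N (f (v \<oplus>\<^bsub>?F\<^esub> w)) (f v \<otimes> f w)" .
    qed
  next
    fix r v assume r: "r \<in> carrier ?R" and v: "v \<in> carrier ?F"
    show "f (r \<odot>\<^bsub>?F\<^esub> v) = sm r (f v)"
    proof (rule near_all_eq)
      fix N
      have "near N (f (r \<odot>\<^bsub>?F\<^esub> v)) (comb (\<lambda>j. residue_series N r * residue_series N (v j)))"
        by (rule f_near) (use r v residue_series_mult[OF m_ge r] in auto)
      also have "near N \<dots> (act (residue_series N r) (f v))"
        unfolding comb_mult by (rule near_act[OF near_sym[OF f_residue[OF v]]])
      also have "near N \<dots> (sm r (f v))" by (rule near_sym[OF near_sm[OF r f_closed[OF v]]])
      finally show "near N (f (r \<odot>\<^bsub>?F\<^esub> v)) (sm r (f v))" .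
    qed
  qed
  define lift where "lift w = (\<lambda>j\<in>{..<n}. series_of_fps m (w j))" for w
  have lift_closed: "lift w \<in> carrier ?F" for w
    using series_of_fps_carrier[OF m_ge] by (simp add: lift_def)
  have f_lift: "f (lift w) = comb w" for w
  proof (rule near_all_eq)
    fix N
    show "near N (f (lift w)) (comb w)"
      by (rule f_near) (use lift_closed[of w] residue_series_of_fps in \<open>auto simp: lift_def\<close>)
  qed
  have surj: "f ` carrier ?F = carrier ?M"
  proof
    show "f ` carrier ?F \<subseteq> carrier ?M" using f_closed by auto
    show "carrier ?M \<subseteq> f ` carrier ?F"
    proof
      fix g assume "g \<in> carrier ?M"
      then obtain w where "comb w = g" using comb_surj by auto
      then show "g \<in> f ` carrier ?F" by (intro image_eqI[OF _ lift_closed[of w]]) (simp add: f_lift)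
    qed
  qed
  obtain r where r: "\<forall>c\<in>leading_vectors. comb (r c) = \<one> \<and> (\<forall>j. fps_nth (r c j) 0 = c j)"
    using relations_exist by (rule exE)
  define S where "S = (\<lambda>c. lift (r c)) ` leading_vectors"
  let ?K = "{v \<in> carrier ?F. f v = \<zero>\<^bsub>?M\<^esub>}"
  have "submodule_span ?R ?F S = ?K"
  proof
    show "submodule_span ?R ?F S \<subseteq> ?K"
      by (rule submodule_span_least, rule linear_kernel_submodule[OF F.module_axioms M.module_axioms linear])
        (use r lift_closed f_lift in \<open>auto simp: S_def simp del: free_module_simps(1)\<close>)
    show "?K \<subseteq> submodule_span ?R ?F S"
    proof
      fix v assume "v \<in> ?K"
      then have v: "v \<in> carrier ?F" "f v = \<one>" by auto
      have vj: "v j \<in> carrier ?R" if "j < n" for j using v(1) that by auto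
      have "kernel_vector v"
        unfolding kernel_vector_def using f_residue[OF v(1)] near_sym v(2) vj by metis
      from kernel_expansion[OF r this]
      obtain C where "(\<forall>c. C c \<in> carrier ?R) \<and>
          (\<forall>N. \<forall>j<n. fps_cong (int m ^ N) (residue_series N (v j))
            (\<Sum>c\<in>leading_vectors. residue_series N (C c) * r c j))"
        by (rule exE)
      then have C: "C c \<in> carrier ?R"
        and expansion: "j < n \<Longrightarrow> fps_cong (int m ^ N) (residue_series N (v j))
            (\<Sum>c\<in>leading_vectors. residue_series N (C c) * r c j)" for c N j
        by blast+
      let ?s = "\<Oplus>\<^bsub>?F\<^esub>c\<in>leading_vectors. C c \<odot>\<^bsub>?F\<^esub> lift (r c)"
      have term_closed: "C c \<odot>\<^bsub>?F\<^esub> lift (r c) \<in> carrier ?F" for c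
        by (rule F.smult_closed[OF C lift_closed])
      have "?s \<in> carrier ?F" by (rule F.finsum_closed) (use term_closed in blast)
      have "v = ?s"
      proof (rule PiE_ext[of _ "{..<n}" "\<lambda>_. carrier ?R"])
        show "v \<in> {..<n} \<rightarrow>\<^sub>E carrier ?R" "?s \<in> {..<n} \<rightarrow>\<^sub>E carrier ?R"
          using v(1) \<open>?s \<in> carrier ?F\<close> by simp_all
        fix j assume "j \<in> {..<n}"
        then have j: "j < n" by simp
        have lj: "lift (r c) j \<in> carrier ?R" for c using lift_closed[of "r c"] j by auto
        have sj: "?s j = (\<Oplus>\<^bsub>?R\<^esub>c\<in>leading_vectors. C c \<otimes>\<^bsub>?R\<^esub> lift (r c) j)"
        proof -
          have "(\<lambda>c. (C c \<odot>\<^bsub>?F\<^esub> lift (r c)) j) = (\<lambda>c. C c \<otimes>\<^bsub>?R\<^esub> lift (r c) j)"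
            using j by (intro ext) simp
          then show ?thesis
            using R.free_module_finsum_nth[OF finite_leading term_closed j] by (simp only:)
        qed
        show "v j = ?s j"
        proof (rule series_eqI[OF m_ge vj[OF j]])
          show "?s j \<in> carrier ?R" using \<open>?s \<in> carrier ?F\<close> j by auto
          fix N
          have "fps_cong (int m ^ N) (residue_series N (?s j))
              (\<Sum>c\<in>leading_vectors. residue_series N (C c \<otimes>\<^bsub>?R\<^esub> lift (r c) j))"
            unfolding sj by (rule residue_series_finsum[OF m_ge finite_leading]) (intro R.m_closed C lj)
          also have "fps_cong (int m ^ N) \<dots> (\<Sum>c\<in>leading_vectors. residue_series N (C c) * r c j)"
          proof (rule fps_cong_sum)
            fix c
            have "fps_cong (int m ^ N) (residue_series N (lift (r c) j)) (r c j)"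
              using residue_series_of_fps j by (simp add: lift_def)
            then show "fps_cong (int m ^ N) (residue_series N (C c \<otimes>\<^bsub>?R\<^esub> lift (r c) j)) (residue_series N (C c) * r c j)"
              using residue_series_mult[OF m_ge C lj] fps_cong_mult fps_cong_refl fps_cong_trans by meson
          qed
          finally show "fps_cong (int m ^ N) (residue_series N (v j)) (residue_series N (?s j))"
            using expansion[OF j] fps_cong_sym fps_cong_trans by blast
        qed
      qed
      moreover have "?s \<in> L" if "submodule L ?R ?F" "S \<subseteq> L" for L
        by (rule F.submodule_finsum_smult[OF that(1) finite_leading C]) (use that(2) in \<open>auto simp: S_def\<close>)
      ultimately show "v \<in> submodule_span ?R ?F S" unfolding submodule_span_def by blast
    qed
  qed
  moreover have "finite S" "S \<subseteq> carrier ?F"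
    unfolding S_def using finite_leading lift_closed by blast+
  ultimately show ?thesis
    unfolding finitely_presented_module_def using M.module_axioms linear surj by blast
qed

end


section \<open>Integral relations of a single element\<close>

text \<open>
  Koenig's lemma: a finite sequence that extends to a solution of every \<open>P N\<close> can be prolonged by one entry of the
  finite set \<open>B\<close> without losing this property, and \<open>P N\<close> sees only the first \<open>N\<close> entries.
\<close>

lemma bounded_sequences_compact:
  fixes P :: "nat \<Rightarrow> (nat \<Rightarrow> 'b) \<Rightarrow> bool"
  assumes B: "finite B"
    and ex: "\<And>N. \<exists>f. (\<forall>i. f i \<in> B) \<and> P N f"
    and anti: "\<And>M N f. P N f \<Longrightarrow> M \<le> N \<Longrightarrow> P M f"
    and local: "\<And>N f f'. P N f \<Longrightarrow> (\<And>i. i < N \<Longrightarrow> f i = f' i) \<Longrightarrow> P N f'"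
  shows "\<exists>f. (\<forall>i. f i \<in> B) \<and> (\<forall>N. P N f)"
proof -
  define good where "good k p \<longleftrightarrow> (\<forall>N. \<exists>f. (\<forall>i. f i \<in> B) \<and> P N f \<and> (\<forall>i<k. f i = p i))" for k p
  have extend: "\<exists>p'. good (Suc k) p' \<and> (\<forall>i<k. p' i = p i)" if "good k p" for k p
  proof (rule ccontr)
    assume no: "\<nexists>p'. good (Suc k) p' \<and> (\<forall>i<k. p' i = p i)"
    have "\<exists>N. \<nexists>f. (\<forall>i. f i \<in> B) \<and> P N f \<and> (\<forall>i<Suc k. f i = (p(k := b)) i)" for b
    proof (rule ccontr)
      assume "\<not> ?thesis"
      then have "good (Suc k) (p(k := b))" by (simp only: good_def not_not simp_thms not_ex) blast
      with no show False by auto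
    qed
    then obtain M where M: "\<And>b f. \<lbrakk>\<forall>i. f i \<in> B; P (M b) f; \<forall>i<Suc k. f i = (p(k := b)) i\<rbrakk> \<Longrightarrow> False"
      by metis
    obtain f where f: "\<forall>i. f i \<in> B" "P (Max (M ` B)) f" "\<forall>i<k. f i = p i"
      using \<open>good k p\<close> unfolding good_def by blast
    have "M (f k) \<le> Max (M ` B)" using B f(1) by simp
    then have "P (M (f k)) f" using anti f(2) by blast
    with M[OF f(1) this] f(3) show False by (simp add: less_Suc_eq)
  qed
  have "good 0 p" for p using ex by (simp add: good_def)
  then have "\<exists>p. \<forall>k. good k (p k) \<and> (\<forall>i<k. p (Suc k) i = p k i)"
    using extend by (intro dependent_nat_choice) blast+
  then obtain p where p: "\<And>k. good k (p k)" "\<And>k. \<forall>i<k. p (Suc k) i = p k i" by blast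
  define f where "f i = p (Suc i) i" for i
  have p_f: "i < k \<Longrightarrow> p k i = f i" for i k
  proof (induction k)
    case (Suc k)
    then show ?case using p(2)[of k] by (cases "i = k") (auto simp: f_def)
  qed simp
  have "f i \<in> B" for i
    using p(1)[of "Suc i"] unfolding good_def f_def by (metis lessI)
  moreover have "P N f" for N
    using p(1)[of N] local p_f unfolding good_def by metis
  ultimately show ?thesis by blast
qed

context adic_group
begin

lemma finite_transversals:
  assumes T: "finite T" "T \<subseteq> carrier G" "\<forall>g\<in>carrier G. \<exists>t\<in>T. \<exists>h\<in>carrier G. g = t \<otimes> x h"
  shows "\<exists>S. finite S \<and> S \<subseteq> carrier G \<and> card S \<le> card T ^ N \<and> (\<forall>g\<in>carrier G. \<exists>s\<in>S. near N g s)"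
proof (induction N)
  case 0
  show ?case by (rule exI[of _ "{\<one>}"]) (simp add: near_0)
next
  case (Suc N)
  then obtain S where S: "finite S" "S \<subseteq> carrier G" "card S \<le> card T ^ N" "\<forall>g\<in>carrier G. \<exists>s\<in>S. near N g s"
    by blast
  let ?S = "(\<lambda>(t, s). t \<otimes> x s) ` (T \<times> S)"
  have "card ?S \<le> card T * card S"
    using card_image_le[of "T \<times> S"] T(1) S(1) by (simp add: card_cartesian_product)
  also have "\<dots> \<le> card T ^ Suc N" using S(3) by simp
  finally have "card ?S \<le> card T ^ Suc N" .
  moreover have "\<exists>s\<in>?S. near (Suc N) g s" if g: "g \<in> carrier G" for g
  proof -
    obtain t h where t: "t \<in> T" "h \<in> carrier G" "g = t \<otimes> x h" using T(3) g by blast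
    obtain s where s: "s \<in> S" "near N h s" using S(4) t by blast
    have "near (Suc N) g (t \<otimes> x s)"
      unfolding t(3) by (intro near_mult near_refl near_x s) (use t T in auto)
    then show ?thesis using t s by force
  qed
  moreover have "?S \<subseteq> carrier G" using S(2) T(2) by (auto simp: subset_iff)
  ultimately show ?case using S(1) T(1) by (intro exI[of _ ?S]) auto
qed

lemma near_xpow_cancel:
  "\<lbrakk>g \<in> carrier G; h \<in> carrier G; near (N + i) ((x ^^ i) g) ((x ^^ i) h)\<rbrakk> \<Longrightarrow> near N g h"
proof (induction i)
  case (Suc i)
  then have "near (Suc (N + i)) (x ((x ^^ i) g)) (x ((x ^^ i) h))" by simp
  then have "near (N + i) ((x ^^ i) g) ((x ^^ i) h)"
    using near_x_cancel Suc.prems by blast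
  then show ?case using Suc by blast
qed simp

text \<open>
  There are \<open>q ^ N\<close> polynomials of degree below \<open>N\<close> with coefficients in \<open>{0..<q}\<close>, and at most \<open>card T ^ (2 * N)\<close> cosets
  of \<open>x\<^sup>2\<^sup>N G\<close>; so two polynomials agree on \<open>g\<close> modulo \<open>x\<^sup>2\<^sup>N G\<close>. Their difference may begin with a power of
  \<open>X\<close>, of exponent below \<open>N\<close>; this power is cancelled because \<open>x\<close> is injective, and at least \<open>N\<close> of the \<open>2 N\<close> steps
  remain.
\<close>

lemma approximate_relation:
  assumes g: "g \<in> carrier G"
    and T: "finite T" "T \<subseteq> carrier G" "\<forall>g\<in>carrier G. \<exists>t\<in>T. \<exists>h\<in>carrier G. g = t \<otimes> x h"
    and q: "q > card T ^ 2"
  shows "\<exists>F. fps_nth F 0 \<noteq> 0 \<and> (\<forall>i. fps_nth F i \<in> {- int q..int q}) \<and> near N (act F g) \<one>"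
proof (cases "N = 0")
  case True
  then show ?thesis using g q by (intro exI[of _ 1]) (auto simp: near_0)
next
  case False
  obtain S where S: "finite S" "S \<subseteq> carrier G" "card S \<le> card T ^ (2 * N)"
      "\<forall>g\<in>carrier G. \<exists>s\<in>S. near (2 * N) g s"
    using finite_transversals[OF T, of "2 * N"] by (elim exE conjE)
  define P where "P = {..<N} \<rightarrow>\<^sub>E {0..<int q}"
  define ser where "ser c = Abs_fps (\<lambda>i. if i < N then c i else 0)" for c :: "nat \<Rightarrow> int"
  obtain \<phi> where \<phi>: "\<And>c. \<phi> c \<in> S \<and> near (2 * N) (act (ser c) g) (\<phi> c)"
  proof -
    have "\<forall>c. \<exists>s. s \<in> S \<and> near (2 * N) (act (ser c) g) s" using S(4) act_closed[OF g] by blast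
    then show ?thesis using that by metis
  qed
  have "card (\<phi> ` P) \<le> card S" using \<phi> S(1) by (intro card_mono) auto
  also have "\<dots> \<le> (card T ^ 2) ^ N" using S(3) by (simp add: power_mult)
  also have "\<dots> < q ^ N" using q False by (intro power_strict_mono) auto
  also have "\<dots> = card P" by (simp add: P_def card_PiE)
  finally have "\<not> inj_on \<phi> P" by (rule pigeonhole)
  then obtain c d where cd: "c \<in> P" "d \<in> P" "c \<noteq> d" "\<phi> c = \<phi> d" by (auto simp: inj_on_def)
  define H where "H = ser c - ser d"
  have "near (2 * N) (act (ser c) g) (act (ser d) g)"
    using \<phi> cd(4) near_sym near_trans by metis
  then have "near (2 * N) (act (ser c) g \<otimes> inv (act (ser d) g)) \<one>"
    using near_mult[OF _ near_refl[of "inv (act (ser d) g)"]] g by fastforce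
  then have nearH: "near (2 * N) (act H g) \<one>" using g by (simp add: H_def act_diff)
  obtain i where i: "i < N" "c i \<noteq> d i"
    using cd(1-3) unfolding P_def by (metis PiE_ext lessThan_iff)
  then have Hi: "fps_nth H i \<noteq> 0" by (simp add: H_def ser_def)
  define j where "j = subdegree H"
  have j: "j < N" using subdegree_leI[OF Hi] i(1) by (simp add: j_def)
  define F where "F = fps_shift j H"
  have "H = fps_X ^ j * F"
    using subdegree_decompose[of H] by (simp add: F_def j_def mult.commute)
  then have "near (2 * N) ((x ^^ j) (act F g)) ((x ^^ j) \<one>)"
    using nearH act_X_power_mult[OF g] by simp
  then have "near (N + j) ((x ^^ j) (act F g)) ((x ^^ j) \<one>)"
    using j by (auto intro: near_mono)
  then have "near N (act F g) \<one>" using near_xpow_cancel g by simp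
  moreover have "fps_nth F 0 \<noteq> 0"
    using Hi nth_subdegree_nonzero[of H] by (auto simp: F_def j_def)
  moreover have "fps_nth F k \<in> {- int q..int q}" for k
  proof (cases "k + j < N")
    case True
    then have "c (k + j) \<in> {0..<int q}" "d (k + j) \<in> {0..<int q}"
      using cd(1,2) unfolding P_def by (auto dest!: PiE_mem[where x = "k + j"])
    moreover have "fps_nth F k = c (k + j) - d (k + j)"
      using True by (simp add: F_def H_def ser_def)
    ultimately show ?thesis by simp
  qed (simp add: F_def H_def ser_def)
  ultimately show ?thesis by blast
qed

text \<open>
  The coefficients of the approximate relations are bounded independently of \<open>N\<close>, so a compactness argument yields a
  relation that holds exactly. Its constant coefficient is still nonzero.
\<close>

lemma exact_relation:
  assumes g: "g \<in> carrier G"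
  shows "\<exists>F. fps_nth F 0 \<noteq> 0 \<and> act F g = \<one>"
proof -
  obtain T where T: "finite T" "T \<subseteq> carrier G" "\<forall>g\<in>carrier G. \<exists>t\<in>T. \<exists>h\<in>carrier G. g = t \<otimes> x h"
    using transversal by blast
  define q where "q = Suc (card T ^ 2)"
  define P where "P N f \<longleftrightarrow> near N (act (Abs_fps f) g) \<one> \<and> (N > 0 \<longrightarrow> f 0 \<noteq> (0::int))" for N f
  \<comment> \<open>The entry \<open>f 0\<close> may be mentioned from \<open>N = 1\<close> on only, as \<open>P N\<close> has to depend on the first \<open>N\<close> entries.\<close>
  have "\<exists>f. (\<forall>i. f i \<in> {- int q..int q}) \<and> (\<forall>N. P N f)"
  proof (rule bounded_sequences_compact)
    fix N
    obtain F where "fps_nth F 0 \<noteq> 0" "\<forall>i. fps_nth F i \<in> {- int q..int q}" "near N (act F g) \<one>"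
      using approximate_relation[OF g T, of q N] by (auto simp: q_def)
    then show "\<exists>f. (\<forall>i. f i \<in> {- int q..int q}) \<and> P N f"
      by (intro exI[of _ "fps_nth F"]) (simp add: P_def fps_nth_inverse)
  next
    fix M N f assume "P N f" "M \<le> N"
    then show "P M f" by (auto simp: P_def intro: near_mono)
  next
    fix N f f' assume Pf: "P N f" and eq: "\<And>i. i < N \<Longrightarrow> f i = f' i"
    have "partial (\<lambda>i. g [^] f i) N = partial (\<lambda>i. g [^] f' i) N"
      unfolding partial_def by (rule finprod_cong') (use g eq in auto)
    then have "near N (act (Abs_fps f') g) (act (Abs_fps f) g)"
      unfolding act_def using series_near[of "\<lambda>i. g [^] f i" N] series_near[of "\<lambda>i. g [^] f' i" N] g
      by (auto intro: near_trans near_sym)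
    then show "P N f'" using Pf eq near_trans unfolding P_def by metis
  qed simp
  then obtain f where f: "\<And>N. P N f" by blast
  then have "act (Abs_fps f) g = \<one>" by (intro near_all_eq) (simp add: P_def)
  then show ?thesis using f[of 1] by (intro exI[of _ "Abs_fps f"]) (simp add: P_def)
qed


section \<open>The torsion-free case\<close>

text \<open>
  As \<open>G\<close> has no \<open>p\<close>-torsion, \<open>p\<close> can be divided out of an annihilating series; this ends, since the constant
  coefficient is a nonzero integer that gets smaller.
\<close>

lemma primitive_relation:
  assumes tf: "\<forall>g\<in>carrier G. g [^] p = \<one> \<longrightarrow> g = \<one>" and p: "p > (1::nat)"
    and g: "g \<in> carrier G"
  shows "\<exists>F. act F g = \<one> \<and> (\<exists>i. \<not> int p dvd fps_nth F i)"
proof -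
  have "\<exists>F. act F g = \<one> \<and> (\<exists>i. \<not> int p dvd fps_nth F i)"
    if "fps_nth F 0 \<noteq> 0" "act F g = \<one>" for F
    using that
  proof (induction "nat \<bar>fps_nth F 0\<bar>" arbitrary: F rule: less_induct)
    case less
    show ?case
    proof (cases "\<forall>i. int p dvd fps_nth F i")
      case True
      define H where "H = Abs_fps (\<lambda>i. fps_nth F i div int p)"
      have F: "F = fps_const (int p) * H" by (rule fps_ext) (simp add: H_def True)
      then have "act H g [^] p = \<one>" using less.prems(2) g by (simp add: act_const_mult int_pow_int)
      then have "act H g = \<one>" using tf g by simp
      moreover have "fps_nth F 0 = int p * fps_nth H 0" by (subst F) simp
      then have "fps_nth H 0 \<noteq> 0" "\<bar>fps_nth H 0\<bar> < \<bar>fps_nth F 0\<bar>"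
        using less.prems(1) p by (auto simp: abs_mult)
      ultimately show ?thesis using less.hyps[of H] by simp
    qed (use less.prems in blast)
  qed
  then show ?thesis using exact_relation[OF g] by blast
qed

text \<open>
  An annihilating series of \<open>g\<close> that is nonzero modulo \<open>p\<close> has the form \<open>F = p H + X\<^sup>l U\<close> with \<open>U\<close> invertible modulo
  \<open>p\<close>. So \<open>X\<^sup>l\<close> is a combination of \<open>F\<close> and \<open>p\<close> in \<open>\<int>[[X]]\<close>, and \<open>x\<^sup>l g\<close> is a multiple of \<open>p\<close>.
\<close>

lemma xpow_is_prime_power:
  assumes tf: "\<forall>g\<in>carrier G. g [^] p = \<one> \<longrightarrow> g = \<one>" and p: "prime (p::nat)"
    and g: "g \<in> carrier G"
  shows "\<exists>l. \<exists>h\<in>carrier G. (x ^^ l) g = h [^] p"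
proof -
  obtain F where "act F g = \<one> \<and> (\<exists>i. \<not> int p dvd fps_nth F i)"
    using primitive_relation[OF tf prime_gt_1_nat[OF p] g] by (rule exE)
  then have F: "act F g = \<one>" "\<exists>i. \<not> int p dvd fps_nth F i" by simp_all
  define l where "l = (LEAST i. \<not> int p dvd fps_nth F i)"
  have Fl: "\<not> int p dvd fps_nth F l" using LeastI_ex[OF F(2)] by (simp add: l_def)
  have below: "int p dvd fps_nth F i" if "i < l" for i
    using not_less_Least[of i "\<lambda>i. \<not> int p dvd fps_nth F i"] that by (auto simp: l_def)
  define H where "H = Abs_fps (\<lambda>i. if i < l then fps_nth F i div int p else 0)"
  define U where "U = fps_shift l F"
  have F_eq: "F = fps_const (int p) * H + fps_X ^ l * U"
    by (rule fps_ext) (auto simp: H_def U_def below fps_X_power_mult_nth)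
  have "coprime (int p) (fps_nth F l)"
    using p Fl by (simp add: prime_imp_coprime)
  then obtain w s where ws: "w * fps_nth F l = 1 + int p * s"
  proof -
    obtain u v where "u * int p + v * fps_nth F l = 1"
      using bezout_int[of "int p" "fps_nth F l"] \<open>coprime (int p) (fps_nth F l)\<close> by auto
    then show ?thesis by (intro that[of v "- u"]) (simp add: algebra_simps)
  qed
  \<comment> \<open>\<open>w U\<close> has constant coefficient \<open>1 + p s\<close>, so \<open>D\<close> is invertible and congruent to \<open>w U\<close> modulo \<open>p\<close>.\<close>
  define D where "D = fps_const w * U - fps_const (int p * s)"
  define E where "E = fps_right_inverse D 1"
  have "fps_nth D 0 = 1" using ws by (simp add: D_def U_def)
  then have DE: "D * E = 1" unfolding E_def by (intro fps_right_inverse) simp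
  define K where "K = E * (fps_const w * H + fps_const s * fps_X ^ l)"
  have "fps_X ^ l = E * (fps_X ^ l * D)"
    using DE by (metis mult.assoc mult.commute mult.right_neutral)
  also have "fps_X ^ l * D = fps_const w * F - fps_const (int p) * (fps_const w * H + fps_const s * fps_X ^ l)"
    by (simp add: D_def F_eq algebra_simps flip: fps_const_mult)
  also have "E * \<dots> = (E * fps_const w) * F - fps_const (int p) * K"
    by (simp add: K_def algebra_simps)
  finally have X: "fps_X ^ l = (E * fps_const w) * F - fps_const (int p) * K" .
  have "(x ^^ l) g = act ((E * fps_const w) * F - fps_const (int p) * K) g"
    using g by (simp only: act_X_power X[symmetric])
  also have "\<dots> = act (E * fps_const w) (act F g) \<otimes> inv (act K g [^] int p)"
    by (simp only: act_diff[OF g] act_const_mult[OF g] act_act[OF g])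
  also have "\<dots> = (inv (act K g)) [^] p"
    using g F(1) by (simp add: int_pow_int nat_pow_inv)
  finally have "(x ^^ l) g = (inv (act K g)) [^] p" .
  then show ?thesis using g by (intro exI[of _ l] bexI[of _ "inv (act K g)"]) simp_all
qed

text \<open>
  For a prime, one exponent serves all the finitely many representatives of \<open>G / x G\<close>, and through their expansions
  all of \<open>G\<close>. A product is handled factor by factor, the exponents adding up.
\<close>

lemma powers_contain_xpow:
  assumes tf: "torsion_free_group G"
  shows "n > 0 \<Longrightarrow> \<exists>l. \<forall>g\<in>carrier G. \<exists>h\<in>carrier G. (x ^^ l) g = h [^] (n::nat)"
proof (induction n rule: less_induct)
  case (less n)
  show ?case
  proof (cases "n = 1")
    case True
    then show ?thesis by (intro exI[of _ 0]) auto
  next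
    case False
    then obtain p where p: "prime p" "p dvd n" using prime_factor_nat by blast
    then obtain k where k: "n = p * k" by blast
    have "k < n" "k > 0" using k less.prems prime_gt_1_nat[OF p(1)] by auto
    then obtain l where l: "\<And>g. g \<in> carrier G \<Longrightarrow> \<exists>h\<in>carrier G. (x ^^ l) g = h [^] k"
      using less.IH by blast
    obtain T where T: "finite T" "T \<subseteq> carrier G" "\<forall>g\<in>carrier G. \<exists>t\<in>T. \<exists>h\<in>carrier G. g = t \<otimes> x h"
      using transversal by blast
    have "\<forall>g\<in>carrier G. g [^] p = \<one> \<longrightarrow> g = \<one>"
      using tf prime_gt_0_nat[OF p(1)] by (simp add: torsion_free_group_def)
    then have "\<exists>l. \<exists>h\<in>carrier G. (x ^^ l) t = h [^] p" if "t \<in> T" for t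
      using xpow_is_prime_power[OF _ p(1)] T(2) that by blast
    then obtain e r where er: "\<And>t. t \<in> T \<Longrightarrow> r t \<in> carrier G \<and> (x ^^ e t) t = r t [^] p"
      by metis
    define b where "b = Max (e ` T)"
    have "\<exists>h\<in>carrier G. (x ^^ b) t = h [^] p" if "t \<in> T" for t
    proof -
      have "e t \<le> b" using T(1) that by (simp add: b_def)
      then have "(x ^^ b) t = (x ^^ (b - e t)) ((x ^^ e t) t)"
        using funpow_add[of "b - e t" "e t" x] by simp
      then show ?thesis using er[OF that] by (metis xpow_closed xpow_nat_pow)
    qed
    then obtain r where r: "\<And>t. t \<in> T \<Longrightarrow> r t \<in> carrier G \<and> (x ^^ b) t = r t [^] p" by metis
    have p_part: "\<exists>h\<in>carrier G. (x ^^ b) g = h [^] p" if g: "g \<in> carrier G" for g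
    proof -
      obtain d where d: "\<And>i. d i \<in> T" "g = series d" using digit_expansion[OF T(2,3) g] by blast
      have dc: "d i \<in> carrier G" "r (d i) \<in> carrier G" for i using d T r by blast+
      have "(x ^^ b) (series d) = series (\<lambda>i. (x ^^ b) (d i))"
        by (induction b) (simp_all add: series_x dc)
      also have "\<dots> = series (\<lambda>i. r (d i) [^] int p)" using r d by (simp add: int_pow_int)
      also have "\<dots> = series (\<lambda>i. r (d i)) [^] int p" by (rule series_int_pow) (rule dc)
      finally show ?thesis using d dc by (metis int_pow_int series_closed)
    qed
    have "\<exists>h\<in>carrier G. (x ^^ (l + b)) g = h [^] n" if g: "g \<in> carrier G" for g
    proof -
      obtain h where h: "h \<in> carrier G" "(x ^^ b) g = h [^] p" using p_part[OF g] by blast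
      obtain h' where h': "h' \<in> carrier G" "(x ^^ l) h = h' [^] k" using l[OF h(1)] by blast
      have "(x ^^ (l + b)) g = (h' [^] k) [^] p"
        using h h' by (simp add: funpow_add xpow_nat_pow)
      then show ?thesis using h' k by (auto simp: nat_pow_pow mult.commute)
    qed
    then show ?thesis by blast
  qed
qed

lemma finsum_additive_module:
  "finite I \<Longrightarrow> (\<And>i. i \<in> I \<Longrightarrow> f i \<in> carrier G) \<Longrightarrow> finsum (additive_module G sm) f I = (\<Otimes>i\<in>I. f i)"
proof (induction I rule: finite_induct)
  case empty
  interpret M: abelian_group "additive_module G sm" by (rule additive_module_abelian)
  show ?case using M.finsum_empty by simp
next
  case (insert i I)
  interpret M: abelian_group "additive_module G sm" by (rule additive_module_abelian)
  have "f \<in> I \<rightarrow> carrier G" "f i \<in> carrier G" using insert by auto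
  then show ?case using insert M.finsum_insert[of I i f] by simp
qed

text \<open>
  Expansion in powers of \<open>m\<close> instead of \<open>x\<close>: if \<open>g = s\<^sub>0 + m s\<^sub>1 + m\<^sup>2 s\<^sub>2 + \<dots>\<close> with all \<open>s\<^sub>k\<close> in the finite set
  \<open>S\<close>, then the coefficient of \<open>s \<in> S\<close> is the \<open>m\<close>-adic integer with digit \<open>1\<close> where \<open>s\<^sub>k = s\<close> and \<open>0\<close> elsewhere.
\<close>

lemma finitely_generated_madic:
  assumes sm: "\<forall>a\<in>carrier (madic_ring m). \<forall>g\<in>carrier G. \<forall>N. near N (sm a g) (g [^] a N)"
    and S: "finite S" "S \<subseteq> carrier G" "\<forall>g\<in>carrier G. \<exists>s\<in>S. \<exists>h\<in>carrier G. g = s \<otimes> h [^] m"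
  shows "finitely_generated_module (madic_ring m) (additive_module G sm)"
proof -
  let ?Z = "madic_ring m" and ?M = "additive_module G sm"
  interpret M: Module.module ?Z ?M by (rule madic_module[OF sm])
  have near: "near N (sm a g) (g [^] a N)" if "a \<in> carrier ?Z" "g \<in> carrier G" for a g N
    using sm that by blast
  have closed: "sm a g \<in> carrier G" if "a \<in> carrier ?Z" "g \<in> carrier G" for a g
    using near[OF that] near_closed by blast
  have "\<exists>c. (\<forall>s. c s \<in> carrier ?Z) \<and> g = (\<Otimes>s\<in>S. sm (c s) s)" if g: "g \<in> carrier G" for g
  proof -
    obtain dig rest where dr: "\<And>g. g \<in> carrier G \<Longrightarrow> dig g \<in> S \<and> rest g \<in> carrier G \<and> g = dig g \<otimes> rest g [^] m"
      using S(3) by metis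
    have r: "(rest ^^ i) g \<in> carrier G" for i
      by (induction i) (use g dr in auto)
    define d where "d i = dig ((rest ^^ i) g)" for i
    have d: "d i \<in> S" for i using r dr by (auto simp: d_def)
    define c0 where "c0 s N = (\<Sum>i<N. if d i = s then int m ^ i else 0)" for s N
    have expand: "g = (\<Otimes>s\<in>S. s [^] c0 s N) \<otimes> (rest ^^ N) g [^] (m ^ N)" for N
    proof (induction N)
      case 0
      have "(\<Otimes>s\<in>S. s [^] c0 s 0) = \<one>" by (rule finprod_one_eqI) (simp add: c0_def)
      then show ?case using g by simp
    next
      case (Suc N)
      have "(rest ^^ N) g = d N \<otimes> (rest ^^ Suc N) g [^] m"
        using dr[OF r[of N]] by (simp add: d_def)
      then have "(rest ^^ N) g [^] (m ^ N) = (d N \<otimes> (rest ^^ Suc N) g [^] m) [^] (m ^ N)" by simp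
      also have "\<dots> = d N [^] (int m ^ N) \<otimes> (rest ^^ Suc N) g [^] (m ^ Suc N)"
      proof -
        have "d N \<in> carrier G" "(rest ^^ Suc N) g \<in> carrier G" using d S(2) r[of "Suc N"] by auto
        moreover have "d N [^] (int m ^ N) = d N [^] (m ^ N)" by (simp flip: int_pow_int)
        ultimately show ?thesis by (simp add: nat_pow_distrib nat_pow_pow del: funpow.simps)
      qed
      finally have *: "(rest ^^ N) g [^] (m ^ N) = d N [^] (int m ^ N) \<otimes> (rest ^^ Suc N) g [^] (m ^ Suc N)" .
      have "(\<Otimes>s\<in>S. s [^] c0 s (Suc N)) =
          (\<Otimes>s\<in>S. s [^] c0 s N \<otimes> (if d N = s then s [^] (int m ^ N) else \<one>))"
        by (rule finprod_cong') (use S(2) in \<open>auto simp: c0_def int_pow_mult\<close>)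
      also have "\<dots> = (\<Otimes>s\<in>S. s [^] c0 s N) \<otimes> (\<Otimes>s\<in>S. if d N = s then s [^] (int m ^ N) else \<one>)"
        by (rule finprod_multf) (use S(2) in auto)
      also have "(\<Otimes>s\<in>S. if d N = s then s [^] (int m ^ N) else \<one>) = d N [^] (int m ^ N)"
        by (rule finprod_singleton) (use d S in auto)
      finally have "(\<Otimes>s\<in>S. s [^] c0 s (Suc N)) = (\<Otimes>s\<in>S. s [^] c0 s N) \<otimes> d N [^] (int m ^ N)" .
      moreover have "(\<Otimes>s\<in>S. s [^] c0 s N) \<in> carrier G" "d N [^] (int m ^ N) \<in> carrier G"
        using S(2) d by (auto intro!: finprod_closed)
      ultimately show ?case using Suc * r[of "Suc N"] by (simp add: m_assoc)
    qed
    define c where "c s = (\<lambda>N. c0 s N mod int m ^ N)" for s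
    have c: "c s \<in> carrier ?Z" for s
      unfolding c_def by (rule madic_reduce_carrier[OF m_ge]) (simp add: c0_def cong_def)
    have "near N g (\<Otimes>s\<in>S. sm (c s) s)" for N
    proof -
      have "near N g (\<Otimes>s\<in>S. s [^] c0 s N)"
      proof -
        have A: "(\<Otimes>s\<in>S. s [^] c0 s N) \<in> carrier G" using S(2) by (auto intro!: finprod_closed)
        have "near N ((\<Otimes>s\<in>S. s [^] c0 s N) \<otimes> (rest ^^ N) g [^] (m ^ N)) ((\<Otimes>s\<in>S. s [^] c0 s N) \<otimes> \<one>)"
          by (intro near_mult near_refl near_pow_m A r)
        then show ?thesis using expand[of N] A by simp
      qed
      also have "near N (\<Otimes>s\<in>S. s [^] c0 s N) (\<Otimes>s\<in>S. sm (c s) s)"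
      proof (rule near_finprod[OF S(1)])
        fix s assume "s \<in> S"
        then have s: "s \<in> carrier G" using S(2) by blast
        have "near N (s [^] c0 s N) (s [^] c s N)"
          by (rule near_int_pow_cong[OF s]) (simp add: c_def cong_def)
        also have "near N (s [^] c s N) (sm (c s) s)" by (rule near_sym[OF near[OF c s]])
        finally show "near N (s [^] c0 s N) (sm (c s) s)" .
      qed
      finally show ?thesis .
    qed
    then show ?thesis using near_all_eq c by blast
  qed
  note combination = this
  have gen: "g \<in> N" if "g \<in> carrier G" "submodule N ?Z ?M" "S \<subseteq> N" for g N
  proof -
    obtain c where c: "\<And>s. c s \<in> carrier ?Z" "g = (\<Otimes>s\<in>S. sm (c s) s)"
      using combination[OF \<open>g \<in> carrier G\<close>] by blast
    have "(\<Oplus>\<^bsub>?M\<^esub>s\<in>S. c s \<odot>\<^bsub>?M\<^esub> s) \<in> N"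
      by (rule M.submodule_finsum_smult[OF that(2) S(1)]) (use c that(3) in auto)
    moreover have "(\<Oplus>\<^bsub>?M\<^esub>s\<in>S. c s \<odot>\<^bsub>?M\<^esub> s) = g"
      using c S closed by (subst finsum_additive_module) auto
    ultimately show ?thesis by simp
  qed
  have "submodule_span ?Z ?M S = carrier ?M"
    using gen S(2) M.carrier_is_submodule unfolding submodule_span_def by fastforce
  then show ?thesis unfolding finitely_generated_module_def
    using S(1,2) M.module_axioms by auto
qed

lemma torsion_free_madic:
  assumes tf: "torsion_free_group G"
    and sm: "\<forall>a\<in>carrier (madic_ring m). \<forall>g\<in>carrier G. \<forall>N. near N (sm a g) (g [^] a N)"
  shows "finitely_generated_module (madic_ring m) (additive_module G sm)"
    and "\<exists>l\<ge>1. (x ^^ l) ` carrier G \<subseteq> nth_multiples G (m ^ i)"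
proof -
  have *: "\<exists>l. \<forall>g\<in>carrier G. \<exists>h\<in>carrier G. (x ^^ l) g = h [^] (m ^ i)" for i
    using powers_contain_xpow[OF tf, of "m ^ i"] m_ge by simp
  obtain T where T: "finite T" "T \<subseteq> carrier G" "\<forall>g\<in>carrier G. \<exists>t\<in>T. \<exists>h\<in>carrier G. g = t \<otimes> x h"
    using transversal by blast
  obtain l where l: "\<And>g. g \<in> carrier G \<Longrightarrow> \<exists>h\<in>carrier G. (x ^^ l) g = h [^] m"
    using *[of 1] by auto
  obtain S where S: "finite S" "S \<subseteq> carrier G" "\<forall>g\<in>carrier G. \<exists>s\<in>S. near l g s"
    using finite_transversals[OF T, of l] by blast
  show "finitely_generated_module (madic_ring m) (additive_module G sm)"
  proof (rule finitely_generated_madic[OF sm S(1,2)], rule ballI)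
    fix g assume "g \<in> carrier G"
    then obtain s k where "s \<in> S" "k \<in> carrier G" "g = s \<otimes> (x ^^ l) k"
      using S(3) unfolding near_def by blast
    then show "\<exists>s\<in>S. \<exists>h\<in>carrier G. g = s \<otimes> h [^] m" using l by metis
  qed
  obtain l where l: "\<And>g. g \<in> carrier G \<Longrightarrow> \<exists>h\<in>carrier G. (x ^^ l) g = h [^] (m ^ i)"
    using *[of i] by blast
  have "(x ^^ Suc l) ` carrier G \<subseteq> nth_multiples G (m ^ i)"
    using l unfolding nth_multiples_def by (auto simp: funpow_Suc_right simp del: funpow.simps)
  then show "\<exists>l\<ge>1. (x ^^ l) ` carrier G \<subseteq> nth_multiples G (m ^ i)" by (intro exI[of _ "Suc l"]) simp
qed

end


section \<open>Coset topologies\<close>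

locale subgroup_chain = group G for G (structure) +
  fixes N :: "nat \<Rightarrow> 'a set"
  assumes chain_subgroup: "subgroup (N i) G"
    and chain_decreasing: "i \<le> j \<Longrightarrow> N j \<subseteq> N i"
begin

lemma chain_in_carrier: "h \<in> N i \<Longrightarrow> h \<in> carrier G"
  using subgroup.subset[OF chain_subgroup] by blast

lemma coset_self:
  assumes "g \<in> carrier G"
  shows "g \<in> g <# N i"
proof -
  have "g = g \<otimes> \<one>" using assms by simp
  then show ?thesis unfolding l_coset_def using subgroup.one_closed[OF chain_subgroup] by blast
qed

lemma coset_mono: "i \<le> j \<Longrightarrow> g <# N j \<subseteq> g <# N i"
  using chain_decreasing[of i j] by (auto simp: l_coset_def)

lemma coset_subset:
  assumes g: "g \<in> carrier G" and h: "h \<in> g <# N i"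
  shows "h <# N i \<subseteq> g <# N i"
proof
  fix k assume "k \<in> h <# N i"
  then obtain a b where ab: "a \<in> N i" "b \<in> N i" "h = g \<otimes> a" "k = h \<otimes> b"
    using h unfolding l_coset_def by blast
  then have "k = g \<otimes> (a \<otimes> b)" using g chain_in_carrier by (simp add: m_assoc)
  moreover have "a \<otimes> b \<in> N i" using ab subgroup.m_closed[OF chain_subgroup] by blast
  ultimately show "k \<in> g <# N i" unfolding l_coset_def by blast
qed

lemma coset_in_carrier: "g \<in> carrier G \<Longrightarrow> g <# N i \<subseteq> carrier G"
  using chain_in_carrier by (auto simp: l_coset_def)

text \<open>
  The coset of \<open>N i\<close> through a point of a given coset of \<open>N i\<close> is that coset itself, and the smaller one of two cosets
  through a common point lies in both. So the cosets are a base, not only a subbase.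
\<close>

lemma openin_coset_topology:
  "openin (coset_topology G N) U \<longleftrightarrow> U \<subseteq> carrier G \<and> (\<forall>g\<in>U. \<exists>i. g <# N i \<subseteq> U)"
proof
  assume "openin (coset_topology G N) U"
  then have "generate_topology_on {g <# N i | g i. g \<in> carrier G} U"
    by (simp add: coset_topology_def openin_topology_generated_by_iff)
  then show "U \<subseteq> carrier G \<and> (\<forall>g\<in>U. \<exists>i. g <# N i \<subseteq> U)"
  proof induction
    case Empty
    then show ?case by simp
  next
    case (Int U V)
    show ?case
    proof (intro conjI ballI)
      show "U \<inter> V \<subseteq> carrier G" using Int by blast
      fix g assume "g \<in> U \<inter> V"
      then obtain i j where "g <# N i \<subseteq> U" "g <# N j \<subseteq> V" using Int by blast
      then have "g <# N (max i j) \<subseteq> U \<inter> V"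
        using coset_mono[of i "max i j" g] coset_mono[of j "max i j" g] by auto
      then show "\<exists>i. g <# N i \<subseteq> U \<inter> V" ..
    qed
  next
    case (UN K)
    show ?case
    proof (intro conjI ballI)
      show "\<Union> K \<subseteq> carrier G" using UN by blast
      fix g assume "g \<in> \<Union> K"
      then obtain U where "U \<in> K" "g \<in> U" by blast
      moreover from this UN obtain i where "g <# N i \<subseteq> U" by blast
      ultimately show "\<exists>i. g <# N i \<subseteq> \<Union> K" by blast
    qed
  next
    case (Basis U)
    then obtain g i where "g \<in> carrier G" "U = g <# N i" by blast
    then show ?case using coset_subset[of g _ i] coset_in_carrier[of g i] by blast
  qed
next
  assume U: "U \<subseteq> carrier G \<and> (\<forall>g\<in>U. \<exists>i. g <# N i \<subseteq> U)"
  then obtain i where i: "\<And>g. g \<in> U \<Longrightarrow> g <# N (i g) \<subseteq> U" by metis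
  have eq: "U = (\<Union>g\<in>U. g <# N (i g))"
  proof
    show "U \<subseteq> (\<Union>g\<in>U. g <# N (i g))"
    proof
      fix g assume "g \<in> U"
      then show "g \<in> (\<Union>g\<in>U. g <# N (i g))" using coset_self[of g "i g"] U by blast
    qed
    show "(\<Union>g\<in>U. g <# N (i g)) \<subseteq> U" using i by blast
  qed
  have "openin (coset_topology G N) (\<Union>g\<in>U. g <# N (i g))"
    unfolding coset_topology_def
    by (intro openin_Union) (use U in \<open>auto intro!: topology_generated_by_Basis\<close>)
  then show "openin (coset_topology G N) U" unfolding eq[symmetric] .
qed

lemma openin_coset: "g \<in> carrier G \<Longrightarrow> openin (coset_topology G N) (g <# N i)"
  unfolding openin_coset_topology using coset_in_carrier[of g i] coset_subset[of g _ i] by blast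

lemma topspace_coset_topology: "topspace (coset_topology G N) = carrier G"
proof
  show "topspace (coset_topology G N) \<subseteq> carrier G"
    using openin_topspace openin_coset_topology by blast
  have "openin (coset_topology G N) (carrier G)"
    unfolding openin_coset_topology using coset_in_carrier by blast
  then show "carrier G \<subseteq> topspace (coset_topology G N)" by (rule openin_subset)
qed

lemma in_closure_of_coset_topology:
  "g \<in> (coset_topology G N) closure_of S \<longleftrightarrow> g \<in> carrier G \<and> (\<forall>i. \<exists>s\<in>S. s \<in> g <# N i)"
proof
  assume g: "g \<in> (coset_topology G N) closure_of S"
  then have "g \<in> carrier G" by (simp add: in_closure_of topspace_coset_topology)
  moreover from this have "\<exists>s\<in>S. s \<in> g <# N i" for i
    using g openin_coset[of g i] coset_self[of g i] by (auto simp: in_closure_of)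
  ultimately show "g \<in> carrier G \<and> (\<forall>i. \<exists>s\<in>S. s \<in> g <# N i)" by blast
next
  assume *: "g \<in> carrier G \<and> (\<forall>i. \<exists>s\<in>S. s \<in> g <# N i)"
  have g: "g \<in> carrier G" using * by (rule conjunct1)
  have dense: "\<exists>s\<in>S. s \<in> g <# N i" for i using * by blast
  have "\<exists>s\<in>S. s \<in> U" if gU: "g \<in> U" and U: "openin (coset_topology G N) U" for U
  proof -
    from U have "\<forall>h\<in>U. \<exists>i. h <# N i \<subseteq> U" unfolding openin_coset_topology by (rule conjunct2)
    then obtain i where "g <# N i \<subseteq> U" using gU by blast
    then show ?thesis using dense[of i] by blast
  qed
  then show "g \<in> (coset_topology G N) closure_of S"
    using g by (auto simp: in_closure_of topspace_coset_topology)
qed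

lemma limitin_coset_topology:
  "limitin (coset_topology G N) f l F \<longleftrightarrow> l \<in> carrier G \<and> (\<forall>i. \<forall>\<^sub>F k in F. f k \<in> l <# N i)"
proof
  assume lim: "limitin (coset_topology G N) f l F"
  then have "l \<in> carrier G" by (simp add: limitin_def topspace_coset_topology)
  then show "l \<in> carrier G \<and> (\<forall>i. \<forall>\<^sub>F k in F. f k \<in> l <# N i)"
    using lim openin_coset coset_self by (simp add: limitin_def)
next
  assume l: "l \<in> carrier G \<and> (\<forall>i. \<forall>\<^sub>F k in F. f k \<in> l <# N i)"
  show "limitin (coset_topology G N) f l F"
    unfolding limitin_def topspace_coset_topology openin_coset_topology
  proof (intro conjI allI impI)
    fix U assume "(U \<subseteq> carrier G \<and> (\<forall>g\<in>U. \<exists>i. g <# N i \<subseteq> U)) \<and> l \<in> U"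
    then obtain i where "l <# N i \<subseteq> U" by blast
    moreover have "\<forall>\<^sub>F k in F. f k \<in> l <# N i" using l by blast
    ultimately show "\<forall>\<^sub>F k in F. f k \<in> U" by (auto elim: eventually_mono)
  qed (use l in simp)
qed

lemma subgroup_chain_restrict:
  assumes H: "subgroup H G"
  shows "subgroup_chain (G\<lparr>carrier := H\<rparr>) (\<lambda>i. H \<inter> N i)"
proof -
  interpret H: group "G\<lparr>carrier := H\<rparr>" by (rule subgroup.subgroup_is_group[OF H is_group])
  show ?thesis
  proof (intro subgroup_chain.intro subgroup_chain_axioms.intro)
    show "subgroup (H \<inter> N i) (G\<lparr>carrier := H\<rparr>)" for i
      by (rule subgroup_incl[OF subgroups_Inter_pair[OF H chain_subgroup] H]) blast
    show "H \<inter> N j \<subseteq> H \<inter> N i" if "i \<le> j" for i j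
      using chain_decreasing[OF that] by blast
  qed (rule H.is_group)
qed

text \<open>
  The cosets in \<open>H\<close> of the subgroups \<open>H \<inter> N i\<close> are the nonempty traces on \<open>H\<close> of the cosets in \<open>G\<close>.
\<close>

lemma subtopology_coset_topology:
  assumes H: "subgroup H G"
  shows "subtopology (coset_topology G N) H = coset_topology (G\<lparr>carrier := H\<rparr>) (\<lambda>i. H \<inter> N i)"
    (is "_ = ?T")
proof -
  interpret H: subgroup_chain "G\<lparr>carrier := H\<rparr>" "\<lambda>i. H \<inter> N i"
    by (rule subgroup_chain_restrict[OF H])
  have sub: "H \<subseteq> carrier G" by (rule subgroup.subset[OF H])
  have coset: "g <#\<^bsub>G\<lparr>carrier := H\<rparr>\<^esub> (H \<inter> N i) = H \<inter> (g <# N i)" if g: "g \<in> H" for g i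
  proof
    show "g <#\<^bsub>G\<lparr>carrier := H\<rparr>\<^esub> (H \<inter> N i) \<subseteq> H \<inter> (g <# N i)"
      using subgroup.m_closed[OF H g] by (auto simp: l_coset_def)
    show "H \<inter> (g <# N i) \<subseteq> g <#\<^bsub>G\<lparr>carrier := H\<rparr>\<^esub> (H \<inter> N i)"
    proof
      fix h assume "h \<in> H \<inter> (g <# N i)"
      then obtain k where k: "k \<in> N i" "h = g \<otimes> k" "h \<in> H" by (auto simp: l_coset_def)
      then have "k = inv g \<otimes> h" using g sub chain_in_carrier by (auto simp: m_assoc[symmetric])
      then have "k \<in> H" using subgroup.m_closed[OF H subgroup.m_inv_closed[OF H g]] k(3) by simp
      then show "h \<in> g <#\<^bsub>G\<lparr>carrier := H\<rparr>\<^esub> (H \<inter> N i)" using k by (auto simp: l_coset_def)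
    qed
  qed
  have "openin (subtopology (coset_topology G N) H) U \<longleftrightarrow> openin ?T U" for U
  proof
    assume "openin (subtopology (coset_topology G N) H) U"
    then obtain V where V: "openin (coset_topology G N) V" "U = V \<inter> H"
      by (auto simp: openin_subtopology)
    show "openin ?T U"
      unfolding H.openin_coset_topology
    proof (intro conjI ballI)
      show "U \<subseteq> carrier (G\<lparr>carrier := H\<rparr>)" using V(2) by simp
      fix g assume g: "g \<in> U"
      then obtain i where "g <# N i \<subseteq> V" using V openin_coset_topology by blast
      then have "H \<inter> (g <# N i) \<subseteq> U" using V(2) by blast
      then show "\<exists>i. g <#\<^bsub>G\<lparr>carrier := H\<rparr>\<^esub> (H \<inter> N i) \<subseteq> U"
        using coset[of g i] g V(2) by (intro exI[of _ i]) simp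
    qed
  next
    assume T: "openin ?T U"
    then have UH: "U \<subseteq> H" by (simp add: H.openin_coset_topology)
    have "\<exists>i. H \<inter> (g <# N i) \<subseteq> U" if g: "g \<in> U" for g
    proof -
      obtain i where "g <#\<^bsub>G\<lparr>carrier := H\<rparr>\<^esub> (H \<inter> N i) \<subseteq> U"
        using T g H.openin_coset_topology by blast
      then show ?thesis using coset[of g i] g UH by (intro exI[of _ i]) auto
    qed
    then obtain i where i: "\<And>g. g \<in> U \<Longrightarrow> H \<inter> (g <# N (i g)) \<subseteq> U" by metis
    have op: "openin (coset_topology G N) (\<Union>g\<in>U. g <# N (i g))"
    proof (rule openin_Union)
      fix V assume "V \<in> (\<lambda>g. g <# N (i g)) ` U"
      then obtain g where "g \<in> U" "V = g <# N (i g)" by (rule imageE)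
      then show "openin (coset_topology G N) V" using openin_coset[of g "i g"] UH sub by (simp add: subset_iff)
    qed
    have eq: "U = (\<Union>g\<in>U. g <# N (i g)) \<inter> H"
    proof
      show "U \<subseteq> (\<Union>g\<in>U. g <# N (i g)) \<inter> H"
      proof
        fix g assume "g \<in> U"
        then show "g \<in> (\<Union>g\<in>U. g <# N (i g)) \<inter> H"
          using coset_self[of g "i g"] UH sub by blast
      qed
      show "(\<Union>g\<in>U. g <# N (i g)) \<inter> H \<subseteq> U" using i by blast
    qed
    show "openin (subtopology (coset_topology G N) H) U"
      unfolding openin_subtopology
      by (rule exI[of _ "\<Union>g\<in>U. g <# N (i g)"]) (rule conjI[OF op eq])
  qed
  then show ?thesis by (simp add: topology_eq)
qed

lemma coset_topology_cofinal:
  assumes M: "subgroup_chain G M"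
    and NM: "\<And>i. \<exists>j. N j \<subseteq> M i" and MN: "\<And>i. \<exists>j. M j \<subseteq> N i"
  shows "coset_topology G N = coset_topology G M"
proof -
  interpret M: subgroup_chain G M by (rule M)
  have mono: "N' \<subseteq> M' \<Longrightarrow> g <# N' \<subseteq> g <# M'" for g N' M' by (auto simp: l_coset_def)
  have "openin (coset_topology G N) U \<longleftrightarrow> openin (coset_topology G M) U" for U
  proof -
    have "\<exists>j. g <# M j \<subseteq> U" if "g <# N i \<subseteq> U" for g i
      using MN[of i] mono that by (meson order_trans)
    moreover have "\<exists>j. g <# N j \<subseteq> U" if "g <# M i \<subseteq> U" for g i
      using NM[of i] mono that by (meson order_trans)
    ultimately show ?thesis
      unfolding openin_coset_topology M.openin_coset_topology by meson
  qed
  then show ?thesis by (simp add: topology_eq)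
qed

end


section \<open>Automorphisms of the rooted tree\<close>

lemma words_Nil [simp]: "[] \<in> words m"
  and words_Cons [simp]: "y # u \<in> words m \<longleftrightarrow> y \<in> {1..m} \<and> u \<in> words m"
  and words_append [simp]: "u @ v \<in> words m \<longleftrightarrow> u \<in> words m \<and> v \<in> words m"
  by (auto simp: words_def)

text \<open>
  The root is fixed since it is the only word without incoming edge. The remaining condition says that an
  automorphism takes the children of a word to the children of its image.
\<close>

lemma tree_automs_iff:
  "\<alpha> \<in> tree_automs m \<longleftrightarrow> \<alpha> permutes words m \<and> \<alpha> [] = [] \<and>
     (\<forall>u\<in>words m. \<forall>y\<in>{1..m}. \<exists>z\<in>{1..m}. \<alpha> (u @ [y]) = \<alpha> u @ [z])"
proof
  assume \<alpha>: "\<alpha> \<in> tree_automs m"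
  then have perm: "\<alpha> permutes words m"
    and edge: "\<And>u v. u \<in> words m \<Longrightarrow> v \<in> words m \<Longrightarrow> tree_edge m (\<alpha> u) (\<alpha> v) \<longleftrightarrow> tree_edge m u v"
    by (auto simp: tree_automs_def)
  have "\<alpha> [] = []"
  proof (rule ccontr)
    assume ne: "\<alpha> [] \<noteq> []"
    have "\<alpha> [] \<in> words m" using perm by (simp add: permutes_in_image)
    then obtain v y where v: "\<alpha> [] = v @ [y]" "v \<in> words m" "y \<in> {1..m}"
      using ne by (cases "\<alpha> []" rule: rev_cases) auto
    obtain u where "u \<in> words m" "\<alpha> u = v"
      using v(2) perm by (metis permutes_in_image permutes_surj surjD)
    then have "tree_edge m (\<alpha> u) (\<alpha> [])" using v by (auto simp: tree_edge_def)
    then show False using edge[OF \<open>u \<in> words m\<close>, of "[]"] by (simp add: tree_edge_def)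
  qed
  moreover have "\<exists>z\<in>{1..m}. \<alpha> (u @ [y]) = \<alpha> u @ [z]" if "u \<in> words m" "y \<in> {1..m}" for u y
    using edge[of u "u @ [y]"] that by (auto simp: tree_edge_def)
  ultimately show "\<alpha> permutes words m \<and> \<alpha> [] = [] \<and>
     (\<forall>u\<in>words m. \<forall>y\<in>{1..m}. \<exists>z\<in>{1..m}. \<alpha> (u @ [y]) = \<alpha> u @ [z])"
    using perm by blast
next
  assume *: "\<alpha> permutes words m \<and> \<alpha> [] = [] \<and>
     (\<forall>u\<in>words m. \<forall>y\<in>{1..m}. \<exists>z\<in>{1..m}. \<alpha> (u @ [y]) = \<alpha> u @ [z])"
  have "tree_edge m (\<alpha> u) (\<alpha> v) \<longleftrightarrow> tree_edge m u v" if u: "u \<in> words m" and v: "v \<in> words m" for u v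
  proof
    assume "tree_edge m u v"
    then show "tree_edge m (\<alpha> u) (\<alpha> v)"
      using * u by (auto simp: tree_edge_def permutes_in_image)
  next
    assume "tree_edge m (\<alpha> u) (\<alpha> v)"
    then obtain z where z: "\<alpha> v = \<alpha> u @ [z]" by (auto simp: tree_edge_def)
    then obtain v' y where v': "v = v' @ [y]" using * by (cases v rule: rev_cases) auto
    moreover have "v' \<in> words m" "y \<in> {1..m}" using v v' by auto
    ultimately obtain z' where "\<alpha> v = \<alpha> v' @ [z']" using * by blast
    then have "\<alpha> v' = \<alpha> u" using z by simp
    then have "v' = u" using * permutes_inj by (metis injD)
    then show "tree_edge m u v" using v v' u by (auto simp: tree_edge_def)
  qed
  then show "\<alpha> \<in> tree_automs m" using * by (simp add: tree_automs_def)
qed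

lemma tree_automs_permutes: "\<alpha> \<in> tree_automs m \<Longrightarrow> \<alpha> permutes words m"
  by (simp add: tree_automs_def)

lemma tree_automs_Nil [simp]: "\<alpha> \<in> tree_automs m \<Longrightarrow> \<alpha> [] = []"
  by (simp add: tree_automs_iff)

lemma tree_automs_words [simp]: "\<alpha> \<in> tree_automs m \<Longrightarrow> \<alpha> u \<in> words m \<longleftrightarrow> u \<in> words m"
  using permutes_in_image[OF tree_automs_permutes] .

lemma tree_automs_not_words: "\<alpha> \<in> tree_automs m \<Longrightarrow> u \<notin> words m \<Longrightarrow> \<alpha> u = u"
  using permutes_not_in[OF tree_automs_permutes] .

lemma tree_automs_inj: "\<alpha> \<in> tree_automs m \<Longrightarrow> \<alpha> u = \<alpha> v \<longleftrightarrow> u = v"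
  using inj_eq[OF permutes_inj[OF tree_automs_permutes]] .

lemma tree_automs_snoc:
  "\<lbrakk>\<alpha> \<in> tree_automs m; u \<in> words m; y \<in> {1..m}\<rbrakk> \<Longrightarrow> \<exists>z\<in>{1..m}. \<alpha> (u @ [y]) = \<alpha> u @ [z]"
  unfolding tree_automs_iff by blast

lemma tree_automs_take:
  assumes \<alpha>: "\<alpha> \<in> tree_automs m" and "u \<in> words m" "v \<in> words m"
  shows "\<exists>w. length w = length v \<and> \<alpha> (u @ v) = \<alpha> u @ w"
  using \<open>v \<in> words m\<close>
proof (induction v rule: rev_induct)
  case (snoc y v)
  then obtain w where w: "length w = length v" "\<alpha> (u @ v) = \<alpha> u @ w" by auto
  obtain z where "\<alpha> ((u @ v) @ [y]) = \<alpha> (u @ v) @ [z]"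
    using tree_automs_snoc[OF \<alpha>, of "u @ v" y] snoc.prems assms(2) by auto
  then show ?case using w by (intro exI[of _ "w @ [z]"]) simp
qed simp

lemma tree_automs_length [simp]:
  assumes "\<alpha> \<in> tree_automs m"
  shows "length (\<alpha> u) = length u"
proof (cases "u \<in> words m")
  case True
  then show ?thesis using tree_automs_take[OF assms words_Nil True] assms by auto
qed (use tree_automs_not_words[OF assms] in simp)

lemma root_perm_eq:
  assumes \<alpha>: "\<alpha> \<in> tree_automs m"
  shows "\<alpha> [y] = [root_perm \<alpha> y]"
proof -
  have "length (\<alpha> [y]) = 1" using \<alpha> by simp
  then show ?thesis by (auto simp: length_Suc_conv root_perm_def)
qed

lemma root_perm_range:
  assumes "\<alpha> \<in> tree_automs m"
  shows "root_perm \<alpha> y \<in> {1..m} \<longleftrightarrow> y \<in> {1..m}"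
  using tree_automs_words[OF assms, of "[y]"] by (simp add: root_perm_eq[OF assms])

lemma tree_automs_Cons:
  assumes \<alpha>: "\<alpha> \<in> tree_automs m" and "y \<in> {1..m}" "u \<in> words m"
  shows "\<alpha> (y # u) = root_perm \<alpha> y # section_at \<alpha> y u"
proof -
  obtain w where "\<alpha> (y # u) = \<alpha> [y] @ w"
    using tree_automs_take[OF \<alpha>, of "[y]" u] assms by auto
  then show ?thesis by (simp add: section_at_def root_perm_eq[OF \<alpha>])
qed


text \<open>The inverse of a function; \<open>inv\<close> stands for inverses in a group.\<close>

abbreviation finv :: "('a \<Rightarrow> 'b) \<Rightarrow> 'b \<Rightarrow> 'a" where
  "finv \<equiv> inv_into UNIV"

lemma tree_group_simps [simp]:
  "carrier (tree_aut_group m) = tree_automs m"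
  "mult (tree_aut_group m) \<alpha> \<beta> = \<beta> \<circ> \<alpha>"
  "one (tree_aut_group m) = id"
  by (simp_all add: tree_aut_group_def)

lemma tree_automs_id [simp]: "id \<in> tree_automs m"
  by (simp add: tree_automs_def permutes_id)

lemma tree_automs_comp [simp]:
  assumes "\<alpha> \<in> tree_automs m" "\<beta> \<in> tree_automs m"
  shows "\<beta> \<circ> \<alpha> \<in> tree_automs m"
proof -
  have "\<beta> \<circ> \<alpha> permutes words m"
    by (intro permutes_compose tree_automs_permutes assms)
  then show ?thesis using assms tree_automs_words[OF assms(1)] by (auto simp: tree_automs_def)
qed

lemma tree_automs_inv [simp]:
  assumes "\<alpha> \<in> tree_automs m"
  shows "finv \<alpha> \<in> tree_automs m"
proof -
  have perm: "\<alpha> permutes words m" by (rule tree_automs_permutes[OF assms])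
  have "tree_edge m (finv \<alpha> u) (finv \<alpha> v) \<longleftrightarrow> tree_edge m u v" if "u \<in> words m" "v \<in> words m" for u v
  proof -
    have "finv \<alpha> u \<in> words m" "finv \<alpha> v \<in> words m"
      using that permutes_in_image[OF permutes_inv[OF perm]] by simp_all
    then have "tree_edge m (\<alpha> (finv \<alpha> u)) (\<alpha> (finv \<alpha> v)) \<longleftrightarrow> tree_edge m (finv \<alpha> u) (finv \<alpha> v)"
      using assms unfolding tree_automs_def by blast
    then show ?thesis by (simp add: permutes_inverses(1)[OF perm])
  qed
  then show ?thesis using permutes_inv[OF perm] by (simp add: tree_automs_def)
qed

lemma tree_automs_inverse:
  assumes "\<alpha> \<in> tree_automs m"
  shows "\<alpha> (finv \<alpha> u) = u" "finv \<alpha> (\<alpha> u) = u" "\<alpha> \<circ> finv \<alpha> = id" "finv \<alpha> \<circ> \<alpha> = id"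
  using permutes_inverses[OF tree_automs_permutes[OF assms]] by (simp_all add: fun_eq_iff)

lemma tree_group: "group (tree_aut_group m)"
proof (rule groupI)
  fix \<alpha> assume "\<alpha> \<in> carrier (tree_aut_group m)"
  then have "finv \<alpha> \<in> carrier (tree_aut_group m)" "finv \<alpha> \<otimes>\<^bsub>tree_aut_group m\<^esub> \<alpha> = \<one>\<^bsub>tree_aut_group m\<^esub>"
    by (simp_all add: tree_automs_inverse)
  then show "\<exists>\<beta>\<in>carrier (tree_aut_group m). \<beta> \<otimes>\<^bsub>tree_aut_group m\<^esub> \<alpha> = \<one>\<^bsub>tree_aut_group m\<^esub>" by blast
qed (simp_all add: comp_assoc)

lemma tree_group_inv: "\<alpha> \<in> tree_automs m \<Longrightarrow> inv\<^bsub>tree_aut_group m\<^esub> \<alpha> = finv \<alpha>"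
  by (rule group.inv_equality[OF tree_group]) (simp_all add: tree_automs_inverse)

lemma root_perm_comp:
  "\<lbrakk>\<alpha> \<in> tree_automs m; \<beta> \<in> tree_automs m\<rbrakk> \<Longrightarrow> root_perm (\<beta> \<circ> \<alpha>) y = root_perm \<beta> (root_perm \<alpha> y)"
  using root_perm_eq[of "\<beta> \<circ> \<alpha>" m y] root_perm_eq[of \<alpha> m y] root_perm_eq[of \<beta> m "root_perm \<alpha> y"]
  by simp

lemma root_perm_id [simp]: "root_perm id y = y"
  by (simp add: root_perm_def)

lemma section_not_words: "\<alpha> \<in> tree_automs m \<Longrightarrow> u \<notin> words m \<Longrightarrow> section_at \<alpha> y u = u"
  by (simp add: section_at_def tree_automs_not_words)

lemma section_words: "\<lbrakk>\<alpha> \<in> tree_automs m; y \<in> {1..m}; u \<in> words m\<rbrakk> \<Longrightarrow> section_at \<alpha> y u \<in> words m"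
  using tree_automs_words[of \<alpha> m "y # u"] tree_automs_Cons[of \<alpha> m y u] by simp

lemma section_id [simp]: "section_at id y = id"
  by (simp add: section_at_def fun_eq_iff)

lemma section_comp:
  assumes "\<alpha> \<in> tree_automs m" "\<beta> \<in> tree_automs m" "y \<in> {1..m}"
  shows "section_at (\<beta> \<circ> \<alpha>) y = section_at \<beta> (root_perm \<alpha> y) \<circ> section_at \<alpha> y"
proof
  fix u
  show "section_at (\<beta> \<circ> \<alpha>) y u = (section_at \<beta> (root_perm \<alpha> y) \<circ> section_at \<alpha> y) u"
  proof (cases "u \<in> words m")
    case True
    then show ?thesis
      using tree_automs_Cons[OF assms(1,3)] by (simp add: section_at_def[of "\<beta> \<circ> \<alpha>"] section_at_def[of \<beta>])
  next
    case False
    have "section_at (\<beta> \<circ> \<alpha>) y u = u"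
      by (rule section_not_words[OF tree_automs_comp[OF assms(1,2)] False])
    then show ?thesis
      by (simp add: section_not_words[OF assms(1) False] section_not_words[OF assms(2) False])
  qed
qed

lemma root_perm_inv:
  assumes "\<alpha> \<in> tree_automs m"
  shows "root_perm (finv \<alpha>) (root_perm \<alpha> y) = y" "root_perm \<alpha> (root_perm (finv \<alpha>) y) = y"
  using root_perm_comp[OF assms tree_automs_inv[OF assms], of y]
    root_perm_comp[OF tree_automs_inv[OF assms] assms, of y] tree_automs_inverse(3,4)[OF assms]
  by (simp_all del: comp_apply)

lemma section_inverse:
  assumes "\<alpha> \<in> tree_automs m" "y \<in> {1..m}"
  shows "section_at (finv \<alpha>) (root_perm \<alpha> y) \<circ> section_at \<alpha> y = id"
    and "section_at \<alpha> y \<circ> section_at (finv \<alpha>) (root_perm \<alpha> y) = id"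
proof -
  show "section_at (finv \<alpha>) (root_perm \<alpha> y) \<circ> section_at \<alpha> y = id"
    using section_comp[OF assms(1) tree_automs_inv[OF assms(1)] assms(2)]
    by (simp add: tree_automs_inverse(4)[OF assms(1)])
  have "root_perm \<alpha> y \<in> {1..m}" using root_perm_range[OF assms(1)] assms(2) by blast
  then show "section_at \<alpha> y \<circ> section_at (finv \<alpha>) (root_perm \<alpha> y) = id"
    using section_comp[OF tree_automs_inv[OF assms(1)] assms(1), of "root_perm \<alpha> y"]
    by (simp add: tree_automs_inverse(3)[OF assms(1)] root_perm_inv(1)[OF assms(1)])
qed

lemma section_autom:
  assumes \<alpha>: "\<alpha> \<in> tree_automs m" and y: "y \<in> {1..m}"
  shows "section_at \<alpha> y \<in> tree_automs m"
  unfolding tree_automs_iff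
proof (intro conjI ballI)
  have "bij_betw (section_at \<alpha> y) (words m) (words m)"
  proof (rule bij_betw_byWitness[where f' = "section_at (finv \<alpha>) (root_perm \<alpha> y)"])
    have y': "root_perm \<alpha> y \<in> {1..m}" using root_perm_range[OF \<alpha>] y by blast
    show "section_at \<alpha> y ` words m \<subseteq> words m"
      using section_words[OF \<alpha> y] by blast
    show "section_at (finv \<alpha>) (root_perm \<alpha> y) ` words m \<subseteq> words m"
      using section_words[OF tree_automs_inv[OF \<alpha>] y'] by blast
  qed (use section_inverse[OF \<alpha> y] in \<open>simp_all add: fun_eq_iff\<close>)
  then show "section_at \<alpha> y permutes words m"
    by (rule bij_imp_permutes) (rule section_not_words[OF \<alpha>])
  show "section_at \<alpha> y [] = []"
    by (simp add: section_at_def root_perm_eq[OF \<alpha>])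
  fix u z assume u: "u \<in> words m" and z: "z \<in> {1..m}"
  obtain z' where "z' \<in> {1..m}" "\<alpha> ((y # u) @ [z]) = \<alpha> (y # u) @ [z']"
    using tree_automs_snoc[OF \<alpha>, of "y # u" z] u y z by auto
  moreover have "\<alpha> (y # u) \<noteq> []" using tree_automs_Cons[OF \<alpha> y u] by simp
  ultimately show "\<exists>z'\<in>{1..m}. section_at \<alpha> y (u @ [z]) = section_at \<alpha> y u @ [z']"
    by (intro bexI[of _ z']) (simp_all add: section_at_def)
qed

lemma section_inv:
  assumes "\<alpha> \<in> tree_automs m" "y \<in> {1..m}"
  shows "section_at (finv \<alpha>) y = finv (section_at \<alpha> (root_perm (finv \<alpha>) y))"
proof -
  let ?z = "root_perm (finv \<alpha>) y"
  have "?z \<in> {1..m}" using root_perm_range[OF tree_automs_inv[OF assms(1)]] assms(2) by blast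
  then have "finv (section_at \<alpha> ?z) = section_at (finv \<alpha>) (root_perm \<alpha> ?z)"
    by (intro inv_unique_comp section_inverse[OF assms(1)])
  then show ?thesis by (simp add: root_perm_inv(2)[OF assms(1)])
qed


section \<open>The diagonal endomorphism\<close>

lemma diag_Nil [simp]: "diag m \<alpha> [] = []"
  and diag_Cons [simp]: "y \<in> {1..m} \<Longrightarrow> diag m \<alpha> (y # u) = y # \<alpha> u"
  and diag_Cons_out: "y \<notin> {1..m} \<Longrightarrow> diag m \<alpha> (y # u) = y # u"
  by (auto simp: diag_def)

lemma diag_id [simp]: "diag m id = id"
proof
  fix w show "diag m id w = id w" by (cases w) (simp_all add: diag_def)
qed

lemma diag_comp: "diag m (\<beta> \<circ> \<alpha>) = diag m \<beta> \<circ> diag m \<alpha>"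
proof
  fix w show "diag m (\<beta> \<circ> \<alpha>) w = (diag m \<beta> \<circ> diag m \<alpha>) w" by (cases w) (simp_all add: diag_def)
qed

lemma diag_inv:
  assumes "\<alpha> \<in> tree_automs m"
  shows "diag m (finv \<alpha>) = finv (diag m \<alpha>)"
  by (rule sym, rule inv_unique_comp)
    (simp_all add: diag_comp[symmetric] tree_automs_inverse[OF assms])

lemma diag_autom [simp]:
  assumes \<alpha>: "\<alpha> \<in> tree_automs m"
  shows "diag m \<alpha> \<in> tree_automs m"
  unfolding tree_automs_iff
proof (intro conjI ballI)
  have img: "diag m \<beta> u \<in> words m" if "\<beta> \<in> tree_automs m" "u \<in> words m" for \<beta> u
    using that by (cases u) simp_all
  have "bij_betw (diag m \<alpha>) (words m) (words m)"
  proof (rule bij_betw_byWitness[where f' = "diag m (finv \<alpha>)"])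
    show "diag m \<alpha> ` words m \<subseteq> words m" using img[OF \<alpha>] by blast
    show "diag m (finv \<alpha>) ` words m \<subseteq> words m" using img[OF tree_automs_inv[OF \<alpha>]] by blast
    have "diag m (finv \<alpha>) \<circ> diag m \<alpha> = id" "diag m \<alpha> \<circ> diag m (finv \<alpha>) = id"
      by (simp_all add: diag_comp[symmetric] tree_automs_inverse[OF \<alpha>])
    then show "\<forall>u\<in>words m. diag m (finv \<alpha>) (diag m \<alpha> u) = u"
      "\<forall>u\<in>words m. diag m \<alpha> (diag m (finv \<alpha>) u) = u"
      by (simp_all add: fun_eq_iff)
  qed
  then show "diag m \<alpha> permutes words m"
  proof (rule bij_imp_permutes)
    fix u assume u: "u \<notin> words m"
    then show "diag m \<alpha> u = u"
      using tree_automs_not_words[OF \<alpha>] by (cases u) (auto simp: diag_def)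
  qed
  fix u z assume u: "u \<in> words m" and z: "z \<in> {1..m}"
  show "\<exists>z'\<in>{1..m}. diag m \<alpha> (u @ [z]) = diag m \<alpha> u @ [z']"
  proof (cases u)
    case Nil
    then show ?thesis using z \<alpha> by (intro bexI[of _ z]) simp_all
  next
    case (Cons y v)
    then have "y \<in> {1..m}" "v \<in> words m" using u by simp_all
    then show ?thesis using tree_automs_snoc[OF \<alpha>, of v z] z Cons by auto
  qed
qed simp

lemma section_diag: "y \<in> {1..m} \<Longrightarrow> section_at (diag m \<alpha>) y = \<alpha>"
  by (simp add: section_at_def fun_eq_iff)

lemma diag_pow_autom [simp]: "\<alpha> \<in> tree_automs m \<Longrightarrow> (diag m ^^ i) \<alpha> \<in> tree_automs m"
  by (induction i) simp_all


section \<open>Agreement on a level and the tree topology\<close>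

definition agree :: "nat \<Rightarrow> nat \<Rightarrow> (nat list \<Rightarrow> nat list) \<Rightarrow> (nat list \<Rightarrow> nat list) \<Rightarrow> bool" where
  "agree m N \<alpha> \<beta> \<longleftrightarrow> (\<forall>u\<in>words m. length u = N \<longrightarrow> \<alpha> u = \<beta> u)"

lemma agreeD: "\<lbrakk>agree m N \<alpha> \<beta>; u \<in> words m; length u = N\<rbrakk> \<Longrightarrow> \<alpha> u = \<beta> u"
  by (simp add: agree_def)

lemma agree_refl [simp]: "agree m N \<alpha> \<alpha>"
  by (simp add: agree_def)

lemma agree_sym: "agree m N \<alpha> \<beta> \<Longrightarrow> agree m N \<beta> \<alpha>"
  by (simp add: agree_def)

lemma agree_trans: "\<lbrakk>agree m N \<alpha> \<beta>; agree m N \<beta> \<gamma>\<rbrakk> \<Longrightarrow> agree m N \<alpha> \<gamma>"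
  by (simp add: agree_def)

lemma agree_0 [simp]: "\<lbrakk>\<alpha> \<in> tree_automs m; \<beta> \<in> tree_automs m\<rbrakk> \<Longrightarrow> agree m 0 \<alpha> \<beta>"
  by (simp add: agree_def)

text \<open>
  A word of length \<open>M\<close> is the beginning of a word of length \<open>N\<close>, whose image begins with the image of the word.
\<close>

lemma agree_mono:
  assumes "m \<ge> 1" and \<alpha>: "\<alpha> \<in> tree_automs m" and \<beta>: "\<beta> \<in> tree_automs m"
    and ag: "agree m N \<alpha> \<beta>" and "M \<le> N"
  shows "agree m M \<alpha> \<beta>"
  unfolding agree_def
proof (intro ballI impI)
  fix u assume u: "u \<in> words m" "length u = M"
  define v where "v = replicate (N - M) (1::nat)"
  have v: "v \<in> words m" using \<open>m \<ge> 1\<close> by (auto simp: v_def words_def)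
  have "\<alpha> (u @ v) = \<beta> (u @ v)"
    by (rule agreeD[OF ag]) (use u v \<open>M \<le> N\<close> in \<open>simp_all add: v_def\<close>)
  moreover obtain w where "\<alpha> (u @ v) = \<alpha> u @ w" using tree_automs_take[OF \<alpha> u(1) v] by blast
  moreover obtain w' where "\<beta> (u @ v) = \<beta> u @ w'" using tree_automs_take[OF \<beta> u(1) v] by blast
  ultimately show "\<alpha> u = \<beta> u" using \<alpha> \<beta> by (simp add: append_eq_append_conv)
qed

lemma agree_all_eq:
  assumes "\<alpha> \<in> tree_automs m" "\<beta> \<in> tree_automs m" "\<And>N. agree m N \<alpha> \<beta>"
  shows "\<alpha> = \<beta>"
proof
  fix u
  show "\<alpha> u = \<beta> u"
    using assms agreeD[OF assms(3)] by (cases "u \<in> words m") (simp_all add: tree_automs_not_words)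
qed

lemma agree_comp:
  assumes "agree m N \<alpha> \<alpha>'" "agree m N \<beta> \<beta>'" "\<alpha>' \<in> tree_automs m"
  shows "agree m N (\<beta> \<circ> \<alpha>) (\<beta>' \<circ> \<alpha>')"
  using assms unfolding agree_def by simp

lemma agree_inv:
  assumes "agree m N \<alpha> \<beta>" and \<alpha>: "\<alpha> \<in> tree_automs m" and \<beta>: "\<beta> \<in> tree_automs m"
  shows "agree m N (finv \<alpha>) (finv \<beta>)"
  unfolding agree_def
proof (intro ballI impI)
  fix u assume "u \<in> words m" "length u = N"
  then have "\<alpha> (finv \<beta> u) = \<beta> (finv \<beta> u)"
    by (intro agreeD[OF assms(1)]) (simp_all add: \<beta> tree_automs_length[OF tree_automs_inv[OF \<beta>]])
  then have "\<alpha> (finv \<beta> u) = \<alpha> (finv \<alpha> u)"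
    by (simp add: tree_automs_inverse(1)[OF \<alpha>] tree_automs_inverse(1)[OF \<beta>])
  then show "finv \<alpha> u = finv \<beta> u" using tree_automs_inj[OF \<alpha>] by simp
qed

lemma agree_diag:
  assumes "agree m N \<alpha> \<beta>"
  shows "agree m (Suc N) (diag m \<alpha>) (diag m \<beta>)"
  unfolding agree_def
proof (intro ballI impI)
  fix w assume "w \<in> words m" "length w = Suc N"
  then obtain y u where "w = y # u" "y \<in> {1..m}" "u \<in> words m" "length u = N" by (cases w) auto
  then show "diag m \<alpha> w = diag m \<beta> w" using agreeD[OF assms, of u] by simp
qed

lemma agree_section: "agree m (Suc N) \<alpha> \<beta> \<Longrightarrow> y \<in> {1..m} \<Longrightarrow> agree m N (section_at \<alpha> y) (section_at \<beta> y)"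
  by (simp add: agree_def section_at_def)

lemma agree_1_iff:
  assumes "\<alpha> \<in> tree_automs m" "\<beta> \<in> tree_automs m"
  shows "agree m 1 \<alpha> \<beta> \<longleftrightarrow> (\<forall>y\<in>{1..m}. root_perm \<alpha> y = root_perm \<beta> y)"
proof
  assume ag: "agree m 1 \<alpha> \<beta>"
  show "\<forall>y\<in>{1..m}. root_perm \<alpha> y = root_perm \<beta> y"
  proof
    fix y assume "y \<in> {1..m}"
    then have "\<alpha> [y] = \<beta> [y]" by (intro agreeD[OF ag]) simp_all
    then show "root_perm \<alpha> y = root_perm \<beta> y" by (simp add: root_perm_def)
  qed
next
  assume eq: "\<forall>y\<in>{1..m}. root_perm \<alpha> y = root_perm \<beta> y"
  show "agree m 1 \<alpha> \<beta>"
    unfolding agree_def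
  proof (intro ballI impI)
    fix u assume "u \<in> words m" "length u = 1"
    then obtain y where "u = [y]" "y \<in> {1..m}" by (cases u) auto
    then show "\<alpha> u = \<beta> u" using eq by (simp add: root_perm_eq[OF assms(1)] root_perm_eq[OF assms(2)])
  qed
qed

text \<open>
  On words of length \<open>N\<close> the limit acts like \<open>s N\<close>; that a word and its children have related images is seen on two
  consecutive levels, where \<open>s N\<close> and \<open>s (Suc N)\<close> are compatible.
\<close>

lemma coherent_limit:
  assumes m: "m \<ge> 1" and s: "\<And>N. s N \<in> tree_automs m"
    and step: "\<And>N. agree m N (s (Suc N)) (s N)"
  shows "\<exists>g\<in>tree_automs m. \<forall>N. agree m N g (s N)"
proof -
  define g where "g u = s (length u) u" for u
  have g_len: "length (g u) = length u" for u by (simp add: g_def tree_automs_length[OF s])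
  have g_words: "g u \<in> words m \<longleftrightarrow> u \<in> words m" for u by (simp add: g_def s)
  have inv_len: "length (finv (s k) u) = length u" for k u by (rule tree_automs_length[OF tree_automs_inv[OF s]])
  have "bij_betw g (words m) (words m)"
  proof (rule bij_betw_byWitness[where f' = "\<lambda>u. finv (s (length u)) u"])
    show "\<forall>u\<in>words m. finv (s (length (g u))) (g u) = u"
      by (simp add: g_len) (simp add: g_def tree_automs_inverse[OF s])
    show "\<forall>u\<in>words m. g (finv (s (length u)) u) = u"
      by (simp add: g_def inv_len tree_automs_inverse(1)[OF s])
    show "g ` words m \<subseteq> words m" using g_words by blast
    show "(\<lambda>u. finv (s (length u)) u) ` words m \<subseteq> words m" using s by auto
  qed
  then have "g permutes words m"
    by (rule bij_imp_permutes) (simp add: g_def tree_automs_not_words[OF s])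
  moreover have "g [] = []" by (simp add: g_def tree_automs_Nil[OF s])
  moreover have "\<exists>z\<in>{1..m}. g (u @ [y]) = g u @ [z]" if u: "u \<in> words m" and y: "y \<in> {1..m}" for u y
  proof -
    have "s (Suc (length u)) u = s (length u) u" by (rule agreeD[OF step u refl])
    then show ?thesis using tree_automs_snoc[OF s u y, of "Suc (length u)"] by (simp add: g_def)
  qed
  ultimately have "g \<in> tree_automs m" unfolding tree_automs_iff by (intro conjI ballI)
  moreover have "agree m N g (s N)" for N by (simp add: agree_def g_def)
  ultimately show ?thesis by blast
qed

lemma level_stab_iff: "\<alpha> \<in> level_stab m G N \<longleftrightarrow> \<alpha> \<in> G \<and> agree m N \<alpha> id"
  by (auto simp: level_stab_def agree_def)

lemma level_stab_coset:
  assumes g: "g \<in> tree_automs m"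
  shows "h \<in> g <#\<^bsub>tree_aut_group m\<^esub> level_stab m (tree_automs m) N \<longleftrightarrow> h \<in> tree_automs m \<and> agree m N h g"
proof
  assume "h \<in> g <#\<^bsub>tree_aut_group m\<^esub> level_stab m (tree_automs m) N"
  then obtain k where k: "k \<in> tree_automs m" "agree m N k id" "h = k \<circ> g"
    by (auto simp: l_coset_def level_stab_iff)
  have "agree m N (k \<circ> g) (id \<circ> g)" by (rule agree_comp[OF agree_refl k(2) g])
  then show "h \<in> tree_automs m \<and> agree m N h g"
    using k tree_automs_comp[OF g k(1)] by (simp only: id_comp)
next
  assume h: "h \<in> tree_automs m \<and> agree m N h g"
  have "agree m N (h \<circ> finv g) (g \<circ> finv g)"
    by (rule agree_comp) (use h g in simp_all)
  then have "h \<circ> finv g \<in> level_stab m (tree_automs m) N"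
    using h g by (simp add: level_stab_iff tree_automs_inverse(3)[OF g])
  moreover have "h = (h \<circ> finv g) \<circ> g" by (simp only: comp_assoc tree_automs_inverse(4)[OF g] comp_id)
  ultimately show "h \<in> g <#\<^bsub>tree_aut_group m\<^esub> level_stab m (tree_automs m) N"
    unfolding l_coset_def tree_group_simps by blast
qed

lemma level_stab_chain:
  assumes "m \<ge> 1"
  shows "subgroup_chain (tree_aut_group m) (level_stab m (tree_automs m))"
proof (intro subgroup_chain.intro subgroup_chain_axioms.intro tree_group)
  interpret group "tree_aut_group m" by (rule tree_group)
  fix i j :: nat
  show "subgroup (level_stab m (tree_automs m) i) (tree_aut_group m)"
  proof (rule subgroupI)
    show "level_stab m (tree_automs m) i \<noteq> {}" using level_stab_iff[of id m "tree_automs m" i] by auto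
  next
    fix a assume "a \<in> level_stab m (tree_automs m) i"
    then show "inv\<^bsub>tree_aut_group m\<^esub> a \<in> level_stab m (tree_automs m) i"
      using agree_inv[of m i a id] by (simp add: level_stab_iff tree_group_inv)
  next
    fix a b assume "a \<in> level_stab m (tree_automs m) i" "b \<in> level_stab m (tree_automs m) i"
    then show "a \<otimes>\<^bsub>tree_aut_group m\<^esub> b \<in> level_stab m (tree_automs m) i"
      using agree_comp[of m i a id b id] by (simp add: level_stab_iff)
  qed (auto simp: level_stab_iff)
  assume "i \<le> j"
  then show "level_stab m (tree_automs m) j \<subseteq> level_stab m (tree_automs m) i"
    using agree_mono[OF assms _ tree_automs_id] by (auto simp: level_stab_iff)
qed

lemma tree_closure_iff:
  assumes "m \<ge> 1"
  shows "g \<in> (tree_topology m) closure_of S \<longleftrightarrow>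
    g \<in> tree_automs m \<and> (\<forall>N. \<exists>s\<in>S. s \<in> tree_automs m \<and> agree m N s g)"
proof -
  interpret subgroup_chain "tree_aut_group m" "level_stab m (tree_automs m)"
    by (rule level_stab_chain[OF assms])
  show ?thesis
    unfolding tree_topology_def in_closure_of_coset_topology tree_group_simps
    by (rule conj_cong[OF refl]) (simp add: level_stab_coset)
qed

lemma tree_limitin_iff:
  assumes "m \<ge> 1"
  shows "limitin (tree_topology m) f l F \<longleftrightarrow>
    l \<in> tree_automs m \<and> (\<forall>N. \<forall>\<^sub>F k in F. f k \<in> tree_automs m \<and> agree m N (f k) l)"
proof -
  interpret subgroup_chain "tree_aut_group m" "level_stab m (tree_automs m)"
    by (rule level_stab_chain[OF assms])
  show ?thesis
    unfolding tree_topology_def limitin_coset_topology tree_group_simps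
    by (rule conj_cong[OF refl]) (simp add: level_stab_coset)
qed


section \<open>Abelian transitive state-closed groups\<close>

lemma (in group) commute_inv:
  assumes "s \<in> carrier G" "h \<in> carrier G" "s \<otimes> h = h \<otimes> s"
  shows "s \<otimes> inv h = inv h \<otimes> s"
proof -
  have "inv h \<otimes> s = inv h \<otimes> (s \<otimes> h) \<otimes> inv h" using assms(1,2) by (simp add: m_assoc)
  also have "\<dots> = s \<otimes> inv h" unfolding assms(3) using assms(1,2) by (simp add: m_assoc[symmetric])
  finally show ?thesis ..
qed

text \<open>
  The centralizer of an element is a subgroup; used twice, this shows that commuting generators generate a commutative
  group.
\<close>

lemma (in group) generate_commute_right:
  assumes s: "s \<in> carrier G" and S: "S \<subseteq> carrier G" "\<forall>t\<in>S. s \<otimes> t = t \<otimes> s"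
    and h: "h \<in> generate G S"
  shows "s \<otimes> h = h \<otimes> s"
  using h
proof induction
  case one
  then show ?case using s by simp
next
  case (incl h)
  then show ?case using S by blast
next
  case (inv h)
  then show ?case using S s by (intro commute_inv) auto
next
  case (eng h k)
  have hk: "h \<in> carrier G" "k \<in> carrier G"
    using eng.hyps generate_in_carrier[OF S(1)] by auto
  have "s \<otimes> (h \<otimes> k) = (h \<otimes> s) \<otimes> k" using s hk by (simp add: m_assoc[symmetric] eng.IH(1))
  also have "\<dots> = h \<otimes> k \<otimes> s" using s hk by (simp add: m_assoc eng.IH(2))
  finally show ?case .
qed

lemma (in group) generate_commute:
  assumes S: "S \<subseteq> carrier G" "\<forall>s\<in>S. \<forall>t\<in>S. s \<otimes> t = t \<otimes> s"
    and "g \<in> generate G S" "h \<in> generate G S"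
  shows "g \<otimes> h = h \<otimes> g"
proof (rule generate_commute_right[OF _ S(1) _ assms(4)])
  show g: "g \<in> carrier G" using generate_in_carrier[OF S(1) assms(3)] .
  show "\<forall>t\<in>S. g \<otimes> t = t \<otimes> g"
  proof
    fix t assume t: "t \<in> S"
    then have "t \<otimes> g = g \<otimes> t"
      using S by (intro generate_commute_right[OF _ S(1) _ assms(3)]) auto
    then show "g \<otimes> t = t \<otimes> g" ..
  qed
qed

text \<open>
  States at arbitrary words are iterated states at letters, so closure under the latter suffices.
\<close>

locale self_similar_abelian =
  fixes m :: nat and H :: "(nat list \<Rightarrow> nat list) set"
  assumes m_ge: "m \<ge> 1"
    and H_subgroup: "subgroup H (tree_aut_group m)"
    and H_commute: "\<lbrakk>g \<in> H; h \<in> H\<rbrakk> \<Longrightarrow> g \<circ> h = h \<circ> g"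
    and H_section: "\<lbrakk>g \<in> H; y \<in> {1..m}\<rbrakk> \<Longrightarrow> section_at g y \<in> H"
    and H_transitive: "\<lbrakk>i \<in> {1..m}; j \<in> {1..m}\<rbrakk> \<Longrightarrow> \<exists>g\<in>H. root_perm g i = j"
begin

lemma H_autom: "g \<in> H \<Longrightarrow> g \<in> tree_automs m"
  using subgroup.subset[OF H_subgroup] by auto

lemma H_id: "id \<in> H"
  using subgroup.one_closed[OF H_subgroup] by simp

lemma H_comp: "\<lbrakk>g \<in> H; h \<in> H\<rbrakk> \<Longrightarrow> h \<circ> g \<in> H"
  using subgroup.m_closed[OF H_subgroup, of g h] by simp

lemma H_finv: "g \<in> H \<Longrightarrow> finv g \<in> H"
  using subgroup.m_inv_closed[OF H_subgroup, of g] by (simp add: tree_group_inv[OF H_autom])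

lemma one_letter: "1 \<in> {1..m}"
  using m_ge by simp

text \<open>
  If \<open>k > 0\<close>, conjugation by \<open>g\<close> permutes the coordinates of \<open>h\<^sup>(\<^sup>k\<^sup>)\<close>, which are all equal to \<open>h\<^sup>(\<^sup>k\<^sup>-\<^sup>1\<^sup>)\<close>, and
  conjugates them by the states of \<open>g\<close>; these belong to \<open>H\<close>, so that the induction hypothesis applies to them.
\<close>

lemma commute_diag_pow: "\<lbrakk>g \<in> H; h \<in> H\<rbrakk> \<Longrightarrow> g \<circ> (diag m ^^ k) h = (diag m ^^ k) h \<circ> g"
proof (induction k arbitrary: g)
  case 0
  then show ?case by (simp add: H_commute)
next
  case (Suc k)
  let ?d = "(diag m ^^ k) h"
  have g: "g \<in> tree_automs m" and d: "?d \<in> tree_automs m"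
    using Suc.prems by (simp_all add: H_autom)
  show ?case
  proof
    fix w
    show "(g \<circ> (diag m ^^ Suc k) h) w = ((diag m ^^ Suc k) h \<circ> g) w"
    proof (cases "w \<in> words m")
      case False
      have "g \<circ> (diag m ^^ Suc k) h \<in> tree_automs m" "(diag m ^^ Suc k) h \<circ> g \<in> tree_automs m"
        using g d by simp_all
      then show ?thesis using tree_automs_not_words False by metis
    next
      case True
      show ?thesis
      proof (cases w)
        case Nil
        then show ?thesis by (simp add: tree_automs_Nil[OF g])
      next
        case (Cons y u)
        then have y: "y \<in> {1..m}" and u: "u \<in> words m" using True by simp_all
        have du: "?d u \<in> words m" using tree_automs_words[OF d] u by blast
        have ry: "root_perm g y \<in> {1..m}" using root_perm_range[OF g] y by blast
        have "section_at g y (?d u) = ?d (section_at g y u)"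
          using fun_cong[OF Suc.IH[OF H_section[OF Suc.prems(1) y] Suc.prems(2)], of u] by simp
        then show ?thesis
          by (simp only: Cons comp_apply funpow.simps(2) diag_Cons[OF y] diag_Cons[OF ry]
              tree_automs_Cons[OF g y u] tree_automs_Cons[OF g y du])
      qed
    qed
  qed
qed

lemma diag_pow_comp: "(diag m ^^ i) (\<beta> \<circ> \<alpha>) = (diag m ^^ i) \<beta> \<circ> (diag m ^^ i) \<alpha>"
proof (induction i)
  case (Suc i)
  have "(diag m ^^ Suc i) \<gamma> = diag m ((diag m ^^ i) \<gamma>)" for \<gamma> by simp
  then show ?case by (simp only: Suc.IH diag_comp)
qed simp

lemma diag_pow_commute:
  assumes "g \<in> H" "h \<in> H" "i \<le> j"
  shows "(diag m ^^ i) g \<circ> (diag m ^^ j) h = (diag m ^^ j) h \<circ> (diag m ^^ i) g"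
proof -
  have "(diag m ^^ j) h = (diag m ^^ i) ((diag m ^^ (j - i)) h)"
    using funpow_add[of i "j - i" "diag m"] assms(3) by simp
  then show ?thesis
    using commute_diag_pow[OF assms(1,2), of "j - i"] by (simp only: diag_pow_comp[symmetric])
qed

abbreviation generators :: "(nat list \<Rightarrow> nat list) set" where
  "generators \<equiv> (\<Union>i. (diag m ^^ i) ` H)"

lemma generators_automs: "generators \<subseteq> carrier (tree_aut_group m)"
  using H_autom by auto

lemma diagonal_closure_subgroup: "subgroup (diagonal_closure m H) (tree_aut_group m)"
  unfolding diagonal_closure_def by (rule group.generate_is_subgroup[OF tree_group generators_automs])

lemma diag_pow_in_closure: "g \<in> H \<Longrightarrow> (diag m ^^ i) g \<in> diagonal_closure m H"
  unfolding diagonal_closure_def by (rule generate.incl) blast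

lemma closure_ops:
  shows "id \<in> diagonal_closure m H"
    and "\<lbrakk>g \<in> diagonal_closure m H; h \<in> diagonal_closure m H\<rbrakk> \<Longrightarrow> h \<circ> g \<in> diagonal_closure m H"
    and "g \<in> diagonal_closure m H \<Longrightarrow> finv g \<in> diagonal_closure m H"
    and "g \<in> diagonal_closure m H \<Longrightarrow> g \<in> tree_automs m"
proof -
  note sub = diagonal_closure_subgroup
  show aut: "g \<in> tree_automs m" if "g \<in> diagonal_closure m H" for g
    using subgroup.mem_carrier[OF sub that] by simp
  show "id \<in> diagonal_closure m H" using subgroup.one_closed[OF sub] by simp
  show "h \<circ> g \<in> diagonal_closure m H" if "g \<in> diagonal_closure m H" "h \<in> diagonal_closure m H"
    using subgroup.m_closed[OF sub that] by simp
  show "finv g \<in> diagonal_closure m H" if "g \<in> diagonal_closure m H"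
    using subgroup.m_inv_closed[OF sub that] by (simp add: tree_group_inv[OF aut[OF that]])
qed

lemma generator_section:
  assumes "h \<in> generators" and y: "y \<in> {1..m}"
  shows "section_at h y \<in> diagonal_closure m H"
proof -
  obtain i a where ia: "a \<in> H" "h = (diag m ^^ i) a" using assms(1) by blast
  show ?thesis
  proof (cases i)
    case 0
    then show ?thesis using diag_pow_in_closure[OF H_section[OF ia(1) y], of 0] ia by simp
  next
    case (Suc k)
    then show ?thesis using diag_pow_in_closure[OF ia(1), of k] ia section_diag[OF y] by simp
  qed
qed

lemma diagonal_closure_section:
  "g \<in> diagonal_closure m H \<Longrightarrow> \<forall>y\<in>{1..m}. section_at g y \<in> diagonal_closure m H"
  unfolding diagonal_closure_def
proof (induction rule: generate.induct)
  case one
  show ?case using closure_ops(1) by (simp only: diagonal_closure_def tree_group_simps section_id) blast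
next
  case (incl h)
  then show ?case using generator_section[OF incl] by (simp add: diagonal_closure_def)
next
  case (inv h)
  have h: "h \<in> tree_automs m" using inv generators_automs by auto
  have "section_at (finv h) y \<in> diagonal_closure m H" if y: "y \<in> {1..m}" for y
  proof -
    have "root_perm (finv h) y \<in> {1..m}" using root_perm_range[OF tree_automs_inv[OF h]] y by blast
    from generator_section[OF inv this] show ?thesis using closure_ops(3) section_inv[OF h y] by simp
  qed
  then show ?case by (simp add: diagonal_closure_def tree_group_inv[OF h])
next
  case (eng g h)
  have gh: "g \<in> tree_automs m" "h \<in> tree_automs m"
    using eng.hyps closure_ops(4) by (simp_all add: diagonal_closure_def)
  show ?case
  proof
    fix y assume y: "y \<in> {1..m}"
    have "root_perm g y \<in> {1..m}" using root_perm_range[OF gh(1)] y by blast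
    then have "section_at h (root_perm g y) \<circ> section_at g y \<in> diagonal_closure m H"
      using eng.IH y by (intro closure_ops(2)) (simp_all add: diagonal_closure_def)
    then show "section_at (g \<otimes>\<^bsub>tree_aut_group m\<^esub> h) y \<in> generate (tree_aut_group m) generators"
      using section_comp[OF gh y] by (simp add: diagonal_closure_def)
  qed
qed

lemma diagonal_closure_diag: "g \<in> diagonal_closure m H \<Longrightarrow> diag m g \<in> diagonal_closure m H"
  unfolding diagonal_closure_def
proof (induction rule: generate.induct)
  case one
  show ?case using closure_ops(1) by (simp only: diagonal_closure_def tree_group_simps diag_id)
next
  case (incl h)
  then obtain i a where ia: "a \<in> H" "h = (diag m ^^ i) a" by blast
  then show ?case using diag_pow_in_closure[OF ia(1), of "Suc i"] by (simp add: diagonal_closure_def)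
next
  case (inv h)
  then obtain i a where ia: "a \<in> H" "h = (diag m ^^ i) a" by blast
  then have h: "h \<in> tree_automs m" by (simp add: H_autom)
  have "finv (diag m h) \<in> diagonal_closure m H"
    using closure_ops(3) diag_pow_in_closure[OF ia(1), of "Suc i"] ia(2) by simp
  then show ?case by (simp add: diagonal_closure_def tree_group_inv[OF h] diag_inv[OF h])
next
  case (eng g h)
  have "diag m h \<circ> diag m g \<in> diagonal_closure m H"
    using eng.IH by (intro closure_ops(2)) (simp_all add: diagonal_closure_def)
  then show ?case by (simp only: diagonal_closure_def tree_group_simps diag_comp)
qed

lemma diagonal_closure_commute:
  assumes "g \<in> diagonal_closure m H" "h \<in> diagonal_closure m H"
  shows "g \<circ> h = h \<circ> g"
proof -
  have "s \<otimes>\<^bsub>tree_aut_group m\<^esub> t = t \<otimes>\<^bsub>tree_aut_group m\<^esub> s"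
    if st: "s \<in> generators" "t \<in> generators" for s t
  proof -
    obtain i a where a: "a \<in> H" "s = (diag m ^^ i) a" using st(1) by blast
    obtain j b where b: "b \<in> H" "t = (diag m ^^ j) b" using st(2) by blast
    have "s \<circ> t = t \<circ> s"
    proof (cases "i \<le> j")
      case True
      then show ?thesis using diag_pow_commute[OF a(1) b(1)] a(2) b(2) by simp
    next
      case False
      then have "j \<le> i" by simp
      then show ?thesis using diag_pow_commute[OF b(1) a(1)] a(2) b(2) by simp
    qed
    then show ?thesis by (simp only: tree_group_simps)
  qed
  then have gen: "\<forall>s\<in>generators. \<forall>t\<in>generators.
      s \<otimes>\<^bsub>tree_aut_group m\<^esub> t = t \<otimes>\<^bsub>tree_aut_group m\<^esub> s"
    by (intro ballI)
  have "h \<otimes>\<^bsub>tree_aut_group m\<^esub> g = g \<otimes>\<^bsub>tree_aut_group m\<^esub> h"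
    by (rule group.generate_commute[OF tree_group generators_automs gen])
      (rule assms[unfolded diagonal_closure_def])+
  then show ?thesis by (simp only: tree_group_simps)
qed

end

locale self_similar_diag = self_similar_abelian +
  assumes H_diag: "g \<in> H \<Longrightarrow> diag m g \<in> H"

lemma (in self_similar_abelian) diagonal_closure_self_similar: "self_similar_diag m (diagonal_closure m H)"
proof (intro self_similar_diag.intro self_similar_abelian.intro self_similar_diag_axioms.intro)
  show "m \<ge> 1" by (rule m_ge)
  show "subgroup (diagonal_closure m H) (tree_aut_group m)" by (rule diagonal_closure_subgroup)
  show "g \<circ> h = h \<circ> g" if "g \<in> diagonal_closure m H" "h \<in> diagonal_closure m H" for g h
    using that by (rule diagonal_closure_commute)
  show "section_at g y \<in> diagonal_closure m H" if "g \<in> diagonal_closure m H" "y \<in> {1..m}" for g y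
    using diagonal_closure_section[OF that(1)] that(2) by (rule bspec)
  show "\<exists>g\<in>diagonal_closure m H. root_perm g i = j" if ij: "i \<in> {1..m}" "j \<in> {1..m}" for i j
  proof -
    obtain g where g: "g \<in> H" "root_perm g i = j" using H_transitive[OF ij] by (rule bexE)
    then show ?thesis using diag_pow_in_closure[OF g(1), of 0] by (intro bexI[of _ g]) simp_all
  qed
  show "diag m g \<in> diagonal_closure m H" if "g \<in> diagonal_closure m H" for g
    using that by (rule diagonal_closure_diag)
qed

locale complete_self_similar = self_similar_diag +
  assumes H_limit: "\<lbrakk>g \<in> tree_automs m; \<And>N. \<exists>s\<in>H. agree m N s g\<rbrakk> \<Longrightarrow> g \<in> H"

text \<open>
  Every condition concerns one level at a time, and on each level an element of the closure agrees with an element of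
  \<open>H\<close>.
\<close>

lemma (in self_similar_diag) closure_self_similar:
  "complete_self_similar m ((tree_topology m) closure_of H)"
proof -
  let ?C = "(tree_topology m) closure_of H"
  have C: "g \<in> ?C \<longleftrightarrow> g \<in> tree_automs m \<and> (\<forall>N. \<exists>s\<in>H. agree m N s g)" for g
    unfolding tree_closure_iff[OF m_ge] using H_autom by (metis (no_types, lifting))
  have aut: "g \<in> tree_automs m" if "g \<in> ?C" for g
    using iffD1[OF C that] by (rule conjunct1)
  have approx: "\<exists>s\<in>H. agree m N s g" if "g \<in> ?C" for g N
    using conjunct2[OF iffD1[OF C that]] by (rule spec)
  have CI: "g \<in> ?C" if "g \<in> tree_automs m" "\<And>N. \<exists>s\<in>H. agree m N s g" for g
    by (rule iffD2[OF C conjI[OF that(1) allI]]) (rule that(2))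
  have H_C: "g \<in> ?C" if "g \<in> H" for g
    by (rule CI[OF H_autom[OF that]]) (rule bexI[OF agree_refl that])
  have comp: "h \<circ> g \<in> ?C" if g: "g \<in> ?C" and h: "h \<in> ?C" for g h
  proof (rule CI)
    show "h \<circ> g \<in> tree_automs m" using aut g h by simp
    fix N
    obtain s t where "s \<in> H" "agree m N s g" "t \<in> H" "agree m N t h"
      using approx[OF g] approx[OF h] by blast
    then show "\<exists>s\<in>H. agree m N s (h \<circ> g)"
      by (intro bexI[of _ "t \<circ> s"] agree_comp[OF _ _ aut[OF g]] H_comp)
  qed
  have inv: "finv g \<in> ?C" if g: "g \<in> ?C" for g
  proof (rule CI)
    show "finv g \<in> tree_automs m" using aut g by simp
    fix N
    obtain s where "s \<in> H" "agree m N s g" using approx[OF g] by blast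
    then show "\<exists>s\<in>H. agree m N s (finv g)"
      by (intro bexI[of _ "finv s"] agree_inv[OF _ H_autom aut[OF g]] H_finv)
  qed
  show ?thesis
  proof (intro complete_self_similar.intro self_similar_diag.intro self_similar_abelian.intro
      self_similar_diag_axioms.intro complete_self_similar_axioms.intro)
    show "m \<ge> 1" by (rule m_ge)
    show "subgroup ?C (tree_aut_group m)"
    proof (rule group.subgroupI[OF tree_group])
      show "?C \<subseteq> carrier (tree_aut_group m)" using aut by auto
      show "?C \<noteq> {}" using H_C H_id by blast
      show "inv\<^bsub>tree_aut_group m\<^esub> g \<in> ?C" if "g \<in> ?C" for g
        using inv[OF that] by (simp add: tree_group_inv[OF aut[OF that]])
      show "g \<otimes>\<^bsub>tree_aut_group m\<^esub> h \<in> ?C" if "g \<in> ?C" "h \<in> ?C" for g h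
        using comp[OF that] by simp
    qed
    show "g \<circ> h = h \<circ> g" if g: "g \<in> ?C" and h: "h \<in> ?C" for g h
    proof (rule agree_all_eq)
      show "g \<circ> h \<in> tree_automs m" "h \<circ> g \<in> tree_automs m" using aut g h by simp_all
      fix N
      obtain s t where st: "s \<in> H" "agree m N s g" "t \<in> H" "agree m N t h"
        using approx[OF g] approx[OF h] by blast
      have "agree m N (s \<circ> t) (g \<circ> h)" by (rule agree_comp[OF st(4) st(2) aut[OF h]])
      moreover have "agree m N (t \<circ> s) (h \<circ> g)" by (rule agree_comp[OF st(2) st(4) aut[OF g]])
      ultimately show "agree m N (g \<circ> h) (h \<circ> g)"
        using H_commute[OF st(1,3)] agree_sym agree_trans by metis
    qed
    show "section_at g y \<in> ?C" if g: "g \<in> ?C" and y: "y \<in> {1..m}" for g y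
    proof (rule CI)
      show "section_at g y \<in> tree_automs m" by (rule section_autom[OF aut[OF g] y])
      fix N
      obtain s where "s \<in> H" "agree m (Suc N) s g" using approx[OF g] by blast
      then show "\<exists>s\<in>H. agree m N s (section_at g y)"
        by (intro bexI[of _ "section_at s y"] agree_section[OF _ y] H_section[OF _ y])
    qed
    show "\<exists>g\<in>?C. root_perm g i = j" if "i \<in> {1..m}" "j \<in> {1..m}" for i j
    proof -
      from H_transitive[OF that] show ?thesis using H_C by (elim bexE) (rule bexI)
    qed
    show "diag m g \<in> ?C" if g: "g \<in> ?C" for g
    proof (rule CI)
      show "diag m g \<in> tree_automs m" using aut g by simp
      fix N
      obtain s where s: "s \<in> H" "agree m N s g" using approx[OF g] by blast
      have "agree m N (diag m s) (diag m g)"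
        by (rule agree_mono[OF m_ge _ _ agree_diag[OF s(2)]]) (use H_autom[OF s(1)] aut[OF g] in simp_all)
      then show "\<exists>s\<in>H. agree m N s (diag m g)" using H_diag[OF s(1)] by blast
    qed
    show "g \<in> ?C" if g: "g \<in> tree_automs m" and ap: "\<And>N. \<exists>s\<in>?C. agree m N s g" for g
    proof (rule CI[OF g])
      fix N
      obtain s where s: "s \<in> ?C" "agree m N s g" using ap by blast
      obtain t where t: "t \<in> H" "agree m N t s" using approx[OF s(1)] by blast
      show "\<exists>s\<in>H. agree m N s g" 
        using agree_trans[OF t(2) s(2)] t(1) by (intro bexI[of _ t])
    qed
  qed
qed


section \<open>Completeness of the closure under the diagonal endomorphism\<close>

lemma (in comm_group) nth_multiples_chain:
  assumes "m > 0"
  shows "subgroup_chain G (\<lambda>i. nth_multiples G (m ^ i))"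
proof (intro subgroup_chain.intro subgroup_chain_axioms.intro is_group)
  fix i j :: nat
  show "subgroup (nth_multiples G (m ^ i)) G"
  proof (rule subgroupI)
    show "nth_multiples G (m ^ i) \<subseteq> carrier G" by (auto simp: nth_multiples_def)
    show "nth_multiples G (m ^ i) \<noteq> {}" by (auto simp: nth_multiples_def)
  next
    fix a assume "a \<in> nth_multiples G (m ^ i)"
    then obtain b where "b \<in> carrier G" "a = b [^] (m ^ i)" by (auto simp: nth_multiples_def)
    then have "inv a = inv b [^] (m ^ i)" "inv b \<in> carrier G" by (simp_all add: nat_pow_inv)
    then show "inv a \<in> nth_multiples G (m ^ i)" unfolding nth_multiples_def by (rule image_eqI)
  next
    fix a b assume "a \<in> nth_multiples G (m ^ i)" "b \<in> nth_multiples G (m ^ i)"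
    then obtain c d where "c \<in> carrier G" "a = c [^] (m ^ i)" "d \<in> carrier G" "b = d [^] (m ^ i)"
      by (auto simp: nth_multiples_def)
    then have "a \<otimes> b = (c \<otimes> d) [^] (m ^ i)" "c \<otimes> d \<in> carrier G" by (simp_all add: nat_pow_distrib)
    then show "a \<otimes> b \<in> nth_multiples G (m ^ i)" unfolding nth_multiples_def by (rule image_eqI)
  qed
  assume "i \<le> j"
  show "nth_multiples G (m ^ j) \<subseteq> nth_multiples G (m ^ i)"
  proof
    fix a assume "a \<in> nth_multiples G (m ^ j)"
    then obtain b where b: "b \<in> carrier G" "a = b [^] (m ^ j)" by (auto simp: nth_multiples_def)
    have "m ^ j = m ^ (j - i) * m ^ i" using \<open>i \<le> j\<close> by (simp add: power_add[symmetric])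
    then have "a = (b [^] (m ^ (j - i))) [^] (m ^ i)" using b by (simp only: nat_pow_pow)
    then show "a \<in> nth_multiples G (m ^ i)"
      unfolding nth_multiples_def using b by (intro image_eqI[of _ _ "b [^] (m ^ (j - i))"]) simp_all
  qed
qed

context complete_self_similar
begin

abbreviation "GH \<equiv> tree_subgroup m H"

lemma diag_pow_1: "(diag m ^^ 1) k = diag m k"
  by simp

lemma GH_simps:
  "carrier GH = H" "g \<otimes>\<^bsub>GH\<^esub> h = h \<circ> g" "\<one>\<^bsub>GH\<^esub> = id"
  by simp_all

lemma GH_comm_group: "comm_group GH"
proof (rule group.group_comm_groupI)
  show "group GH" by (rule subgroup.subgroup_is_group[OF H_subgroup tree_group])
  fix g h assume "g \<in> carrier GH" "h \<in> carrier GH"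
  then show "g \<otimes>\<^bsub>GH\<^esub> h = h \<otimes>\<^bsub>GH\<^esub> g" unfolding GH_simps by (rule H_commute[symmetric])
qed

lemma root_perm_commute:
  assumes "g \<in> H" "h \<in> H"
  shows "root_perm g (root_perm h y) = root_perm h (root_perm g y)"
  using root_perm_comp[OF H_autom[OF assms(2)] H_autom[OF assms(1)], of y]
    root_perm_comp[OF H_autom[OF assms(1)] H_autom[OF assms(2)], of y] H_commute[OF assms]
  by simp

text \<open>
  A transitive abelian permutation group is regular: an element of it is determined by the image of one letter.
\<close>

lemma regular_on_letters:
  assumes g: "g \<in> H" and h: "h \<in> H" and eq: "root_perm g 1 = root_perm h 1"
  shows "agree m 1 g h"
  unfolding agree_1_iff[OF H_autom[OF g] H_autom[OF h]]
proof
  fix y assume "y \<in> {1..m}"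
  then obtain k where k: "k \<in> H" "root_perm k 1 = y" using H_transitive[OF one_letter] by blast
  show "root_perm g y = root_perm h y"
    unfolding k(2)[symmetric] root_perm_commute[OF g k(1)] root_perm_commute[OF h k(1)] eq ..
qed

text \<open>
  Let \<open>h\<close> take the letter \<open>1\<close> to \<open>y\<close>. Comparing \<open>g h\<close> and \<open>h g\<close> below the letter \<open>1\<close> shows that the state of \<open>g\<close> at
  \<open>y\<close> is conjugate to the state at \<open>1\<close> by a state of \<open>h\<close>. All these states are in \<open>H\<close>, which is commutative; so the
  states of \<open>g\<close> at \<open>1\<close> and at \<open>y\<close> are equal.
\<close>

lemma fixing_first_level:
  assumes g: "g \<in> H" and fix1: "agree m 1 g id"
  shows "g = diag m (section_at g 1)"
proof
  fix w
  have ga: "g \<in> tree_automs m" by (rule H_autom[OF g])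
  have r: "root_perm g y = y" if "y \<in> {1..m}" for y
    using fix1 that unfolding agree_1_iff[OF ga tree_automs_id] by simp
  let ?k = "section_at g 1"
  have kH: "?k \<in> H" by (rule H_section[OF g one_letter])
  have ka: "?k \<in> tree_automs m" by (rule H_autom[OF kH])
  show "g w = diag m ?k w"
  proof (cases "w \<in> words m")
    case False
    then show ?thesis using tree_automs_not_words[OF ga] tree_automs_not_words[OF diag_autom[OF ka]] by simp
  next
    case True
    show ?thesis
    proof (cases w)
      case Nil
      then show ?thesis by (simp add: tree_automs_Nil[OF ga])
    next
      case (Cons y u)
      then have y: "y \<in> {1..m}" and u: "u \<in> words m" using True by simp_all
      obtain h where h: "h \<in> H" "root_perm h 1 = y" using H_transitive[OF one_letter y] by blast
      let ?s = "section_at h 1"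
      have sH: "?s \<in> H" by (rule H_section[OF h(1) one_letter])
      have sa: "?s \<in> tree_automs m" and ha: "h \<in> tree_automs m" by (rule H_autom, fact)+
      define v where "v = finv ?s u"
      have v: "v \<in> words m" "?s v = u"
        using u tree_automs_words[OF tree_automs_inv[OF sa]] tree_automs_inverse(1)[OF sa]
        by (simp_all add: v_def)
      have kv: "?k v \<in> words m" using tree_automs_words[OF ka] v(1) by blast
      have h1: "h (1 # a) = y # ?s a" if "a \<in> words m" for a
        using tree_automs_Cons[OF ha one_letter that] h(2) by simp
      have g1: "g (1 # a) = 1 # ?k a" if "a \<in> words m" for a
        using tree_automs_Cons[OF ga one_letter that] r[OF one_letter] by simp
      have "g (y # u) = g (h (1 # v))" using h1[OF v(1)] v(2) by simp
      also have "\<dots> = h (g (1 # v))" using fun_cong[OF H_commute[OF g h(1)], of "1 # v"] by simp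
      also have "\<dots> = y # ?s (?k v)" using g1[OF v(1)] h1[OF kv] by simp
      also have "?s (?k v) = ?k (?s v)" using fun_cong[OF H_commute[OF sH kH], of v] by simp
      finally show ?thesis using v(2) y Cons by simp
    qed
  qed
qed

lemma fixing_level:
  "\<lbrakk>g \<in> H; agree m N g id\<rbrakk> \<Longrightarrow> \<exists>k\<in>H. g = (diag m ^^ N) k"
proof (induction N arbitrary: g)
  case 0
  then show ?case by (intro bexI[of _ g]) simp_all
next
  case (Suc N)
  let ?k = "section_at g 1"
  have "agree m 1 g id"
    by (rule agree_mono[OF m_ge H_autom[OF Suc.prems(1)] tree_automs_id Suc.prems(2)]) simp
  then have g: "g = diag m ?k" by (rule fixing_first_level[OF Suc.prems(1)])
  have "agree m N ?k id" using agree_section[OF Suc.prems(2) one_letter] by (simp only: section_id)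
  then obtain k where k: "k \<in> H" "?k = (diag m ^^ N) k"
    using Suc.IH[OF H_section[OF Suc.prems(1) one_letter]] by blast
  have "g = (diag m ^^ Suc N) k" using g unfolding k(2) by simp
  then show ?case using k(1) by (rule bexI)
qed

lemma diag_pow_fixes: "agree m N ((diag m ^^ N) k) id" if "k \<in> H"
proof (induction N)
  case 0
  show ?case unfolding funpow_0 by (rule agree_0[OF H_autom[OF that] tree_automs_id])
next
  case (Suc N)
  then show ?case using agree_diag[OF Suc] by (simp only: funpow.simps comp_apply diag_id)
qed

lemma diag_pow_H: "k \<in> H \<Longrightarrow> (diag m ^^ N) k \<in> H"
  by (induction N) (simp_all add: H_diag)

lemma agree_iff_coset:
  assumes g: "g \<in> H" and h: "h \<in> H"
  shows "agree m N g h \<longleftrightarrow> (\<exists>k\<in>H. g = (diag m ^^ N) k \<circ> h)"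
proof
  assume ag: "agree m N g h"
  have ha: "h \<in> tree_automs m" by (rule H_autom[OF h])
  have "agree m N (g \<circ> finv h) (h \<circ> finv h)"
    by (rule agree_comp[OF agree_refl ag tree_automs_inv[OF ha]])
  then have "agree m N (g \<circ> finv h) id" by (simp only: tree_automs_inverse(3)[OF ha])
  then obtain k where k: "k \<in> H" "g \<circ> finv h = (diag m ^^ N) k"
    using fixing_level[OF H_comp[OF H_finv[OF h] g]] by blast
  have "g = (g \<circ> finv h) \<circ> h" by (simp only: comp_assoc tree_automs_inverse(4)[OF ha] comp_id)
  then have "g = (diag m ^^ N) k \<circ> h" unfolding k(2) .
  then show "\<exists>k\<in>H. g = (diag m ^^ N) k \<circ> h" using k(1) by (rule bexI)
next
  assume "\<exists>k\<in>H. g = (diag m ^^ N) k \<circ> h"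
  then obtain k where k: "k \<in> H" "g = (diag m ^^ N) k \<circ> h" by blast
  have "agree m N ((diag m ^^ N) k \<circ> h) (id \<circ> h)"
    by (rule agree_comp[OF agree_refl diag_pow_fixes[OF k(1)] H_autom[OF h]])
  then show "agree m N g h" unfolding k(2) by (simp only: id_comp)
qed

lemma letter_representatives: "\<exists>\<tau>. \<forall>y\<in>{1..m}. \<tau> y \<in> H \<and> root_perm (\<tau> y) 1 = y"
proof -
  have "\<forall>y\<in>{1..m}. \<exists>g. g \<in> H \<and> root_perm g 1 = y" using H_transitive[OF one_letter] by blast
  then show ?thesis by (rule bchoice)
qed

text \<open>
  Lagrange's theorem for the group induced on the \<open>m\<close> letters, by the usual argument for abelian groups: multiplication
  by \<open>g\<close> permutes the representatives \<open>\<tau> y\<close> up to elements fixing the letters, so the product \<open>P\<close> of all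
  representatives is congruent to \<open>g ^ m\<close> times \<open>P\<close>.
\<close>

lemma power_m_fixes_letters:
  assumes g: "g \<in> H"
  shows "agree m 1 (g [^]\<^bsub>GH\<^esub> m) id"
proof -
  interpret GH: comm_group GH by (rule GH_comm_group)
  obtain \<tau> where \<tau>: "\<forall>y\<in>{1..m}. \<tau> y \<in> H \<and> root_perm (\<tau> y) 1 = y"
    using letter_representatives by (rule exE)
  let ?Y = "{1..m}" and ?r = "root_perm g"
  have ga: "g \<in> tree_automs m" by (rule H_autom[OF g])
  have \<tau>H: "\<tau> y \<in> H" if "y \<in> ?Y" for y using \<tau> that by blast
  have r_in: "?r y \<in> ?Y" if "y \<in> ?Y" for y using root_perm_range[OF ga] that by blast
  have inj: "inj_on ?r ?Y" by (rule inj_on_inverseI) (rule root_perm_inv(1)[OF ga])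
  have onto: "?r ` ?Y = ?Y" by (rule endo_inj_surj[OF _ _ inj]) (use r_in in auto)
  have ag_prod: "finprod GH f I \<in> H \<and> finprod GH f' I \<in> H \<and> agree m 1 (finprod GH f I) (finprod GH f' I)"
    if "finite I" "\<forall>i\<in>I. f i \<in> H \<and> f' i \<in> H \<and> agree m 1 (f i) (f' i)" for f f' and I :: "nat set"
    using that
  proof (induction I rule: finite_induct)
    case empty
    then show ?case using H_id by (simp only: GH.finprod_empty GH_simps agree_refl)
  next
    case (insert i I)
    have c: "f \<in> I \<rightarrow> carrier GH" "f i \<in> carrier GH" "f' \<in> I \<rightarrow> carrier GH" "f' i \<in> carrier GH"
      using insert.prems by auto
    have IH: "finprod GH f I \<in> H" "finprod GH f' I \<in> H" "agree m 1 (finprod GH f I) (finprod GH f' I)"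
      using insert.IH insert.prems by auto
    have fi: "f i \<in> H" "f' i \<in> H" "agree m 1 (f i) (f' i)" using insert.prems by auto
    show ?case
      unfolding GH.finprod_insert[OF insert.hyps c(1,2)] GH.finprod_insert[OF insert.hyps c(3,4)] GH_simps
      using H_comp[OF fi(1) IH(1)] H_comp[OF fi(2) IH(2)] agree_comp[OF fi(3) IH(3) H_autom[OF fi(2)]]
      by blast
  qed
  let ?P = "finprod GH \<tau> ?Y"
  have PH: "?P \<in> H" using GH.finprod_closed[of \<tau> ?Y] \<tau>H by auto
  have "finprod GH (\<lambda>y. \<tau> y \<otimes>\<^bsub>GH\<^esub> g) ?Y = ?P \<otimes>\<^bsub>GH\<^esub> finprod GH (\<lambda>y. g) ?Y"
    by (rule GH.finprod_multf) (use \<tau>H g in auto)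
  also have "finprod GH (\<lambda>y. g) ?Y = g [^]\<^bsub>GH\<^esub> m"
    using GH.finprod_const[of g ?Y] g by simp
  finally have left: "finprod GH (\<lambda>y. \<tau> y \<otimes>\<^bsub>GH\<^esub> g) ?Y = g [^]\<^bsub>GH\<^esub> m \<circ> ?P" by (simp only: GH_simps)
  have "finprod GH \<tau> (?r ` ?Y) = finprod GH (\<lambda>y. \<tau> (?r y)) ?Y"
    by (rule GH.finprod_reindex[OF _ inj]) (use \<tau>H r_in in auto)
  then have right: "finprod GH (\<lambda>y. \<tau> (?r y)) ?Y = ?P" by (simp only: onto)
  have "\<tau> y \<otimes>\<^bsub>GH\<^esub> g \<in> H \<and> \<tau> (?r y) \<in> H \<and> agree m 1 (\<tau> y \<otimes>\<^bsub>GH\<^esub> g) (\<tau> (?r y))" if y: "y \<in> ?Y" for y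
  proof -
    have "root_perm (g \<circ> \<tau> y) 1 = root_perm (\<tau> (?r y)) 1"
      using root_perm_comp[OF H_autom[OF \<tau>H[OF y]] ga, of 1] \<tau> y r_in[OF y] by simp
    then show ?thesis
      unfolding GH_simps
      using regular_on_letters[OF H_comp[OF \<tau>H[OF y] g] \<tau>H[OF r_in[OF y]]]
        H_comp[OF \<tau>H[OF y] g] \<tau>H[OF r_in[OF y]] by blast
  qed
  then have "agree m 1 (finprod GH (\<lambda>y. \<tau> y \<otimes>\<^bsub>GH\<^esub> g) ?Y) (finprod GH (\<lambda>y. \<tau> (?r y)) ?Y)"
    using ag_prod[of ?Y "\<lambda>y. \<tau> y \<otimes>\<^bsub>GH\<^esub> g" "\<lambda>y. \<tau> (?r y)"] by simp
  then have "agree m 1 (g [^]\<^bsub>GH\<^esub> m \<circ> ?P) ?P" by (simp only: left right)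
  then have "agree m 1 ((g [^]\<^bsub>GH\<^esub> m \<circ> ?P) \<circ> finv ?P) (?P \<circ> finv ?P)"
    by (rule agree_comp[OF agree_refl _ tree_automs_inv[OF H_autom[OF PH]]])
  then show ?thesis by (simp only: comp_assoc tree_automs_inverse(3)[OF H_autom[OF PH]] comp_id)
qed

lemma limit_in_H:
  assumes s: "\<And>N. s N \<in> H" and step: "\<And>N. agree m N (s (Suc N)) (s N)"
  shows "\<exists>g\<in>H. \<forall>N. agree m N g (s N)"
proof -
  obtain g where g: "g \<in> tree_automs m" "\<forall>N. agree m N g (s N)"
    using coherent_limit[OF m_ge H_autom[OF s] step] by blast
  have "g \<in> H"
  proof (rule H_limit[OF g(1)])
    fix N
    have "agree m N (s N) g" using g(2) agree_sym by blast
    then show "\<exists>s\<in>H. agree m N s g" using s by (rule bexI)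
  qed
  then show ?thesis using g(2) by (intro bexI[of _ g])
qed

lemma transversal_H:
  assumes \<tau>: "\<forall>y\<in>{1..m}. \<tau> y \<in> H \<and> root_perm (\<tau> y) 1 = y" and g: "g \<in> H"
  shows "\<exists>y\<in>{1..m}. \<exists>k\<in>H. g = \<tau> y \<otimes>\<^bsub>GH\<^esub> diag m k"
proof -
  let ?y = "root_perm g 1"
  have y: "?y \<in> {1..m}" using root_perm_range[OF H_autom[OF g]] one_letter by blast
  have t: "\<tau> ?y \<in> H" "root_perm (\<tau> ?y) 1 = ?y" using \<tau> y by blast+
  have "agree m 1 g (\<tau> ?y)" by (rule regular_on_letters[OF g t(1) t(2)[symmetric]])
  then obtain k where k: "k \<in> H" "g = (diag m ^^ 1) k \<circ> \<tau> ?y"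
    unfolding agree_iff_coset[OF g t(1)] by (rule bexE)
  have "g = \<tau> ?y \<otimes>\<^bsub>GH\<^esub> diag m k" using k(2) by (simp only: GH_simps diag_pow_1)
  then show ?thesis using y k(1) by blast
qed

text \<open>
  Completeness comes from closedness in the tree topology: the partial products of \<open>\<Prod>\<^sub>i x\<^sup>i h\<^sub>i\<close> become stationary on
  every level.
\<close>

lemma adic: "adic_group GH (diag m) m"
proof (intro adic_group.intro adic_group_axioms.intro GH_comm_group m_ge)
  interpret GH: comm_group GH by (rule GH_comm_group)
  show "diag m \<in> hom GH GH"
    by (rule homI) (simp_all only: GH_simps H_diag diag_comp)
  show "g = \<one>\<^bsub>GH\<^esub>" if g: "g \<in> carrier GH" "diag m g = \<one>\<^bsub>GH\<^esub>" for g
  proof -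
    have "section_at (diag m g) 1 = section_at id 1" using g(2) by (simp only: GH_simps)
    then show ?thesis by (simp only: GH_simps section_id section_diag[OF one_letter])
  qed
  show "g = \<one>\<^bsub>GH\<^esub>" if g: "g \<in> carrier GH" "\<And>N. g \<in> (diag m ^^ N) ` carrier GH" for g
  proof -
    have gH: "g \<in> H" using g(1) by (simp only: GH_simps)
    have "g = id"
    proof (rule agree_all_eq[OF H_autom[OF gH] tree_automs_id])
      fix N
      obtain k where "k \<in> H" "g = (diag m ^^ N) k" using g(2)[of N] unfolding GH_simps by (rule imageE)
      then show "agree m N g id" using diag_pow_fixes by simp
    qed
    then show ?thesis by (simp only: GH_simps)
  qed
  show "\<exists>g\<in>carrier GH. \<forall>N. \<exists>k\<in>carrier GH.
      g = finprod GH (\<lambda>i. (diag m ^^ i) (h i)) {..<N} \<otimes>\<^bsub>GH\<^esub> (diag m ^^ N) k"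
    if h: "\<And>i. h i \<in> carrier GH" for h
  proof -
    define s where "s N = finprod GH (\<lambda>i. (diag m ^^ i) (h i)) {..<N}" for N
    have hH: "h i \<in> H" for i using h[of i] by (simp only: GH_simps)
    have dH: "(diag m ^^ i) (h i) \<in> carrier GH" for i using diag_pow_H[OF hH] by (simp only: GH_simps)
    have sH: "s N \<in> H" for N
      using GH.finprod_closed[of "\<lambda>i. (diag m ^^ i) (h i)" "{..<N}"] dH by (simp add: s_def)
    have s_Suc: "s (Suc N) = (diag m ^^ N) (h N) \<circ> s N" for N
    proof -
      have "s (Suc N) = (diag m ^^ N) (h N) \<otimes>\<^bsub>GH\<^esub> s N"
        unfolding s_def lessThan_Suc by (rule GH.finprod_insert) (use dH in auto)
      also have "\<dots> = s N \<otimes>\<^bsub>GH\<^esub> (diag m ^^ N) (h N)"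
        by (rule GH.m_comm) (use dH sH in \<open>simp_all only: GH_simps\<close>)
      finally show ?thesis by (simp only: GH_simps)
    qed
    have step: "agree m N (s (Suc N)) (s N)" for N
      unfolding agree_iff_coset[OF sH sH] using s_Suc hH by (rule bexI)
    obtain g where g: "g \<in> H" "\<forall>N. agree m N g (s N)"
      using limit_in_H[of s, OF sH step] by blast
    have "\<exists>k\<in>H. g = (diag m ^^ N) k \<circ> s N" for N
      using g(2) unfolding agree_iff_coset[OF g(1) sH] by (rule spec)
    then show ?thesis using g(1) unfolding s_def GH_simps by blast
  qed
  show "\<exists>h\<in>carrier GH. g [^]\<^bsub>GH\<^esub> m = diag m h" if g: "g \<in> carrier GH" for g
  proof -
    have gH: "g \<in> H" using g by (simp only: GH_simps)
    have pH: "g [^]\<^bsub>GH\<^esub> m \<in> H" using GH.nat_pow_closed[OF g, of m] by (simp only: GH_simps)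
    obtain k where "k \<in> H" "g [^]\<^bsub>GH\<^esub> m = (diag m ^^ 1) k"
      using fixing_level[OF pH power_m_fixes_letters[OF gH]] by (rule bexE)
    then show ?thesis unfolding GH_simps diag_pow_1 by (intro bexI[of _ k])
  qed
  show "\<exists>T. finite T \<and> T \<subseteq> carrier GH \<and>
      (\<forall>g\<in>carrier GH. \<exists>t\<in>T. \<exists>h\<in>carrier GH. g = t \<otimes>\<^bsub>GH\<^esub> diag m h)"
  proof -
    obtain \<tau> where \<tau>: "\<forall>y\<in>{1..m}. \<tau> y \<in> H \<and> root_perm (\<tau> y) 1 = y"
      using letter_representatives by (rule exE)
    show ?thesis
    proof (intro exI[of _ "\<tau> ` {1..m}"] conjI ballI)
      show "\<tau> ` {1..m} \<subseteq> carrier GH" using \<tau> by auto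
      fix g assume "g \<in> carrier GH"
      then have "g \<in> H" by (simp only: GH_simps)
      from transversal_H[OF \<tau> this]
      show "\<exists>t\<in>\<tau> ` {1..m}. \<exists>h\<in>carrier GH. g = t \<otimes>\<^bsub>GH\<^esub> diag m h"
        by (simp only: GH_simps(1) bex_simps(7))
    qed simp
  qed
qed

end


section \<open>The theorem on the diagonal-topological closure\<close>

lemma tree_limit_unique:
  assumes m: "m \<ge> 1"
    and lim: "limitin (tree_topology m) f l sequentially" "limitin (tree_topology m) f l' sequentially"
  shows "l = l'"
proof (rule agree_all_eq)
  note L = lim[unfolded tree_limitin_iff[OF m]]
  show "l \<in> tree_automs m" by (rule conjunct1[OF L(1)])
  show "l' \<in> tree_automs m" by (rule conjunct1[OF L(2)])
  fix N
  have "\<forall>\<^sub>F k in sequentially. (f k \<in> tree_automs m \<and> agree m N (f k) l) \<and> (f k \<in> tree_automs m \<and> agree m N (f k) l')"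
    by (rule eventually_conj) (rule spec[OF conjunct2[OF L(1)]], rule spec[OF conjunct2[OF L(2)]])
  then obtain k where "agree m N (f k) l" "agree m N (f k) l'"
    using eventually_happens'[OF sequentially_bot] by blast
  then show "agree m N l l'" using agree_sym agree_trans by blast
qed

text \<open>
  An \<open>m\<close>-adic integer, being a family of residues, is itself a sequence of integers; as such it converges to itself.
  This sequence pins down the limit that defines a power with \<open>m\<close>-adic exponent.
\<close>

lemma madic_tendsto_self:
  assumes "m \<ge> 1" "\<xi> \<in> carrier (madic_ring m)"
  shows "madic_tendsto m \<xi> \<xi>"
  unfolding madic_tendsto_def
proof
  fix i
  have "\<xi> k mod int m ^ i = \<xi> i" if "i \<le> k" for k
    using madic_carrier_cong_le[OF assms that] assms by (simp add: cong_def madic_carrier_iff)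
  then show "\<forall>\<^sub>F k in sequentially. \<xi> k mod int m ^ i = \<xi> i"
    by (rule eventually_sequentiallyI)
qed

context complete_self_similar
begin

interpretation adic_group GH "diag m" m
  by (rule adic)

lemma near_iff_agree:
  assumes "g \<in> H" "h \<in> H"
  shows "near N g h \<longleftrightarrow> agree m N g h"
  unfolding near_def agree_iff_coset[OF assms] GH_simps using assms by blast

lemma near_H: "near N g h \<Longrightarrow> g \<in> H" "near N g h \<Longrightarrow> h \<in> H"
  by (simp_all only: near_def GH_simps)

lemma near_agree: "near N g h \<Longrightarrow> agree m N g h"
  using near_H near_iff_agree by blast

lemma limitin_H:
  assumes "l \<in> H" "\<And>N. \<forall>\<^sub>F k in F. near N (f k) l"
  shows "limitin (tree_topology m) f l F"
  unfolding tree_limitin_iff[OF m_ge]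
proof (intro conjI allI)
  show "l \<in> tree_automs m" by (rule H_autom[OF assms(1)])
  fix N
  show "\<forall>\<^sub>F k in F. f k \<in> tree_automs m \<and> agree m N (f k) l"
    using assms(2)[of N] by (rule eventually_mono) (simp add: near_agree H_autom[OF near_H(1)])
qed

lemma madic_power_near:
  assumes \<xi>: "\<xi> \<in> carrier (madic_ring m)" and \<alpha>: "\<alpha> \<in> H"
  shows "near N (madic_power m \<xi> \<alpha>) (\<alpha> [^]\<^bsub>GH\<^esub> \<xi> N)"
proof -
  have \<alpha>G: "\<alpha> \<in> carrier GH" using \<alpha> by (simp only: GH_simps)
  have pow_near: "near N (\<alpha> [^]\<^bsub>GH\<^esub> c) (\<alpha> [^]\<^bsub>GH\<^esub> d)" if "[c = d] (mod int m ^ N)" for c d N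
    by (rule near_int_pow_cong[OF \<alpha>G that])
  have pH: "\<alpha> [^]\<^bsub>GH\<^esub> (c :: int) \<in> H" for c
    using int_pow_closed[OF \<alpha>G, of c] by (simp only: GH_simps)
  have step: "agree m N (\<alpha> [^]\<^bsub>GH\<^esub> \<xi> (Suc N)) (\<alpha> [^]\<^bsub>GH\<^esub> \<xi> N)" for N
    by (rule near_agree[OF pow_near[OF madic_carrier_cong[OF m_ge \<xi>]]])
  obtain \<beta> where \<beta>: "\<beta> \<in> H" "\<forall>N. agree m N \<beta> (\<alpha> [^]\<^bsub>GH\<^esub> \<xi> N)"
    using limit_in_H[of "\<lambda>N. \<alpha> [^]\<^bsub>GH\<^esub> \<xi> N", OF pH step] by blast
  have \<beta>_near: "near N \<beta> (\<alpha> [^]\<^bsub>GH\<^esub> \<xi> N)" for N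
    using \<beta>(2) near_iff_agree[OF \<beta>(1) pH] by blast
  have lim: "limitin (tree_topology m) (\<lambda>k. \<alpha> [^]\<^bsub>tree_aut_group m\<^esub> n k) \<beta> sequentially"
    if n: "madic_tendsto m n \<xi>" for n
  proof (rule limitin_H[OF \<beta>(1)])
    fix N
    have "\<forall>\<^sub>F k in sequentially. n k mod int m ^ N = \<xi> N" using n by (simp add: madic_tendsto_def)
    then show "\<forall>\<^sub>F k in sequentially. near N (\<alpha> [^]\<^bsub>tree_aut_group m\<^esub> n k) \<beta>"
    proof (rule eventually_mono)
      fix k assume k: "n k mod int m ^ N = \<xi> N"
      have "[n k = \<xi> N] (mod int m ^ N)" by (simp add: cong_def flip: k)
      then have "near N (\<alpha> [^]\<^bsub>GH\<^esub> n k) \<beta>"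
        by (rule near_trans[OF pow_near near_sym[OF \<beta>_near]])
      then show "near N (\<alpha> [^]\<^bsub>tree_aut_group m\<^esub> n k) \<beta>"
        using group.int_pow_consistent[OF tree_group H_subgroup \<alpha>] by simp
    qed
  qed
  have "madic_power m \<xi> \<alpha> = \<beta>"
    unfolding madic_power_def
  proof (rule the_equality)
    show "\<forall>n. madic_tendsto m n \<xi> \<longrightarrow> limitin (tree_topology m) (\<lambda>k. \<alpha> [^]\<^bsub>tree_aut_group m\<^esub> n k) \<beta> sequentially"
      using lim by blast
    fix \<gamma> assume "\<forall>n. madic_tendsto m n \<xi> \<longrightarrow> limitin (tree_topology m) (\<lambda>k. \<alpha> [^]\<^bsub>tree_aut_group m\<^esub> n k) \<gamma> sequentially"
    then have "limitin (tree_topology m) (\<lambda>k. \<alpha> [^]\<^bsub>tree_aut_group m\<^esub> \<xi> k) \<gamma> sequentially"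
      using madic_tendsto_self[OF m_ge \<xi>] by blast
    then show "\<gamma> = \<beta>" by (rule tree_limit_unique[OF m_ge _ lim[OF madic_tendsto_self[OF m_ge \<xi>]]])
  qed
  then show ?thesis using \<beta>_near by simp
qed

text \<open>
  The partial products in the definition of the action are the partial sums of a series in the sense of the \<open>x\<close>-adic
  topology, so the limit in the tree is the sum of that series.
\<close>

lemma power_series_action_near:
  assumes A: "astar m A = H" and q: "q \<in> carrier (madic_series m)" and \<alpha>: "\<alpha> \<in> H"
  shows "near N (power_series_action m A q \<alpha>) (act (residue_series N q) \<alpha>)"
proof -
  define h where "h i = madic_power m (q i) \<alpha>" for i
  have qi: "q i \<in> carrier (madic_ring m)" for i using q by (simp add: series_carrier_iff)
  have h_near: "near N (h i) (\<alpha> [^]\<^bsub>GH\<^esub> q i N)" for i N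
    unfolding h_def by (rule madic_power_near[OF qi \<alpha>])
  have hG: "h i \<in> carrier GH" for i by (rule near_closed(1)[OF h_near])
  have sH: "series h \<in> H" using series_closed[of h] hG by (simp only: GH_simps)
  have lim: "limitin (tree_topology m) (partial h) (series h) sequentially"
  proof (rule limitin_H[OF sH])
    fix N
    have "near N (partial h k) (series h)" if "N \<le> k" for k
      by (rule near_mono[OF near_sym[OF series_near[OF hG]] that])
    then show "\<forall>\<^sub>F k in sequentially. near N (partial h k) (series h)"
      by (rule eventually_sequentiallyI)
  qed
  have "power_series_action m A q \<alpha> =
      (THE \<beta>. limitin (tree_topology m) (partial h) \<beta> sequentially)"
    unfolding power_series_action_def A partial_def h_def ..
  also have "\<dots> = series h"
    by (rule the_equality[where P = "\<lambda>\<beta>. limitin (tree_topology m) (partial h) \<beta> sequentially", OF lim])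
      (rule tree_limit_unique[OF m_ge _ lim])
  finally have eq: "power_series_action m A q \<alpha> = series h" .
  show ?thesis
    unfolding eq act_def residue_series_nth by (rule series_cong_near[OF h_near])
qed

lemma module_finitely_presented:
  assumes A: "astar m A = H"
  shows "finitely_presented_module (madic_series m) (additive_module GH (power_series_action m A))"
proof -
  obtain \<tau> where \<tau>: "\<forall>y\<in>{1..m}. \<tau> y \<in> H \<and> root_perm (\<tau> y) 1 = y"
    using letter_representatives by (rule exE)
  \<comment> \<open>The letters are numbered from \<open>1\<close>, the basis of a free module from \<open>0\<close>.\<close>
  interpret adic_generators GH "diag m" m m "\<lambda>j. \<tau> (Suc j)"
  proof
    show "\<tau> (Suc j) \<in> carrier GH" if "j < m" for j using \<tau> that by simp
    fix g assume "g \<in> carrier GH"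
    then have "g \<in> H" by (simp only: GH_simps)
    from transversal_H[OF \<tau> this] obtain y k where y: "y \<in> {1..m}" and k: "k \<in> H" "g = \<tau> y \<otimes>\<^bsub>GH\<^esub> diag m k"
      by blast
    then have "y - 1 < m" "Suc (y - 1) = y" by auto
    then show "\<exists>j<m. \<exists>k\<in>carrier GH. g = \<tau> (Suc j) \<otimes>\<^bsub>GH\<^esub> diag m k"
      using k by (intro exI[of _ "y - 1"] conjI bexI[of _ k]) simp_all
  qed
  show ?thesis
    by (rule finitely_presented) (simp add: power_series_action_near[OF A])
qed

lemma level_stab_eq: "level_stab m H l = (diag m ^^ l) ` H"
  unfolding set_eq_iff level_stab_iff
proof
  fix g
  show "g \<in> H \<and> agree m l g id \<longleftrightarrow> g \<in> (diag m ^^ l) ` H"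
    using fixing_level diag_pow_fixes diag_pow_H by (metis image_iff)
qed

text \<open>
  The level stabilizers are the subgroups \<open>x\<^sup>i H\<close>. They contain \<open>m\<^sup>i H\<close>, because the exponent of \<open>H / x H\<close> divides
  \<open>m\<close>; conversely each \<open>m\<^sup>i H\<close> contains some \<open>x\<^sup>l H\<close>, as \<open>H\<close> is torsion-free.
\<close>

lemma torsion_free_case:
  assumes tf: "torsion_free_group GH"
  shows "finitely_generated_module (madic_ring m) (additive_module GH (madic_power m)) \<and> pro_m_group m H"
proof -
  have sm: "\<forall>a\<in>carrier (madic_ring m). \<forall>g\<in>carrier GH. \<forall>N. near N (madic_power m a g) (g [^]\<^bsub>GH\<^esub> a N)"
    by (simp add: madic_power_near)
  let ?M = "\<lambda>i. nth_multiples GH (m ^ i)"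
  let ?N = "level_stab m (tree_automs m)"
  have stab: "\<exists>l\<ge>1. level_stab m H l \<subseteq> ?M i" for i
    using torsion_free_madic(2)[OF tf sm, of i] by (simp only: level_stab_eq GH_simps)
  have HN: "H \<inter> ?N l = level_stab m H l" for l
    using H_autom by (auto simp: level_stab_iff)
  interpret chain: subgroup_chain "tree_aut_group m" ?N by (rule level_stab_chain[OF m_ge])
  interpret HN: subgroup_chain GH "\<lambda>i. H \<inter> ?N i" by (rule chain.subgroup_chain_restrict[OF H_subgroup])
  have "subtopology (tree_topology m) H = coset_topology GH (\<lambda>i. H \<inter> ?N i)"
    unfolding tree_topology_def by (rule chain.subtopology_coset_topology[OF H_subgroup])
  also have "\<dots> = coset_topology GH ?M"
  proof (rule HN.coset_topology_cofinal)
    show "subgroup_chain GH ?M" by (rule nth_multiples_chain) (use m_ge in simp)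
    show "\<exists>j. H \<inter> ?N j \<subseteq> ?M i" for i using stab[of i] unfolding HN by blast
    have "?M i \<subseteq> H \<inter> ?N i" for i
    proof
      fix a assume "a \<in> ?M i"
      then obtain b where b: "b \<in> carrier GH" "a = b [^]\<^bsub>GH\<^esub> (m ^ i)"
        unfolding nth_multiples_def by (rule imageE)
      then have "near i a \<one>\<^bsub>GH\<^esub>" by (simp only: near_pow_m)
      then have "a \<in> (diag m ^^ i) ` H" unfolding near_one_iff by (simp only: GH_simps)
      then show "a \<in> H \<inter> ?N i" unfolding HN level_stab_eq .
    qed
    then show "\<exists>j. ?M j \<subseteq> H \<inter> ?N i" for i by blast
  qed
  finally have top: "subtopology (tree_topology m) H = coset_topology GH ?M" .
  show ?thesis
    unfolding pro_m_group_def using torsion_free_madic(1)[OF tf sm] stab top by blast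
qed

end


theorem theorem1:
  fixes m :: nat and A :: "(nat list \<Rightarrow> nat list) set"
  assumes "m \<ge> 2"
    and "subgroup A (tree_aut_group m)"
    and "comm_group (tree_subgroup m A)"
    and "transitive_on_letters m A"
    and "state_closed m A"
  shows "finitely_presented_module (power_series_ring (madic_ring m)) (astar_power_series_module m A) \<and>
    (torsion_free_group (tree_subgroup m (astar m A)) \<longrightarrow>
       finitely_generated_module (madic_ring m) (astar_madic_module m A) \<and>
       pro_m_group m (astar m A))"
proof -
  have "self_similar_abelian m A"
  proof (rule self_similar_abelian.intro)
    show "m \<ge> 1" using assms(1) by simp
    show "subgroup A (tree_aut_group m)" by (rule assms(2))
    show "g \<circ> h = h \<circ> g" if "g \<in> A" "h \<in> A" for g h
      using comm_groupE(4)[OF assms(3), of h g] that by simp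
    show "section_at g y \<in> A" if "g \<in> A" "y \<in> {1..m}" for g y
    proof -
      have "[y] \<in> words m" using that(2) by simp
      then have "state g [y] \<in> A" using assms(5) that(1) unfolding state_closed_def by blast
      then show ?thesis by simp
    qed
    show "\<exists>g\<in>A. root_perm g i = j" if "i \<in> {1..m}" "j \<in> {1..m}" for i j
      using assms(4) that unfolding transitive_on_letters_def perm_group_on_letters_def by blast
  qed
  then interpret A: self_similar_abelian m A .
  interpret D: self_similar_diag m "diagonal_closure m A" by (rule A.diagonal_closure_self_similar)
  interpret complete_self_similar m "astar m A"
    unfolding astar_def by (rule D.closure_self_similar)
  show ?thesis
    unfolding astar_power_series_module_def astar_madic_module_def
    using module_finitely_presented[OF refl] torsion_free_case by blast
qed

end
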